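(* Let $\alpha_1,\alpha_2$ be two generic holomorphic twist forms of charge $2$ on $\mathbb C^8\setminus\{0\}$ (for the diagonal $S^1$-action), where $\mathbb C^8$ carries its canonical $SU(8)$-structure $(\Omega_0,\omega_0)$. Denote by $\beta_1,\beta_2$ the forms resulting from the Gram–Schmidt process, and by $\xi$ the holomorphic Euler vector field. Then the forms $\Omega,\omega$ given by $$\Omega:=\frac{1}{\|\beta_1\|^2\|\beta_2\|^2}\,\overline{\beta_1}\wedge\overline{\beta_2}\wedge\big(\overline{\beta_1}\cdot\overline{\beta_2}\cdot\iota_\xi\Omega_0\big),\qquad -\omega=\omega_0-\frac{i}{\|\beta_1\|^2}\,\beta_1\wedge\overline{\beta_1}-\frac{i}{\|\beta_2\|^2}\,\beta_2\wedge\overline{\beta_2}$$ define a smooth $SU(7)$-structure on $\mathbb{CP}^7$ outside four generic projective lines in $\mathbb{CP}^7$.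
   Context: $\omega_0=\frac i2\sum_{j=1}^8dz_j\wedge d\overline{z_j}$, $\Omega_0=dz_1\wedge\cdots\wedge dz_8$, $\xi=\sum_jz_j\partial_{z_j}$ on $\mathbb C^8$ with its standard Hermitian metric. $SU(m)$-structure: on a smooth manifold of real dimension $2m$, a pair $(\Omega,\omega)$ with $\omega$ a nondegenerate real $2$-form and $\Omega$ a locally decomposable nowhere-vanishing complex $m$-form such that $\Omega\wedge\omega=0$ and $\Omega\wedge\overline\Omega=c_m\omega^m$, where $c_m=\frac{2^m}{m!}(-i)^{m^2}$. A holomorphic twist form of charge $2$ on $\mathbb C^8\setminus\{0\}$ is a nowhere-vanishing holomorphic $1$-form $\alpha$ with $\alpha(\xi)=0$ and $\mathcal L_\xi\alpha=2\alpha$; these are exactly the forms $\alpha_M={}^tZ\,M\,dZ=\sum_{i,j}z_im_{ij}dz_j$ with $M$ an invertible skew-symmetric $8\times8$ complex matrix. "Generic" is meant in the usual algebro-geometric sense, for the pair of matrices $(M_1,M_2)$ defining $\alpha_1,\alpha_2$. Contraction: for a $(1,0)$-form $\alpha=\sum_ja_jdz_j$, $\overline\alpha\cdot$ denotes contraction by $\overline\alpha^\sharp=\sum_j\overline{a_j}\,\partial_{z_j}$, and $\|\alpha\|^2:=\overline\alpha\cdot\alpha=\sum_j|a_j|^2$. Gram–Schmidt process: $\beta_1=\alpha_1$ and $\beta_2=P_{\alpha_1}(\alpha_2)=\alpha_2-\frac{\overline{\alpha_1}\cdot\alpha_2}{\|\alpha_1\|^2}\alpha_1$. Forms on (open invariant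 subsets of) $\mathbb C^8\setminus\{0\}$ define forms on (open subsets of) $\mathbb{CP}^7=S^7_{\mathbb C^8}/S^1$, where $S^7_{\mathbb C^8}=S^{15}$ is the unit sphere, when their pullbacks to $S^{15}$ are basic for the diagonal $S^1$-action.
   Formalization: With c_7 as given, the displayed pair satisfies Ω∧Ω̄ = −c_7 ω^7, so the literal claim fails by a sign; the statement proved is that Ω together with −ω = ω_0 − … − … (the displayed right-hand side) is the SU(7)-structure. *)

theory Defs
  imports "HOL-Analysis.Analysis"
begin

section \<open>Alternating forms at a point\<close>

text \<open>
  Differential forms are complex valued and real multilinear. A \<open>k\<close>-form at a point is a function
  on sequences of tangent vectors that reads only the first \<open>k\<close> of them; the degree is passed
  explicitly wherever it matters.
\<close>

type_synonym 'v form = "(nat \<Rightarrow> 'v) \<Rightarrow> complex"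

definition alternating_form :: "nat \<Rightarrow> 'v::real_vector form \<Rightarrow> bool" where
  "alternating_form k \<phi> \<longleftrightarrow>
     (\<forall>v w. (\<forall>i<k. v i = w i) \<longrightarrow> \<phi> v = \<phi> w) \<and>
     (\<forall>v. \<forall>i<k. linear (\<lambda>x. \<phi> (v(i := x)))) \<and>
     (\<forall>v. \<forall>i<k. \<forall>j<k. i \<noteq> j \<and> v i = v j \<longrightarrow> \<phi> v = 0)"

text \<open>
  The normalisation is the one for which \<open>(\<theta> \<and> \<eta>)(u, v) = \<theta>(u) \<eta>(v) - \<theta>(v) \<eta>(u)\<close> on 1-forms.
\<close>

definition wedge :: "nat \<Rightarrow> nat \<Rightarrow> 'v form \<Rightarrow> 'v form \<Rightarrow> 'v form" where
  "wedge p q \<phi> \<psi> v =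
     (\<Sum>\<sigma> | \<sigma> permutes {..<p + q}.
        of_int (sign \<sigma>) * \<phi> (\<lambda>i. v (\<sigma> i)) * \<psi> (\<lambda>i. v (\<sigma> (p + i)))) / (fact p * fact q)"

primrec wedge_list :: "'v form list \<Rightarrow> 'v form" where
  "wedge_list [] = (\<lambda>v. 1)"
| "wedge_list (\<theta> # \<theta>s) = wedge 1 (length \<theta>s) \<theta> (wedge_list \<theta>s)"

primrec wedge_power :: "nat \<Rightarrow> 'v form \<Rightarrow> nat \<Rightarrow> 'v form" where
  "wedge_power p \<phi> 0 = (\<lambda>v. 1)"
| "wedge_power p \<phi> (Suc n) = wedge p (p * n) \<phi> (wedge_power p \<phi> n)"

definition cnj_form :: "'v form \<Rightarrow> 'v form" where
  "cnj_form \<phi> = (\<lambda>v. cnj (\<phi> v))"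

definition contract :: "'v \<Rightarrow> 'v form \<Rightarrow> 'v form" where
  "contract u \<phi> = (\<lambda>v. \<phi> (case_nat u v))"

text \<open>
  Complexified tangent vectors \<open>x + \<i> y\<close> are pairs \<open>(x, y)\<close> of real tangent vectors, and contraction
  is extended complex linearly.
\<close>

definition ccontract :: "'v \<times> 'v \<Rightarrow> 'v form \<Rightarrow> 'v form" where
  "ccontract X \<phi> = (\<lambda>v. contract (fst X) \<phi> v + \<i> * contract (snd X) \<phi> v)"


section \<open>Smooth forms on manifolds\<close>

text \<open>Both notions are meant for open \<open>S\<close>.\<close>

primrec Ck_on :: "nat \<Rightarrow> 'a::euclidean_space set \<Rightarrow> ('a \<Rightarrow> 'b::real_normed_vector) \<Rightarrow> bool" where
  "Ck_on 0 S f \<longleftrightarrow> continuous_on S f"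
| "Ck_on (Suc k) S f \<longleftrightarrow>
     (\<forall>x\<in>S. f differentiable (at x)) \<and> (\<forall>v. Ck_on k S (\<lambda>x. frechet_derivative f (at x) v))"

definition smooth_on :: "'a::euclidean_space set \<Rightarrow> ('a \<Rightarrow> 'b::real_normed_vector) \<Rightarrow> bool" where
  "smooth_on S f \<longleftrightarrow> (\<forall>k. Ck_on k S f)"

definition smooth_form_on ::
    "nat \<Rightarrow> 'a::euclidean_space set \<Rightarrow> ('a \<Rightarrow> 'a form) \<Rightarrow> bool" where
  "smooth_form_on k S \<theta> \<longleftrightarrow>
     (\<forall>x\<in>S. alternating_form k (\<theta> x)) \<and> (\<forall>v. smooth_on S (\<lambda>x. \<theta> x v))"

definition pullback ::
    "('a::real_normed_vector \<Rightarrow> 'b::real_normed_vector) \<Rightarrow> ('b \<Rightarrow> 'b form) \<Rightarrow> 'a \<Rightarrow> 'a form" where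
  "pullback f \<theta> x v = \<theta> (f x) (\<lambda>i. frechet_derivative f (at x) (v i))"

text \<open>
  A chart is a domain together with a coordinate map, and a manifold is given by a smooth atlas.
  A differential form is the family of its coordinate expressions, indexed by the charts.
\<close>

type_synonym ('a, 'e) chart = "'a set \<times> ('a \<Rightarrow> 'e)"

definition smooth_atlas :: "'a set \<Rightarrow> ('a, 'e::euclidean_space) chart set \<Rightarrow> bool" where
  "smooth_atlas X A \<longleftrightarrow>
     (\<Union>(U, \<phi>)\<in>A. U) = X \<and>
     (\<forall>(U, \<phi>)\<in>A. inj_on \<phi> U \<and> open (\<phi> ` U)) \<and>
     (\<forall>(U, \<phi>)\<in>A. \<forall>(V, \<psi>)\<in>A.
        open (\<phi> ` (U \<inter> V)) \<and> smooth_on (\<phi> ` (U \<inter> V)) (\<psi> \<circ> inv_into U \<phi>))"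

type_synonym ('a, 'e) mform = "('a, 'e) chart \<Rightarrow> 'e \<Rightarrow> 'e form"

definition differential_form ::
    "nat \<Rightarrow> ('a, 'e::euclidean_space) chart set \<Rightarrow> ('a, 'e) mform \<Rightarrow> bool" where
  "differential_form k A \<theta> \<longleftrightarrow>
     (\<forall>(U, \<phi>)\<in>A. smooth_form_on k (\<phi> ` U) (\<theta> (U, \<phi>))) \<and>
     (\<forall>(U, \<phi>)\<in>A. \<forall>(V, \<psi>)\<in>A. \<forall>x\<in>\<phi> ` (U \<inter> V).
        \<theta> (U, \<phi>) x = pullback (\<psi> \<circ> inv_into U \<phi>) (\<theta> (V, \<psi>)) x)"


section \<open>\<open>SU(m)\<close>-structures\<close>

definition locally_decomposable ::
    "nat \<Rightarrow> 'a::euclidean_space set \<Rightarrow> ('a \<Rightarrow> 'a form) \<Rightarrow> bool" where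
  "locally_decomposable m S \<Omega> \<longleftrightarrow>
     (\<forall>x\<in>S. \<exists>N \<theta>s. open N \<and> x \<in> N \<and> N \<subseteq> S \<and> length \<theta>s = m \<and>
        (\<forall>\<theta>\<in>set \<theta>s. smooth_form_on 1 N \<theta>) \<and>
        (\<forall>y\<in>N. \<Omega> y = wedge_list (map (\<lambda>\<theta>. \<theta> y) \<theta>s)))"

definition nondegenerate :: "'v::real_vector form \<Rightarrow> bool" where
  "nondegenerate \<phi> \<longleftrightarrow> (\<forall>u. u \<noteq> 0 \<longrightarrow> (\<exists>v. contract u \<phi> v \<noteq> 0))"

definition SU_constant :: "nat \<Rightarrow> complex" where
  "SU_constant m = 2 ^ m / fact m * (- \<i>) ^ (m\<^sup>2)"

definition SU_structure ::
    "nat \<Rightarrow> 'a set \<Rightarrow> ('a, 'e::euclidean_space) chart set \<Rightarrow> ('a, 'e) mform \<Rightarrow> ('a, 'e) mform \<Rightarrow> bool"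
  where
  "SU_structure m X A \<Omega> \<omega> \<longleftrightarrow>
     smooth_atlas X A \<and> DIM('e) = 2 * m \<and>
     differential_form m A \<Omega> \<and> differential_form 2 A \<omega> \<and>
     (\<forall>(U, \<phi>)\<in>A. locally_decomposable m (\<phi> ` U) (\<Omega> (U, \<phi>))) \<and>
     (\<forall>(U, \<phi>)\<in>A. \<forall>x\<in>\<phi> ` U.
        let \<Omega>x = \<Omega> (U, \<phi>) x; \<omega>x = \<omega> (U, \<phi>) x in
        (\<forall>v. \<omega>x v \<in> \<real>) \<and> nondegenerate \<omega>x \<and>
        \<Omega>x \<noteq> (\<lambda>v. 0) \<and>
        wedge m 2 \<Omega>x \<omega>x = (\<lambda>v. 0) \<and>
        wedge m m \<Omega>x (cnj_form \<Omega>x) = (\<lambda>v. SU_constant m * wedge_power 2 \<omega>x m v))"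


section \<open>Complex projective space\<close>

text \<open>
  Points are complex lines through the origin; restricted to the unit sphere, \<open>cline\<close> is the quotient
  map by the diagonal circle action.
\<close>

definition cline :: "complex^'n \<Rightarrow> (complex^'n) set" where
  "cline z = range (\<lambda>c. c *s z)"

definition projectivization :: "(complex^'n) set \<Rightarrow> (complex^'n) set set" where
  "projectivization W = {cline z |z. z \<in> W \<and> z \<noteq> 0}"

abbreviation CP :: "(complex^'n) set set" where
  "CP \<equiv> projectivization UNIV"

text \<open>
  The affine chart \<open>[z] \<mapsto> (z\<^sub>k / z\<^sub>j)\<close>, \<open>k \<noteq> j\<close>, on \<open>z\<^sub>j \<noteq> 0\<close>. The coordinates \<open>k \<noteq> j\<close> are numbered by a
  bijection \<open>e\<close> from the index type \<open>'m\<close>, and every numbering is admitted.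
\<close>

definition affine_coords :: "'n \<Rightarrow> ('m \<Rightarrow> 'n) \<Rightarrow> (complex^'n) set \<Rightarrow> complex^'m" where
  "affine_coords j e L = (\<chi> k. (THE z. z \<in> L \<and> z $ j = 1) $ e k)"

definition CP_atlas ::
    "(complex^'n) set set \<Rightarrow> ((complex^'n) set, complex^'m) chart set" where
  "CP_atlas X = {({cline z |z. z $ j \<noteq> 0} \<inter> X, affine_coords j e) |j e. bij_betw e UNIV (UNIV - {j})}"

text \<open>
  The ambient form \<open>\<Theta>\<close> defines the form \<open>\<theta>\<close> on the open subset \<open>X\<close> of projective space: the pullback of
  \<open>\<theta>\<close> to the part of the unit sphere above \<open>X\<close> equals the restriction of \<open>\<Theta>\<close> to vectors tangent to
  the sphere. Such a \<open>\<theta>\<close> exists exactly if the restriction of \<open>\<Theta>\<close> is smooth and basic for the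
  circle action, and is then unique.
\<close>

definition defines_form ::
    "nat \<Rightarrow> (complex^'n) set set \<Rightarrow> (complex^'n \<Rightarrow> (complex^'n) form)
      \<Rightarrow> ((complex^'n) set, complex^'m) mform \<Rightarrow> bool" where
  "defines_form k X \<Theta> \<theta> \<longleftrightarrow>
     differential_form k (CP_atlas X) \<theta> \<and>
     (\<forall>(U, \<phi>)\<in>CP_atlas X. \<forall>p. norm p = 1 \<and> cline p \<in> U \<longrightarrow>
        (\<forall>v. (\<forall>i<k. p \<bullet> v i = 0) \<longrightarrow> \<Theta> p v = pullback (\<phi> \<circ> cline) (\<theta> (U, \<phi>)) p v))"


section \<open>Complex forms and holomorphic twist forms\<close>

text \<open>
  A \<open>(1,0)\<close>-form \<open>\<Sum>\<^sub>j a\<^sub>j dz\<^sub>j\<close> is represented by its coefficient vector \<open>a\<close>, and a vector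
  \<open>\<Sum>\<^sub>j u\<^sub>j \<partial>\<^sub>z\<^sub>j\<close> of type \<open>(1,0)\<close> by \<open>u\<close>. As a complexified real vector the latter is \<open>(u - \<i> J u) / 2\<close>.
\<close>

definition form10 :: "complex^'n \<Rightarrow> (complex^'n) form" where
  "form10 a v = (\<Sum>j\<in>UNIV. a $ j * v 0 $ j)"

definition vec10 :: "complex^'n \<Rightarrow> (complex^'n) \<times> (complex^'n)" where
  "vec10 u = ((1 / 2) *s u, (- (\<i> / 2)) *s u)"

abbreviation dz :: "'n \<Rightarrow> (complex^'n) form" where
  "dz j \<equiv> form10 (axis j 1)"

definition sharp_cnj :: "complex^'n \<Rightarrow> (complex^'n) \<times> (complex^'n)" where
  "sharp_cnj a = vec10 (\<chi> j. cnj (a $ j))"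

definition holomorphic_map_on :: "(complex^'n) set \<Rightarrow> (complex^'n \<Rightarrow> complex^'m) \<Rightarrow> bool" where
  "holomorphic_map_on S f \<longleftrightarrow>
     (\<forall>z\<in>S. \<exists>D. (f has_derivative D) (at z) \<and> (\<forall>c v. D (c *s v) = c *s D v))"

text \<open>
  The Lie derivative of a \<open>k\<close>-form on an open subset of a vector space, evaluated on constant vector
  fields \<open>v\<^sub>i\<close>, for which \<open>[X, v\<^sub>i] = - DX(v\<^sub>i)\<close>; it is extended complex linearly in the vector field.
\<close>

definition lie_derivative ::
    "nat \<Rightarrow> ('v::real_normed_vector \<Rightarrow> 'v) \<Rightarrow> ('v \<Rightarrow> 'v form) \<Rightarrow> 'v \<Rightarrow> 'v form" where
  "lie_derivative k X \<theta> p v =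
     frechet_derivative (\<lambda>q. \<theta> q v) (at p) (X p) +
     (\<Sum>i<k. \<theta> p (v(i := frechet_derivative X (at p) (v i))))"

definition clie_derivative ::
    "nat \<Rightarrow> ('v::real_normed_vector \<Rightarrow> 'v \<times> 'v) \<Rightarrow> ('v \<Rightarrow> 'v form) \<Rightarrow> 'v \<Rightarrow> 'v form" where
  "clie_derivative k X \<theta> p v =
     lie_derivative k (\<lambda>q. fst (X q)) \<theta> p v + \<i> * lie_derivative k (\<lambda>q. snd (X q)) \<theta> p v"

definition euler :: "complex^'n \<Rightarrow> (complex^'n) \<times> (complex^'n)" where
  "euler z = vec10 z"

definition holomorphic_twist_form :: "complex \<Rightarrow> (complex^'n \<Rightarrow> complex^'n) \<Rightarrow> bool" where
  "holomorphic_twist_form q \<alpha> \<longleftrightarrow>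
     holomorphic_map_on (- {0}) \<alpha> \<and>
     (\<forall>z. z \<noteq> 0 \<longrightarrow>
        \<alpha> z \<noteq> 0 \<and>
        (\<forall>v. ccontract (euler z) (form10 (\<alpha> z)) v = 0) \<and>
        (\<forall>v. clie_derivative 1 euler (\<lambda>w. form10 (\<alpha> w)) z v = q * form10 (\<alpha> z) v))"

text \<open>\<open>\<alpha>\<^sub>M = \<^sup>tZ M dZ\<close> has the coefficients \<open>\<Sum>\<^sub>i z\<^sub>i m\<^sub>i\<^sub>j\<close>.\<close>

definition matrix_form :: "complex^'n^'n \<Rightarrow> complex^'n \<Rightarrow> complex^'n" where
  "matrix_form M z = z v* M"


section \<open>The forms \<open>\<Omega>\<close> and \<open>\<omega>\<close>\<close>

definition Omega0 :: "(complex^8) form" where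
  "Omega0 = wedge_list (map dz [1, 2, 3, 4, 5, 6, 7, 8])"

definition omega0 :: "(complex^8) form" where
  "omega0 v = \<i> / 2 * (\<Sum>j\<in>UNIV. wedge 1 1 (dz j) (cnj_form (dz j)) v)"

definition norm_sq :: "complex^'n \<Rightarrow> complex" where
  "norm_sq a = of_real ((norm a)\<^sup>2)"

definition herm :: "complex^'n \<Rightarrow> complex^'n \<Rightarrow> complex" where
  "herm a b = (\<Sum>j\<in>UNIV. cnj (a $ j) * b $ j)"

definition gram_schmidt2 :: "complex^'n \<Rightarrow> complex^'n \<Rightarrow> complex^'n" where
  "gram_schmidt2 a1 a2 = a2 - (herm a1 a2 / norm_sq a1) *s a1"

definition twisted_Omega ::
    "(complex^8 \<Rightarrow> complex^8) \<Rightarrow> (complex^8 \<Rightarrow> complex^8) \<Rightarrow> complex^8 \<Rightarrow> (complex^8) form" where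
  "twisted_Omega \<alpha>1 \<alpha>2 z v =
     (let b1 = \<alpha>1 z; b2 = gram_schmidt2 (\<alpha>1 z) (\<alpha>2 z) in
      1 / (norm_sq b1 * norm_sq b2) *
      wedge 1 6 (cnj_form (form10 b1))
        (wedge 1 5 (cnj_form (form10 b2))
          (ccontract (sharp_cnj b1) (ccontract (sharp_cnj b2) (ccontract (euler z) Omega0)))) v)"

text \<open>
  Beware of the overall sign: \<open>- twisted_omega\<close> is the form \<open>\<i> / 2 * (\<Sum>\<^sub>j f\<^sub>j \<and> cnj f\<^sub>j)\<close> of a unitary
  coframe for which \<open>\<Omega>\<close> is a unit multiple of \<open>f\<^sub>1 \<and> \<dots> \<and> f\<^sub>7\<close>. As \<open>7\<close> is odd, the normalisation
  \<open>\<Omega> \<and> cnj \<Omega> = c\<^sub>7 \<sigma>\<^sup>7\<close> holds for \<open>\<sigma> = - twisted_omega\<close> and fails for \<open>\<sigma> = twisted_omega\<close>.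
\<close>

definition twisted_omega ::
    "(complex^8 \<Rightarrow> complex^8) \<Rightarrow> (complex^8 \<Rightarrow> complex^8) \<Rightarrow> complex^8 \<Rightarrow> (complex^8) form" where
  "twisted_omega \<alpha>1 \<alpha>2 z v =
     (let b1 = \<alpha>1 z; b2 = gram_schmidt2 (\<alpha>1 z) (\<alpha>2 z) in
      - (omega0 v
         - \<i> / norm_sq b1 * wedge 1 1 (form10 b1) (cnj_form (form10 b1)) v
         - \<i> / norm_sq b2 * wedge 1 1 (form10 b2) (cnj_form (form10 b2)) v))"


section \<open>Genericity\<close>

inductive_set polynomial_functions :: "('a \<Rightarrow> complex) set \<Rightarrow> ('a \<Rightarrow> complex) set"
  for C :: "('a \<Rightarrow> complex) set" where
  coord: "f \<in> C \<Longrightarrow> f \<in> polynomial_functions C"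
| const: "(\<lambda>x. c) \<in> polynomial_functions C"
| add: "f \<in> polynomial_functions C \<Longrightarrow> g \<in> polynomial_functions C \<Longrightarrow>
          (\<lambda>x. f x + g x) \<in> polynomial_functions C"
| mult: "f \<in> polynomial_functions C \<Longrightarrow> g \<in> polynomial_functions C \<Longrightarrow>
          (\<lambda>x. f x * g x) \<in> polynomial_functions C"

definition zariski_open_in :: "('a \<Rightarrow> complex) set \<Rightarrow> 'a set \<Rightarrow> 'a set \<Rightarrow> bool" where
  "zariski_open_in C X U \<longleftrightarrow>
     (\<exists>F \<subseteq> polynomial_functions C. U = {x \<in> X. \<exists>f\<in>F. f x \<noteq> 0})"

definition matrix_pair_coords :: "((complex^'n^'n) \<times> (complex^'n^'n) \<Rightarrow> complex) set" where
  "matrix_pair_coords = {\<lambda>(M, N). M $ i $ j |i j. True} \<union> {\<lambda>(M, N). N $ i $ j |i j. True}"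

definition invertible_skew :: "(complex^'n^'n) set" where
  "invertible_skew = {M. invertible M \<and> transpose M = - M}"

text \<open>
  The pairs of invertible skew matrices are irreducible (open in a vector space), so nonempty
  Zariski open subsets are dense.
\<close>

definition generic_skew_pair :: "(complex^'n^'n \<Rightarrow> complex^'n^'n \<Rightarrow> bool) \<Rightarrow> bool" where
  "generic_skew_pair P \<longleftrightarrow>
     (\<exists>U. zariski_open_in matrix_pair_coords (invertible_skew \<times> invertible_skew) U \<and> U \<noteq> {} \<and>
          (\<forall>(M1, M2)\<in>U. P M1 M2))"

text \<open>
  Four lines in seven-dimensional projective space are in general position if the corresponding
  planes span, so that their sum is direct. Such configurations form a single orbit, which is open
  and dense, of the projective linear group on all quadruples of lines.
\<close>

definition four_generic_lines :: "(4 \<Rightarrow> (complex^8) set) \<Rightarrow> bool" where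
  "four_generic_lines W \<longleftrightarrow>
     (\<forall>k. vec.subspace (W k) \<and> vec.dim (W k) = 2) \<and> vec.span (\<Union>k. W k) = UNIV"

end

theory Submission
  imports Defs "HOL-Computational_Algebra.Fundamental_Theorem_Algebra"
begin

text \<open>
  Fix a pair of invertible skew matrices and a point \<open>z \<noteq> 0\<close>, and let \<open>b\<^sub>1, b\<^sub>2\<close> be the coefficient vectors of
  the Gram-Schmidt forms at \<open>z\<close>. Skewness gives \<open>b\<^sub>1(z) = b\<^sub>2(z) = 0\<close>, so the three covectors
  \<open>\<Sum>\<^sub>j cnj z\<^sub>j dz\<^sub>j\<close>, \<open>b\<^sub>1\<close>, \<open>b\<^sub>2\<close> are mutually orthogonal. As long as \<open>b\<^sub>1\<close> and \<open>b\<^sub>2\<close> do not vanish, five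
  covectors \<open>t\<^sub>4, \<dots>, t\<^sub>8\<close> complete them, after normalisation, to a unitary basis. On the orthogonal complement of
  the complex line of \<open>z\<close>, the hermitian form is the sum of squares of the last seven members, and
  subtracting twice the \<open>b\<^sub>1\<close> and \<open>b\<^sub>2\<close> terms from the fundamental form amounts to replacing these two by
  their conjugates. Contracting the volume form with the vectors dual to the triple leaves a
  multiple of \<open>t\<^sub>4 \<and> \<dots> \<and> t\<^sub>8\<close>. So, at unit vectors \<open>z\<close> and with \<open>b\<^sub>1, b\<^sub>2\<close> normalised, both forms come from
  the single coframe \<open>cnj b\<^sub>1, cnj b\<^sub>2, t\<^sub>4, \<dots>, t\<^sub>8\<close>: one is its top product, up to a unit factor, the other is
  \<open>\<i>/2 \<Sum>\<^sub>k f\<^sub>k \<and> cnj f\<^sub>k\<close> (\<open>Omega_hat_eq\<close>, \<open>omega_hat_eq_coframe\<close>). The pointwise conditions of an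
  \<open>SU(m)\<close>-structure hold for any such pair; the products are computed by writing every form as
  the determinant of a list of linear functionals (\<open>wedge_dform_append\<close>, \<open>wedge_power_top\<close>).

  On the unit sphere the two forms agree with forms on the cone that are invariant under complex
  scaling and blind to the direction of \<open>z\<close>; on tangent vectors of the sphere the correction of the
  2-form by \<open>\<Sum>\<^sub>j cnj z\<^sub>j dz\<^sub>j\<close> vanishes, because that covector takes only imaginary values there. Invariant
  forms descend to projective space by pulling them back along the sections \<open>z\<^sub>j = 1\<close> of the affine
  charts (\<open>pullback_descended_form\<close>). All coefficients are rational in real coordinates, which
  settles smoothness, and projecting fixed covectors \<open>t\<^sub>k\<close> away from the moving triple gives a local
  decomposition with smooth factors (\<open>local_decomposition\<close>).

  It remains to see where \<open>b\<^sub>1\<close> or \<open>b\<^sub>2\<close> vanishes: where \<open>\<^sup>tz M\<^sub>1\<close> and \<open>\<^sup>tz M\<^sub>2\<close> are proportional, that is,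
  on the kernels of the singular members \<open>x M\<^sub>2 - M\<^sub>1\<close> of the pencil. A singular skew matrix of even
  size has a kernel of dimension at least two (\<open>skew_kernel_dim\<close>), and kernels for different \<open>x\<close> are
  independent, being eigenspaces. In dimension eight, four roots of \<open>det (x M\<^sub>2 - M\<^sub>1)\<close> therefore
  force exactly four planes, whose sum is direct and everything (\<open>degeneracy_planes\<close>). A nonzero polynomial
  \<open>q\<close> with fewer than four roots satisfies a nontrivial relation \<open>u q + w q' = 0\<close> with \<open>deg u < 3\<close> and
  \<open>deg w < 4\<close>, and the absence of such relations is the nonvanishing of some member of a family of
  polynomials in the entries of the pair; a pair of block matrices shows that this occurs (\<open>ex_generic_pair\<close>).
\<close>

section \<open>Products of linear functionals\<close>

text \<open>
  There is no factor \<open>1/n!\<close>. With this choice a product is the alternation of a tensor product divided by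
  the factorials that \<open>wedge\<close> contains, and the alternation of \<open>f\<^sub>1 \<otimes> \<dots> \<otimes> f\<^sub>n\<close> is a determinant.
\<close>
definition alternation :: "nat \<Rightarrow> 'v form \<Rightarrow> 'v form" where
  "alternation n T v = (\<Sum>\<sigma> | \<sigma> permutes {..<n}. of_int (sign \<sigma>) * T (\<lambda>i. v (\<sigma> i)))"

primrec tensor :: "('v \<Rightarrow> complex) list \<Rightarrow> 'v form" where
  "tensor [] = (\<lambda>v. 1)"
| "tensor (f # fs) = (\<lambda>v. f (v 0) * tensor fs (\<lambda>i. v (Suc i)))"

text \<open>
  The product \<open>f\<^sub>1 \<and> \<dots> \<and> f\<^sub>n\<close>; lists turn products into concatenations, see \<open>wedge_dform_append\<close>.
\<close>
definition dform :: "('v \<Rightarrow> complex) list \<Rightarrow> 'v form" where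
  "dform fs = alternation (length fs) (tensor fs)"

lemma wedge_eq_alternation:
  "wedge p q \<phi> \<psi> v = alternation (p + q) (\<lambda>v. \<phi> v * \<psi> (\<lambda>i. v (p + i))) v / (fact p * fact q)"
  by (simp add: wedge_def alternation_def mult.assoc)

lemma tensor_eq_prod: "tensor fs v = (\<Prod>i<length fs. (fs ! i) (v i))"
proof (induction fs arbitrary: v)
  case (Cons f fs)
  then show ?case by (simp add: prod.lessThan_Suc_shift del: prod.lessThan_Suc)
qed simp

lemma tensor_append: "tensor (fs @ gs) v = tensor fs v * tensor gs (\<lambda>i. v (length fs + i))"
  by (induction fs arbitrary: v) (simp_all add: mult.assoc)

lemma tensor_cong: "(\<And>i. i < length fs \<Longrightarrow> v i = w i) \<Longrightarrow> tensor fs v = tensor fs w"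
  by (simp add: tensor_eq_prod)

lemma alternation_permuted:
  assumes "\<tau> permutes {..<n}"
  shows "alternation n T (\<lambda>i. v (\<tau> i)) = of_int (sign \<tau>) * alternation n T v"
proof -
  have pm: "permutation \<tau>" using assms permutation_permutes by blast
  have "alternation n T v = (\<Sum>\<sigma> | \<sigma> permutes {..<n}. of_int (sign (\<tau> \<circ> \<sigma>)) * T (\<lambda>i. v ((\<tau> \<circ> \<sigma>) i)))"
    unfolding alternation_def by (rule setum_permutations_compose_left[OF assms])
  also have "\<dots> = of_int (sign \<tau>) * alternation n T (\<lambda>i. v (\<tau> i))"
    unfolding alternation_def sum_distrib_left
  proof (rule sum.cong[OF refl])
    fix \<sigma> assume "\<sigma> \<in> {\<sigma>. \<sigma> permutes {..<n}}"
    then have "permutation \<sigma>" using permutation_permutes by blast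
    then show "of_int (sign (\<tau> \<circ> \<sigma>)) * T (\<lambda>i. v ((\<tau> \<circ> \<sigma>) i)) =
      of_int (sign \<tau>) * (of_int (sign \<sigma>) * T (\<lambda>i. v (\<tau> (\<sigma> i))))"
      by (simp add: sign_compose pm)
  qed
  finally have "of_int (sign \<tau>) * alternation n T v =
    (of_int (sign \<tau>) * of_int (sign \<tau>)) * alternation n T (\<lambda>i. v (\<tau> i))" by simp
  also have "(of_int (sign \<tau>) * of_int (sign \<tau>) :: complex) = 1"
    by (simp add: sign_def)
  finally show ?thesis by simp
qed

lemma alternation_precompose:
  assumes "\<tau> permutes {..<n}"
  shows "alternation n (\<lambda>v. T (\<lambda>i. v (\<tau> i))) v = of_int (sign \<tau>) * alternation n T v"
proof -
  have pm: "permutation \<tau>" using assms permutation_permutes by blast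
  have "alternation n T v = (\<Sum>\<sigma> | \<sigma> permutes {..<n}. of_int (sign (\<sigma> \<circ> \<tau>)) * T (\<lambda>i. v ((\<sigma> \<circ> \<tau>) i)))"
    unfolding alternation_def by (rule sum_permutations_compose_right[OF assms])
  also have "\<dots> = of_int (sign \<tau>) * alternation n (\<lambda>v. T (\<lambda>i. v (\<tau> i))) v"
    unfolding alternation_def sum_distrib_left
  proof (rule sum.cong[OF refl])
    fix \<sigma> assume "\<sigma> \<in> {\<sigma>. \<sigma> permutes {..<n}}"
    then have "permutation \<sigma>" using permutation_permutes by blast
    then show "of_int (sign (\<sigma> \<circ> \<tau>)) * T (\<lambda>i. v ((\<sigma> \<circ> \<tau>) i)) =
      of_int (sign \<tau>) * (of_int (sign \<sigma>) * T (\<lambda>i. v (\<sigma> (\<tau> i))))"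
      by (simp add: sign_compose pm)
  qed
  finally have "of_int (sign \<tau>) * alternation n T v =
    (of_int (sign \<tau>) * of_int (sign \<tau>)) * alternation n (\<lambda>v. T (\<lambda>i. v (\<tau> i))) v" by simp
  also have "(of_int (sign \<tau>) * of_int (sign \<tau>) :: complex) = 1"
    by (simp add: sign_def)
  finally show ?thesis by simp
qed

lemma bij_betw_map_permutation:
  assumes "bij_betw f A B"
  shows "bij_betw (map_permutation A f) {\<sigma>. \<sigma> permutes A} {\<sigma>. \<sigma> permutes B}"
proof -
  have "f ` A = B" using assms by (simp add: bij_betw_def)
  then have "map_permutation A f = (\<lambda>\<pi> x. if x \<in> B then f (\<pi> (inv_into A f x)) else x)"
    by (simp add: map_permutation_def restrict_id_def fun_eq_iff)
  then show ?thesis using bij_betw_permutations[OF assms] by simp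
qed

lemma alternation_sum: "alternation n (\<lambda>v. \<Sum>x\<in>A. T x v) v = (\<Sum>x\<in>A. alternation n (T x) v)"
  unfolding alternation_def sum_distrib_left by (rule sum.swap)

lemma alternation_cmult: "alternation n (\<lambda>v. c * T v) v = c * alternation n T v"
  unfolding alternation_def sum_distrib_left by (simp add: algebra_simps)

lemma sign_cancel: "of_int (sign \<tau>) * (of_int (sign \<tau>) * x) = (x::complex)"
  by (simp add: sign_def)

text \<open>
  A permutation of the first \<open>p\<close> slots is absorbed by reindexing the outer sum, so each of the \<open>p!\<close> terms
  of the inner sum contributes the same amount.
\<close>
lemma alternation_alternation_left:
  "alternation (p + q) (\<lambda>v. alternation p S v * T (\<lambda>i. v (p + i))) v =
     fact p * alternation (p + q) (\<lambda>v. S v * T (\<lambda>i. v (p + i))) v"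
proof -
  have *: "alternation (p + q) (\<lambda>v. of_int (sign \<tau>) * (S (\<lambda>i. v (\<tau> i)) * T (\<lambda>i. v (p + i)))) v
      = alternation (p + q) (\<lambda>v. S v * T (\<lambda>i. v (p + i))) v"
    if t: "\<tau> permutes {..<p}" for \<tau>
  proof -
    have t': "\<tau> permutes {..<p+q}" using permutes_subset[OF t] by auto
    have fixed: "\<tau> (p + i) = p + i" for i
      using t by (simp add: permutes_def)
    have "alternation (p + q) (\<lambda>v. S (\<lambda>i. v (\<tau> i)) * T (\<lambda>i. v (p + i))) v
       = alternation (p + q) (\<lambda>v. (\<lambda>v. S v * T (\<lambda>i. v (p + i))) (\<lambda>i. v (\<tau> i))) v"
      by (simp add: fixed)
    also have "\<dots> = of_int (sign \<tau>) * alternation (p + q) (\<lambda>v. S v * T (\<lambda>i. v (p + i))) v"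
      by (rule alternation_precompose[OF t'])
    finally show ?thesis by (simp add: alternation_cmult sign_cancel)
  qed
  have "alternation (p + q) (\<lambda>v. alternation p S v * T (\<lambda>i. v (p + i))) v
     = (\<Sum>\<tau> | \<tau> permutes {..<p}. alternation (p + q) (\<lambda>v. of_int (sign \<tau>) * (S (\<lambda>i. v (\<tau> i)) * T (\<lambda>i. v (p + i)))) v)"
    unfolding alternation_sum[symmetric] by (simp add: alternation_def[of p] sum_distrib_right mult.assoc)
  also have "\<dots> = fact p * alternation (p + q) (\<lambda>v. S v * T (\<lambda>i. v (p + i))) v"
    by (simp add: * card_permutations[OF refl])
  finally show ?thesis .
qed

text \<open>
  As before, after moving the permutations of \<open>q\<close> slots up by \<open>p\<close>. The left factor must not notice them.
\<close>
lemma alternation_alternation_right: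
  assumes S: "\<And>v w. (\<And>i. i < p \<Longrightarrow> v i = w i) \<Longrightarrow> S v = S w"
  shows "alternation (p + q) (\<lambda>v. S v * alternation q T (\<lambda>i. v (p + i))) v =
     fact q * alternation (p + q) (\<lambda>v. S v * T (\<lambda>i. v (p + i))) v"
proof -
  have *: "alternation (p + q) (\<lambda>v. of_int (sign \<tau>) * (S v * T (\<lambda>i. v (p + \<tau> i)))) v
      = alternation (p + q) (\<lambda>v. S v * T (\<lambda>i. v (p + i))) v"
    if t: "\<tau> permutes {..<q}" for \<tau>
  proof -
    define \<tau>' where "\<tau>' = map_permutation {..<q} ((+) p) \<tau>"
    have bij: "bij_betw ((+) p) {..<q} {p..<p+q}"
      by (rule bij_betwI[where g = "\<lambda>i. i - p"]) auto
    have t1: "\<tau>' permutes {p..<p+q}"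
      unfolding \<tau>'_def by (rule map_permutation_permutes[OF bij t])
    have t2: "\<tau>' permutes {..<p+q}" by (rule permutes_subset[OF t1]) auto
    have low: "\<tau>' i = i" if "i < p" for i using t1 that by (simp add: permutes_def)
    have sg: "sign \<tau>' = sign \<tau>" unfolding \<tau>'_def
      by (rule sign_map_permutation) (use t bij in \<open>auto simp: bij_betw_def\<close>)
    have up: "\<tau>' (p + i) = p + \<tau> i" if "i < q" for i
      unfolding \<tau>'_def using that map_permutation_apply[of "(+) p" "{..<q}" i \<tau>] by auto
    have up': "\<tau>' (p + i) = p + \<tau> i" for i
    proof (cases "i < q")
      case False
      then show ?thesis using t t1 by (simp add: permutes_def)
    qed (rule up)
    have "S (\<lambda>i. v (\<tau>' i)) = S v" for v by (rule S) (simp add: low)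
    then have "alternation (p + q) (\<lambda>v. S v * T (\<lambda>i. v (p + \<tau> i))) v
       = alternation (p + q) (\<lambda>v. (\<lambda>v. S v * T (\<lambda>i. v (p + i))) (\<lambda>i. v (\<tau>' i))) v"
      by (simp add: up')
    also have "\<dots> = of_int (sign \<tau>') * alternation (p + q) (\<lambda>v. S v * T (\<lambda>i. v (p + i))) v"
      by (rule alternation_precompose[OF t2])
    finally show ?thesis by (simp add: alternation_cmult sg sign_cancel)
  qed
  have "alternation (p + q) (\<lambda>v. S v * alternation q T (\<lambda>i. v (p + i))) v
     = (\<Sum>\<tau> | \<tau> permutes {..<q}. alternation (p + q) (\<lambda>v. of_int (sign \<tau>) * (S v * T (\<lambda>i. v (p + \<tau> i)))) v)"
    unfolding alternation_sum[symmetric] by (simp add: alternation_def[of q] sum_distrib_left mult_ac)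
  also have "\<dots> = fact q * alternation (p + q) (\<lambda>v. S v * T (\<lambda>i. v (p + i))) v"
    by (simp add: * card_permutations[OF refl])
  finally show ?thesis .
qed

text \<open>
  The two factorials that come from alternating twice are those in the denominator of \<open>wedge\<close>.
\<close>
lemma wedge_dform_append:
  assumes "p = length fs" "q = length gs"
  shows "wedge p q (dform fs) (dform gs) = dform (fs @ gs)"
proof
  fix v
  let ?T = "\<lambda>v. tensor fs v * tensor gs (\<lambda>i. v (p + i))"
  have "alternation (p + q) (\<lambda>v. dform fs v * dform gs (\<lambda>i. v (p + i))) v
      = fact p * alternation (p + q) (\<lambda>v. tensor fs v * dform gs (\<lambda>i. v (p + i))) v"
    unfolding dform_def assms by (rule alternation_alternation_left)
  also have "\<dots> = fact p * (fact q * alternation (p + q) ?T v)"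
    unfolding dform_def[of gs] assms by (subst alternation_alternation_right) (auto intro: tensor_cong)
  finally show "wedge p q (dform fs) (dform gs) v = dform (fs @ gs) v"
    using assms by (simp add: wedge_eq_alternation dform_def[of "fs @ gs"] tensor_append alternation_def)
qed

lemma dform_Nil [simp]: "dform [] = (\<lambda>v. 1)"
proof -
  have "{\<sigma>. \<sigma> permutes {..<0::nat}} = {id}" by auto
  then show ?thesis by (simp add: dform_def alternation_def[abs_def])
qed

lemma dform_single: "dform [f] = (\<lambda>v. f (v 0))"
proof -
  have "{\<sigma>. \<sigma> permutes {..<Suc 0}} = {id}" by (auto simp: lessThan_Suc)
  then show ?thesis by (simp add: dform_def alternation_def[abs_def])
qed

lemma wedge_list_eq_dform: "wedge_list (map (\<lambda>f v. f (v 0)) fs) = dform fs"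
proof (induction fs)
  case (Cons f fs)
  then show ?case using wedge_dform_append[of 1 "[f]" "length fs" fs] by (simp add: dform_single)
qed simp

lemma dform_pair: "dform [f, g] v = f (v 0) * g (v 1) - f (v 1) * g (v 0)"
proof -
  have "\<sigma> permutes {..<2} \<longleftrightarrow> \<sigma> = id \<or> \<sigma> = Transposition.transpose 0 (1::nat)" for \<sigma>
    using permutes_doubleton_iff[of \<sigma> 0 1] by (simp add: numeral_2_eq_2 lessThan_Suc insert_commute)
  then have "{\<sigma>. \<sigma> permutes {..<2::nat}} = {id, Transposition.transpose 0 1}" by auto
  moreover have "id \<noteq> Transposition.transpose 0 (1::nat)" by (metis id_apply transpose_apply_first zero_neq_one)
  ultimately show ?thesis
    by (simp add: dform_def alternation_def numeral_2_eq_2 sign_swap_id)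
qed

lemma dform_permute_list:
  assumes "\<pi> permutes {..<length fs}"
  shows "dform (permute_list \<pi> fs) v = of_int (sign \<pi>) * dform fs v"
proof -
  let ?n = "length fs"
  have ip: "inv \<pi> permutes {..<?n}" by (rule permutes_inv[OF assms])
  have t: "tensor (permute_list \<pi> fs) v = tensor fs (\<lambda>i. v (inv \<pi> i))" for v
  proof -
    have "tensor (permute_list \<pi> fs) v = (\<Prod>i<?n. (fs ! \<pi> i) (v i))"
      by (simp add: tensor_eq_prod permute_list_nth[OF assms])
    also have "\<dots> = (\<Prod>i<?n. (fs ! i) (v (inv \<pi> i)))"
      using prod.reindex_bij_betw[OF permutes_imp_bij[OF assms], of "\<lambda>i. (fs ! i) (v (inv \<pi> i))"]
      by (simp add: permutes_inverses[OF assms])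
    finally show ?thesis by (simp add: tensor_eq_prod)
  qed
  have "dform (permute_list \<pi> fs) v = alternation ?n (\<lambda>v. tensor fs (\<lambda>i. v (inv \<pi> i))) v"
    unfolding dform_def using t by (simp add: fun_eq_iff alternation_def)
  also have "\<dots> = of_int (sign (inv \<pi>)) * dform fs v"
    unfolding dform_def by (rule alternation_precompose[OF ip])
  also have "sign (inv \<pi>) = sign \<pi>"
    using assms permutation_permutes by (blast intro: sign_inverse)
  finally show ?thesis .
qed

lemma dform_permuted_args:
  assumes "\<pi> permutes {..<length fs}"
  shows "dform fs (\<lambda>i. v (\<pi> i)) = of_int (sign \<pi>) * dform fs v"
  unfolding dform_def by (rule alternation_permuted[OF assms])

lemma dform_equal_args:
  assumes "i < length fs" "j < length fs" "i \<noteq> j" "v i = v j"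
  shows "dform fs v = 0"
proof -
  have "Transposition.transpose i j permutes {..<length fs}" using assms by (intro permutes_swap_id) auto
  from dform_permuted_args[OF this, of v] have "dform fs (\<lambda>k. v (Transposition.transpose i j k)) = - dform fs v"
    using assms by (simp add: sign_swap_id)
  moreover have "(\<lambda>k. v (Transposition.transpose i j k)) = v"
    using assms by (auto simp: Transposition.transpose_def fun_eq_iff)
  ultimately show ?thesis by simp
qed

lemma dform_not_distinct:
  assumes "\<not> distinct fs" shows "dform fs v = 0"
proof -
  obtain i j where ij: "i < length fs" "j < length fs" "i \<noteq> j" "fs ! i = fs ! j"
    using assms by (auto simp: distinct_conv_nth)
  have p: "Transposition.transpose i j permutes {..<length fs}" using ij by (intro permutes_swap_id) auto
  have "permute_list (Transposition.transpose i j) fs = fs"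
    by (rule nth_equalityI) (use ij in \<open>auto simp: permute_list_nth[OF p] Transposition.transpose_def\<close>)
  with dform_permute_list[OF p, of v] ij show ?thesis by (simp add: sign_swap_id)
qed
text \<open>
  Expansion along the first argument: a permutation that does not fix \<open>0\<close> feeds \<open>w\<close> to a functional that
  kills it.
\<close>
lemma dform_contract:
  assumes "\<And>g. g \<in> set fs \<Longrightarrow> g w = 0"
  shows "dform (f # fs) (case_nat w v) = f w * dform fs v"
proof -
  let ?n = "length fs" and ?u = "case_nat w v"
  let ?sh = "map_permutation {..<?n} Suc"
  have bij: "bij_betw Suc {..<?n} {1..<Suc ?n}"
    by (rule bij_betwI[where g = "\<lambda>i. i - 1"]) auto
  let ?P = "{\<sigma>. \<sigma> permutes {..<Suc ?n}}" and ?Q = "{\<sigma>. \<sigma> permutes {1..<Suc ?n}}"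
  let ?F = "\<lambda>\<sigma>. of_int (sign \<sigma>) * tensor (f # fs) (\<lambda>i. ?u (\<sigma> i))"
  have zero: "?F \<sigma> = 0" if "\<sigma> \<in> ?P - ?Q" for \<sigma>
  proof -
    from that have s: "\<sigma> permutes {..<Suc ?n}" and ns: "\<not> \<sigma> permutes {1..<Suc ?n}" by auto
    have "\<sigma> 0 \<noteq> 0"
    proof
      assume "\<sigma> 0 = 0"
      then have "\<sigma> permutes {1..<Suc ?n}"
        by (intro permutes_superset[OF s]) (auto simp: not_le less_Suc_eq)
      with ns show False by simp
    qed
    obtain k where k: "\<sigma> k = 0" using permutes_surj[OF s] by (metis surjD)
    have "k < Suc ?n" using s k by (metis lessThan_iff permutes_def zero_less_Suc)
    with k \<open>\<sigma> 0 \<noteq> 0\<close> obtain k' where k': "k = Suc k'" "k' < ?n" by (cases k) auto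
    have "(fs ! k') (?u (\<sigma> (Suc k'))) = 0" using assms k k' by simp
    then have "tensor fs (\<lambda>i. ?u (\<sigma> (Suc i))) = 0"
      unfolding tensor_eq_prod using k' by (auto intro!: bexI[of _ k'])
    then show ?thesis by simp
  qed
  have "dform (f # fs) ?u = sum ?F ?P" by (simp add: dform_def alternation_def[abs_def])
  also have "\<dots> = sum ?F ?Q"
    by (rule sum.mono_neutral_right) (use zero in \<open>auto intro: finite_permutations permutes_subset\<close>)
  also have "\<dots> = (\<Sum>\<tau> | \<tau> permutes {..<?n}. ?F (?sh \<tau>))"
    by (rule sum.reindex_bij_betw[symmetric]) (rule bij_betw_map_permutation[OF bij])
  also have "\<dots> = (\<Sum>\<tau> | \<tau> permutes {..<?n}. f w * (of_int (sign \<tau>) * tensor fs (\<lambda>i. v (\<tau> i))))"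
  proof (rule sum.cong[OF refl])
    fix \<tau> assume "\<tau> \<in> {\<tau>. \<tau> permutes {..<?n}}"
    then have t: "\<tau> permutes {..<?n}" by simp
    have t1: "?sh \<tau> permutes {1..<Suc ?n}" by (rule map_permutation_permutes[OF bij t])
    have z: "?sh \<tau> 0 = 0" using t1 by (simp add: permutes_def)
    have s: "?sh \<tau> (Suc i) = Suc (\<tau> i)" if "i < ?n" for i
      using that map_permutation_apply[of Suc "{..<?n}" i \<tau>] by auto
    have "sign (?sh \<tau>) = sign \<tau>" by (rule sign_map_permutation) (use t in auto)
    moreover have "tensor fs (\<lambda>i. ?u (?sh \<tau> (Suc i))) = tensor fs (\<lambda>i. v (\<tau> i))"
      by (rule tensor_cong) (simp add: s)
    ultimately show "?F (?sh \<tau>) = f w * (of_int (sign \<tau>) * tensor fs (\<lambda>i. v (\<tau> i)))"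
      by (simp add: z)
  qed
  finally show ?thesis by (simp add: dform_def alternation_def sum_distrib_left)
qed

text \<open>
  The vectors and the functionals may be changed together, as long as all values \<open>f\<^sub>k(v\<^sub>i)\<close> persist. This
  serves for pullbacks and for rescaling.
\<close>
lemma dform_transfer:
  assumes "list_all2 (\<lambda>f g. \<forall>i. f (v i) = g (w i)) fs gs"
  shows "dform fs v = dform gs w"
proof -
  have l: "length fs = length gs" using assms by (rule list_all2_lengthD)
  have "tensor fs (\<lambda>i. v (\<sigma> i)) = tensor gs (\<lambda>i. w (\<sigma> i))" for \<sigma>
    unfolding tensor_eq_prod l using assms by (intro prod.cong) (auto simp: list_all2_conv_all_nth l)
  then show ?thesis by (simp add: dform_def alternation_def l)
qed

lemma dform_compose: "dform fs (\<lambda>i. h (v i)) = dform (map (\<lambda>f u. f (h u)) fs) v"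
  by (rule dform_transfer) (simp add: list_all2_conv_all_nth)

lemma dform_scale:
  "dform (map (\<lambda>k u. c k * F k u) ks) v = prod_list (map c ks) * dform (map F ks) v"
proof -
  have "tensor (map (\<lambda>k u. c k * F k u) ks) v = prod_list (map c ks) * tensor (map F ks) v" for v
    by (induction ks arbitrary: v) (simp_all add: mult_ac)
  then show ?thesis by (simp add: dform_def alternation_def sum_distrib_left mult_ac)
qed

lemma dform_scale_head: "dform ((\<lambda>u. c * f u) # fs) v = c * dform (f # fs) v"
  by (simp add: dform_def alternation_def sum_distrib_left mult_ac)

lemma cnj_dform: "cnj (dform fs v) = dform (map (\<lambda>f u. cnj (f u)) fs) v"
proof -
  have "cnj (tensor fs v) = tensor (map (\<lambda>f u. cnj (f u)) fs) v" for v
    by (induction fs arbitrary: v) simp_all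
  then show ?thesis by (simp add: dform_def alternation_def)
qed

lemma dform_cong_args:
  assumes "\<And>i. i < length fs \<Longrightarrow> v i = w i"
  shows "dform fs v = dform fs w"
proof -
  have "tensor fs (\<lambda>i. v (\<sigma> i)) = tensor fs (\<lambda>i. w (\<sigma> i))" if "\<sigma> permutes {..<length fs}" for \<sigma>
    using permutes_in_image[OF that] by (intro tensor_cong assms) auto
  then show ?thesis by (simp add: dform_def alternation_def)
qed

lemma linear_sum_complex:
  assumes "\<And>x. x \<in> A \<Longrightarrow> linear (f x :: 'v::real_vector \<Rightarrow> complex)"
  shows "linear (\<lambda>u. \<Sum>x\<in>A. f x u)"
  using assms by (intro linear_compose_sum) auto

lemma linear_cmult_complex:
  assumes "linear (f :: 'v::real_vector \<Rightarrow> complex)" shows "linear (\<lambda>u. c * f u)"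
  using linear_compose[OF assms, of "(*) c"] by (simp add: o_def bounded_linear.linear[OF bounded_linear_mult_right])

text \<open>
  Exactly one factor of the tensor product sees the \<open>i\<close>-th vector.
\<close>
lemma tensor_permuted_update:
  assumes s: "\<sigma> permutes {..<length fs}" and i: "i < length fs"
  shows "inv \<sigma> i < length fs"
    "tensor fs (\<lambda>l. (v(i := x)) (\<sigma> l)) =
      (\<Prod>l\<in>{..<length fs} - {inv \<sigma> i}. (fs ! l) (v (\<sigma> l))) * (fs ! inv \<sigma> i) x"
proof -
  define k where "k = inv \<sigma> i"
  have sk: "\<sigma> k = i" unfolding k_def by (rule permutes_inverses(1)[OF s])
  have k: "k < length fs" using permutes_in_image[OF s, of k] i sk by simp
  then show "inv \<sigma> i < length fs" by (simp add: k_def)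
  have eq: "\<sigma> l = i \<longleftrightarrow> l = k" for l using sk permutes_inj[OF s] by (auto dest: injD)
  have "tensor fs (\<lambda>l. (v(i := x)) (\<sigma> l)) =
      (\<Prod>l\<in>{..<length fs} - {k}. (fs ! l) (v (\<sigma> l))) * (fs ! k) x"
    unfolding tensor_eq_prod using k
    by (subst prod.remove[of _ k]) (auto simp: eq sk intro!: prod.cong)
  then show "tensor fs (\<lambda>l. (v(i := x)) (\<sigma> l)) =
      (\<Prod>l\<in>{..<length fs} - {inv \<sigma> i}. (fs ! l) (v (\<sigma> l))) * (fs ! inv \<sigma> i) x"
    unfolding k_def .
qed

lemma dform_linear_arg:
  assumes "\<And>f. f \<in> set fs \<Longrightarrow> linear f" and i: "i < length fs"
  shows "linear (\<lambda>x. dform fs (v(i := x)))"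
  unfolding dform_def alternation_def
proof (intro linear_sum_complex linear_cmult_complex)
  fix \<sigma> assume "\<sigma> \<in> {\<sigma>. \<sigma> permutes {..<length fs}}"
  then have s: "\<sigma> permutes {..<length fs}" by simp
  have "linear (fs ! inv \<sigma> i)" using assms(1) tensor_permuted_update(1)[OF s i] by simp
  then show "linear (\<lambda>x. tensor fs (\<lambda>l. (v(i := x)) (\<sigma> l)))"
    unfolding tensor_permuted_update(2)[OF s i] by (rule linear_cmult_complex)
qed

lemma alternating_dform:
  assumes "\<And>f. f \<in> set fs \<Longrightarrow> linear f"
  shows "alternating_form (length fs) (dform fs)"
  unfolding alternating_form_def
proof (intro conjI allI impI)
  show "dform fs v = dform fs w" if "\<forall>i<length fs. v i = w i" for v w
    using that by (intro dform_cong_args) auto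
  show "linear (\<lambda>x. dform fs (v(i := x)))" if "i < length fs" for v i
    using dform_linear_arg[OF assms that] .
  show "dform fs v = 0" if "i < length fs" "j < length fs" "i \<noteq> j \<and> v i = v j" for v i j
    using dform_equal_args[of i fs j v] that by auto
qed

lemma dform_eq_det:
  fixes ix :: "'n::finite \<Rightarrow> nat"
  assumes bij: "bij_betw ix UNIV {..<length fs}"
  shows "dform fs v = det (\<chi> a b. (fs ! ix a) (v (ix b)))"
proof -
  let ?m = "map_permutation UNIV ix"
  have B: "bij_betw ?m {\<sigma>. \<sigma> permutes UNIV} {\<sigma>. \<sigma> permutes {..<length fs}}"
    by (rule bij_betw_map_permutation[OF bij])
  have "dform fs v = (\<Sum>p | p permutes UNIV. of_int (sign (?m p)) * tensor fs (\<lambda>i. v (?m p i)))"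
    unfolding dform_def alternation_def by (rule sum.reindex_bij_betw[OF B, symmetric])
  also have "\<dots> = (\<Sum>p | p permutes UNIV. of_int (sign p) * (\<Prod>a\<in>UNIV. (fs ! ix a) (v (ix (p a)))))"
  proof (rule sum.cong[OF refl])
    fix p :: "'n \<Rightarrow> 'n" assume "p \<in> {p. p permutes UNIV}"
    then have p: "p permutes UNIV" by simp
    have inj: "inj ix" using bij by (simp add: bij_betw_def)
    have "tensor fs (\<lambda>i. v (?m p i)) = (\<Prod>a\<in>UNIV. (fs ! ix a) (v (?m p (ix a))))"
      unfolding tensor_eq_prod by (rule prod.reindex_bij_betw[OF bij, symmetric])
    then show "of_int (sign (?m p)) * tensor fs (\<lambda>i. v (?m p i)) =
      of_int (sign p) * (\<Prod>a\<in>UNIV. (fs ! ix a) (v (ix (p a))))"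
      using sign_map_permutation[OF inj p] map_permutation_apply[OF inj] by simp
  qed
  finally show ?thesis by (simp add: det_def)
qed

lemma dform_swap_adjacent: "dform (xs @ g # a # ys) v = - dform (xs @ a # g # ys) v"
proof -
  let ?fs = "xs @ a # g # ys" and ?t = "Transposition.transpose (length xs) (Suc (length xs))"
  have p: "?t permutes {..<length ?fs}" by (intro permutes_swap_id) auto
  have "permute_list ?t ?fs = xs @ g # a # ys"
    by (rule nth_equalityI)
       (auto simp: permute_list_nth[OF p] Transposition.transpose_def nth_append nth_Cons split: nat.splits if_splits)
  then show ?thesis using dform_permute_list[OF p, of v] by (simp add: sign_swap_id)
qed

lemma dform_move: "dform (xs @ g # as @ ys) v = (-1) ^ length as * dform (xs @ as @ g # ys) v"
proof (induction as arbitrary: xs)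
  case (Cons a as)
  have "dform (xs @ g # (a # as) @ ys) v = - dform ((xs @ [a]) @ g # as @ ys) v"
    using dform_swap_adjacent[of xs g a "as @ ys" v] by simp
  then show ?case using Cons[of "xs @ [a]"] by simp
qed simp

lemma wedge_cmult_left: "wedge p q (\<lambda>v. c * \<phi> v) \<psi> v = c * wedge p q \<phi> \<psi> v"
  by (simp add: wedge_def sum_distrib_left mult_ac sum_divide_distrib)

lemma wedge_cmult_right: "wedge p q \<phi> (\<lambda>v. c * \<psi> v) v = c * wedge p q \<phi> \<psi> v"
  by (simp add: wedge_def sum_distrib_left mult_ac sum_divide_distrib)

lemma wedge_sum_left: "wedge p q (\<lambda>v. \<Sum>x\<in>A. \<phi> x v) \<psi> v = (\<Sum>x\<in>A. wedge p q (\<phi> x) \<psi> v)"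
  unfolding wedge_def sum_divide_distrib[symmetric] sum_distrib_left sum_distrib_right by (subst sum.swap) (rule refl)

lemma wedge_sum_right: "wedge p q \<phi> (\<lambda>v. \<Sum>x\<in>A. \<psi> x v) v = (\<Sum>x\<in>A. wedge p q \<phi> (\<psi> x) v)"
  unfolding wedge_def sum_divide_distrib[symmetric] sum_distrib_left sum_distrib_right by (subst sum.swap) (rule refl)

abbreviation cnjf :: "('v \<Rightarrow> complex) \<Rightarrow> 'v \<Rightarrow> complex" where "cnjf f \<equiv> \<lambda>u. cnj (f u)"

section \<open>Powers of a sum of pairs\<close>

text \<open>
  The sign of the permutation that sorts \<open>f\<^sub>1, g\<^sub>1, f\<^sub>2, g\<^sub>2, \<dots>\<close> into \<open>f\<^sub>1, f\<^sub>2, \<dots>, g\<^sub>1, g\<^sub>2, \<dots>\<close>: each \<open>g\<close> has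
  to pass all later \<open>f\<close>.
\<close>
definition unshuffle_sign :: "nat \<Rightarrow> complex" where
  "unshuffle_sign n = (\<Prod>k<n. (-1) ^ k)"

lemma dform_unshuffle:
  "dform (concat (map (\<lambda>k. [F k, G k]) ks)) v =
     unshuffle_sign (length ks) * dform (map F ks @ map G ks) v"
proof (induction ks arbitrary: v)
  case Nil
  then show ?case by (simp add: unshuffle_sign_def)
next
  case (Cons k ks)
  let ?n = "length ks" and ?C = "concat (map (\<lambda>k. [F k, G k]) ks)"
  have lC: "length ?C = 2 * ?n" by (induction ks) auto
  have "dform (concat (map (\<lambda>k. [F k, G k]) (k # ks))) v = wedge 2 (2 * ?n) (dform [F k, G k]) (dform ?C) v"
    by (subst wedge_dform_append) (auto simp: lC)
  also have "dform ?C = (\<lambda>v. unshuffle_sign ?n * dform (map F ks @ map G ks) v)"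
    by (rule ext) (rule Cons.IH)
  also have "wedge 2 (2 * ?n) (dform [F k, G k]) \<dots> v =
    unshuffle_sign ?n * dform ([F k, G k] @ map F ks @ map G ks) v"
    by (simp add: wedge_cmult_right wedge_dform_append)
  also have "dform ([F k, G k] @ map F ks @ map G ks) v = (-1) ^ ?n * dform (F k # map F ks @ G k # map G ks) v"
    using dform_move[of "[F k]" "G k" "map F ks" "map G ks" v] by simp
  finally show ?case by (simp add: unshuffle_sign_def mult_ac)
qed

lemma wedge_power_cmult: "wedge_power p (\<lambda>v. c * \<phi> v) n v = c ^ n * wedge_power p \<phi> n v"
proof (induction n arbitrary: v)
  case (Suc n)
  then have "wedge_power p (\<lambda>v. c * \<phi> v) n = (\<lambda>v. c ^ n * wedge_power p \<phi> n v)" by (simp add: fun_eq_iff)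
  then show ?case by (simp add: wedge_cmult_left wedge_cmult_right)
qed simp

lemma wedge_power_sum_pairs:
  assumes "finite A"
  shows "wedge_power 2 (\<lambda>v. \<Sum>k\<in>A. dform [F k, G k] v) n v =
    (\<Sum>ks | set ks \<subseteq> A \<and> length ks = n. dform (concat (map (\<lambda>k. [F k, G k]) ks)) v)"
proof (induction n arbitrary: v)
  case 0
  have "{ks. set ks \<subseteq> A \<and> length ks = 0} = {[]}" by auto
  then show ?case by simp
next
  case (Suc n)
  let ?L = "{ks. set ks \<subseteq> A \<and> length ks = n}" and ?c = "\<lambda>ks. concat (map (\<lambda>k. [F k, G k]) ks)"
  have lC: "length (?c ks) = 2 * length ks" for ks by (induction ks) auto
  have "wedge_power 2 (\<lambda>v. \<Sum>k\<in>A. dform [F k, G k] v) (Suc n) v =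
      wedge 2 (2 * n) (\<lambda>v. \<Sum>k\<in>A. dform [F k, G k] v) (\<lambda>v. \<Sum>ks\<in>?L. dform (?c ks) v) v"
    unfolding wedge_power.simps Suc.IH[THEN ext] ..
  also have "\<dots> = (\<Sum>k\<in>A. \<Sum>ks\<in>?L. dform (?c (k # ks)) v)"
    unfolding wedge_sum_left wedge_sum_right
    by (intro sum.cong refl) (subst wedge_dform_append, auto simp: lC)
  also have "\<dots> = (\<Sum>(ks, k)\<in>?L \<times> A. dform (?c (k # ks)) v)"
    by (subst sum.swap) (simp add: sum.cartesian_product)
  also have "\<dots> = (\<Sum>ks | set ks \<subseteq> A \<and> length ks = Suc n. dform (?c ks) v)"
    unfolding lists_length_Suc_eq by (subst sum.reindex) (auto simp: inj_on_def intro!: sum.cong)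
  finally show ?case .
qed
text \<open>
  The power expands into a sum over lists of \<open>m\<close> indices. A repeated index kills a term. Otherwise the list
  is a permutation of all indices; once the \<open>f\<close> and the \<open>g\<close> are separated, it permutes both groups alike, so
  its sign cancels and all \<open>m!\<close> terms are equal.
\<close>
lemma wedge_power_top:
  "wedge_power 2 (\<lambda>v. \<Sum>k<m. dform [F k, G k] v) m v =
    fact m * unshuffle_sign m * dform (map F [0..<m] @ map G [0..<m]) v"
proof -
  let ?L = "{ks. set ks \<subseteq> {..<m} \<and> length ks = m}" and ?D = "{ks. length ks = m \<and> distinct ks \<and> set ks \<subseteq> {..<m}}"
  let ?c = "\<lambda>ks. dform (concat (map (\<lambda>k. [F k, G k]) ks)) v"
  have zero: "?c ks = 0" if "\<not> distinct ks" for ks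
  proof -
    have "\<not> distinct (map F ks @ map G ks)" using that by (auto simp: distinct_map)
    then show ?thesis by (simp add: dform_unshuffle dform_not_distinct)
  qed
  have val: "?c ks = unshuffle_sign m * dform (map F [0..<m] @ map G [0..<m]) v" if "ks \<in> ?D" for ks
  proof -
    from that have ks: "length ks = m" "distinct ks" "set ks \<subseteq> {..<m}" by auto
    have "card (set ks) = card {..<m}" using distinct_card[OF ks(2)] ks(1) by simp
    then have "set ks = {..<m}" by (rule card_subset_eq[OF finite_lessThan ks(3)])
    then have "set ks = set [0..<m]" unfolding atLeast_upt .
    then have "mset ks = mset [0..<m]"
      using set_eq_iff_mset_eq_distinct[OF ks(2) distinct_upt] by blast
    then obtain \<pi> where \<pi>: "\<pi> permutes {..<length [0..<m]}" "permute_list \<pi> [0..<m] = ks"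
      by (rule mset_eq_permutation)
    have \<pi>': "\<pi> permutes {..<length (map H [0..<m])}" for H :: "nat \<Rightarrow> 'a \<Rightarrow> complex" using \<pi> by simp
    have *: "dform (map H ks) = (\<lambda>v. of_int (sign \<pi>) * dform (map H [0..<m]) v)" for H :: "nat \<Rightarrow> 'a \<Rightarrow> complex"
    proof
      have "map H ks = permute_list \<pi> (map H [0..<m])" using permute_list_map[OF \<pi>(1), of H] \<pi>(2) by simp
      then show "dform (map H ks) v = of_int (sign \<pi>) * dform (map H [0..<m]) v" for v
        by (simp only: dform_permute_list[OF \<pi>'])
    qed
    have "dform (map F ks @ map G ks) v = wedge m m (dform (map F ks)) (dform (map G ks)) v"
      by (simp add: wedge_dform_append ks)
    also have "\<dots> = dform (map F [0..<m] @ map G [0..<m]) v"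
      unfolding * wedge_cmult_left wedge_cmult_right sign_cancel by (simp add: wedge_dform_append)
    finally show ?thesis by (simp add: dform_unshuffle ks)
  qed
  have "wedge_power 2 (\<lambda>v. \<Sum>k<m. dform [F k, G k] v) m v = (\<Sum>ks\<in>?L. ?c ks)"
    by (rule wedge_power_sum_pairs) simp
  also have "\<dots> = (\<Sum>ks\<in>?D. ?c ks)"
    by (rule sum.mono_neutral_right) (use zero in \<open>auto intro: finite_lists_length_eq\<close>)
  also have "\<dots> = of_nat (card ?D) * (unshuffle_sign m * dform (map F [0..<m] @ map G [0..<m]) v)"
    using val by simp
  also have "card ?D = fact m"
    using card_lists_distinct_length_eq[of "{..<m}" m] by (simp add: fact_prod)
  finally show ?thesis by simp
qed

text \<open>
  The constant of an \<open>SU(m)\<close>-structure undoes the factor that arises when the power of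
  \<open>\<i>/2 \<Sum>\<^sub>k f\<^sub>k \<and> cnj f\<^sub>k\<close> is compared with \<open>f\<^sub>1 \<and> \<dots> \<and> f\<^sub>m \<and> cnj f\<^sub>1 \<and> \<dots> \<and> cnj f\<^sub>m\<close>.
\<close>
lemma SU_constant_unshuffle: "SU_constant m * (\<i> / 2) ^ m * fact m * unshuffle_sign m = 1"
proof -
  have "(- \<i>) ^ (m\<^sup>2) * \<i> ^ m * unshuffle_sign m = 1"
  proof (induction m)
    case (Suc m)
    have "(Suc m)\<^sup>2 = m\<^sup>2 + (2 * m + 1)" by (simp add: power2_eq_square)
    then have "(- \<i>) ^ ((Suc m)\<^sup>2) = (- \<i>) ^ (m\<^sup>2) * ((-1) ^ m * (- \<i>))"
      by (simp only: power_add power_mult) simp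
    then have "(- \<i>) ^ ((Suc m)\<^sup>2) * \<i> ^ Suc m * unshuffle_sign (Suc m) =
      ((- \<i>) ^ (m\<^sup>2) * \<i> ^ m * unshuffle_sign m) * ((-1) ^ m * (-1) ^ m) * (- \<i> * \<i>)"
      by (simp only: unshuffle_sign_def prod.lessThan_Suc power_Suc mult_ac)
    also have "((-1) ^ m * (-1) ^ m :: complex) = 1" by (simp flip: power_mult_distrib)
    finally show ?case using Suc by simp
  qed (simp add: unshuffle_sign_def)
  then show ?thesis by (simp add: SU_constant_def power_divide)
qed

section \<open>Unitary coframes\<close>

definition fundamental_form :: "nat \<Rightarrow> (nat \<Rightarrow> 'v \<Rightarrow> complex) \<Rightarrow> 'v form" where
  "fundamental_form m F v = \<i> / 2 * (\<Sum>k<m. dform [F k, cnjf (F k)] v)"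

lemma fundamental_form_eq:
  "fundamental_form m F v = \<i> / 2 * (\<Sum>k<m. F k (v 0) * cnj (F k (v 1)) - F k (v 1) * cnj (F k (v 0)))"
  by (simp add: fundamental_form_def dform_pair)

lemma fundamental_form_real: "fundamental_form m F v \<in> \<real>"
  unfolding fundamental_form_eq sum_distrib_left
  by (intro sum_in_Reals) (simp add: complex_is_Real_iff algebra_simps)

text \<open>
  Every summand of the 2-form repeats a factor of the top product.
\<close>
lemma wedge_coframe_fundamental: "wedge m 2 (dform (map F [0..<m])) (fundamental_form m F) v = 0"
proof -
  have "wedge m 2 (dform (map F [0..<m])) (dform [F k, G k]) v = 0" if "k < m" for k G
  proof -
    have "\<not> distinct (map F [0..<m] @ [F k, G k])" using that by auto
    then show ?thesis by (simp add: wedge_dform_append dform_not_distinct)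
  qed
  then show ?thesis
    unfolding fundamental_form_def[abs_def] wedge_cmult_right wedge_sum_right by (auto intro!: sum.neutral)
qed

lemma wedge_coframe_cnj:
  "wedge m m (dform (map F [0..<m])) (cnj_form (dform (map F [0..<m]))) v =
     SU_constant m * wedge_power 2 (fundamental_form m F) m v"
proof -
  have "wedge_power 2 (fundamental_form m F) m v =
    (\<i> / 2) ^ m * (fact m * unshuffle_sign m * dform (map F [0..<m] @ map (\<lambda>k. cnjf (F k)) [0..<m]) v)"
    unfolding fundamental_form_def[abs_def] wedge_power_cmult wedge_power_top ..
  moreover have "cnj_form (dform (map F [0..<m])) = dform (map (\<lambda>k. cnjf (F k)) [0..<m])"
    by (simp add: cnj_form_def cnj_dform o_def)
  ultimately show ?thesis
    using arg_cong[OF SU_constant_unshuffle[of m], of "\<lambda>c. c * dform (map F [0..<m] @ map (\<lambda>k. cnjf (F k)) [0..<m]) v"]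
    by (simp add: wedge_dform_append mult_ac)
qed
text \<open>
  An injective real linear map from a space of dimension \<open>2m\<close> to \<open>\<complex>\<^sup>m\<close> is onto. The prescribed values
  provide the test vectors for nondegeneracy and for nonvanishing.
\<close>
lemma coframe_surj:
  fixes F :: "nat \<Rightarrow> 'v::euclidean_space \<Rightarrow> complex"
  assumes lin: "\<And>k. k < m \<Longrightarrow> linear (F k)"
    and inj: "\<And>u. (\<And>k. k < m \<Longrightarrow> F k u = 0) \<Longrightarrow> u = 0"
    and dim: "DIM('v) = 2 * m"
  shows "\<exists>u. \<forall>k<m. F k u = c k"
proof -
  obtain b :: "nat \<Rightarrow> 'v" where b: "bij_betw b {..<2*m} Basis"
    using finite_same_card_bij[of "{..<2*m}" "Basis :: 'v set"] dim by auto
  \<comment> \<open>Real and imaginary parts as coordinates, to apply the dimension count for endomorphisms of one space.\<close>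
  define \<Phi> :: "'v \<Rightarrow> 'v" where
    "\<Phi> u = (\<Sum>k<m. Re (F k u) *\<^sub>R b k + Im (F k u) *\<^sub>R b (m + k))" for u
  have orth: "b i \<bullet> b j = (if i = j then 1 else 0)" if "i < 2*m" "j < 2*m" for i j
  proof -
    have "b i \<in> Basis" "b j \<in> Basis" using that b by (auto simp: bij_betw_def)
    moreover have "b i = b j \<longleftrightarrow> i = j" using that b by (auto simp: bij_betw_def inj_on_def)
    ultimately show ?thesis by (simp add: inner_Basis)
  qed
  have scale: "linear (\<lambda>u. g u *\<^sub>R (a::'v))" if "linear g" for g :: "'v \<Rightarrow> real" and a
    using that by (simp add: linear_iff scaleR_add_left)
  have "linear (\<lambda>u. Re (F k u))" "linear (\<lambda>u. Im (F k u))" if "k < m" for k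
    using lin[OF that] by (simp_all add: linear_iff)
  then have lin\<Phi>: "linear \<Phi>"
    unfolding \<Phi>_def by (intro linear_compose_sum ballI linear_compose_add scale) auto
  have re: "\<Phi> u \<bullet> b k = Re (F k u)" if "k < m" for u k
  proof -
    have "\<Phi> u \<bullet> b k = (\<Sum>l<m. if l = k then Re (F k u) else 0)"
      unfolding \<Phi>_def inner_sum_left using that by (intro sum.cong) (auto simp: inner_add_left orth)
    then show ?thesis using that by simp
  qed
  have im: "\<Phi> u \<bullet> b (m + k) = Im (F k u)" if "k < m" for u k
  proof -
    have "\<Phi> u \<bullet> b (m + k) = (\<Sum>l<m. if l = k then Im (F k u) else 0)"
      unfolding \<Phi>_def inner_sum_left using that by (intro sum.cong) (auto simp: inner_add_left orth)
    then show ?thesis using that by simp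
  qed
  have "inj \<Phi>"
    unfolding linear_injective_0[OF lin\<Phi>]
  proof (intro allI impI inj)
    fix u k assume "\<Phi> u = 0" "k < m"
    then show "F k u = 0" using re[of k u] im[of k u] by (simp add: complex_eq_iff)
  qed
  then have "surj \<Phi>" using linear_injective_imp_surjective[OF lin\<Phi>] by simp
  then obtain u where u: "\<Phi> u = (\<Sum>k<m. Re (c k) *\<^sub>R b k + Im (c k) *\<^sub>R b (m + k))" by (metis surjD)
  have "F k u = c k" if k: "k < m" for k
  proof -
    have "\<Phi> u \<bullet> b k = (\<Sum>l<m. if l = k then Re (c k) else 0)"
      unfolding u inner_sum_left using that by (intro sum.cong) (auto simp: inner_add_left orth)
    moreover have "\<Phi> u \<bullet> b (m + k) = (\<Sum>l<m. if l = k then Im (c k) else 0)"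
      unfolding u inner_sum_left using that by (intro sum.cong) (auto simp: inner_add_left orth)
    ultimately show ?thesis using re[OF k, of u] im[OF k, of u] k by (simp add: complex_eq_iff)
  qed
  then show ?thesis by blast
qed

text \<open>
  Against the vector with coordinates \<open>\<i> f\<^sub>k(u)\<close>, the vector \<open>u\<close> has the value \<open>\<Sum>\<^sub>k |f\<^sub>k(u)|\<^sup>2\<close>.
\<close>
lemma nondegenerate_fundamental_form:
  fixes F :: "nat \<Rightarrow> 'v::euclidean_space \<Rightarrow> complex"
  assumes lin: "\<And>k. k < m \<Longrightarrow> linear (F k)"
    and inj: "\<And>u. (\<And>k. k < m \<Longrightarrow> F k u = 0) \<Longrightarrow> u = 0"
    and dim: "DIM('v) = 2 * m"
  shows "nondegenerate (fundamental_form m F)"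
  unfolding nondegenerate_def
proof (intro allI impI)
  fix u :: 'v assume "u \<noteq> 0"
  then obtain k0 where k0: "k0 < m" "F k0 u \<noteq> 0" using inj by blast
  have "\<exists>w. \<forall>k<m. F k w = \<i> * F k u"
    by (rule coframe_surj[of m F]; fact lin inj dim)
  then obtain w where w: "\<forall>k<m. F k w = \<i> * F k u" by blast
  have "contract u (fundamental_form m F) (\<lambda>_. w) = \<i> / 2 * (\<Sum>k<m. - 2 * \<i> * of_real ((cmod (F k u))\<^sup>2))"
  proof -
    have "F k u * cnj (F k w) - F k w * cnj (F k u) = - 2 * \<i> * of_real ((cmod (F k u))\<^sup>2)" if "k < m" for k
      unfolding complex_norm_square using that by (simp add: w)
    then show ?thesis by (simp add: contract_def fundamental_form_eq)
  qed
  also have "\<dots> = of_real (\<Sum>k<m. (cmod (F k u))\<^sup>2)" by (simp add: sum_distrib_left)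
  also have "(\<Sum>k<m. (cmod (F k u))\<^sup>2) > 0"
    using k0 by (intro sum_pos2[of _ k0]) auto
  then have "complex_of_real (\<Sum>k<m. (cmod (F k u))\<^sup>2) \<noteq> 0" by (simp del: of_real_sum of_real_power)
  finally have "contract u (fundamental_form m F) (\<lambda>_. w) \<noteq> 0" by simp
  then show "\<exists>v. contract u (fundamental_form m F) v \<noteq> 0" by blast
qed

text \<open>
  The product is \<open>1\<close> on the dual vectors.
\<close>
lemma dform_coframe_nonzero:
  fixes F :: "nat \<Rightarrow> 'v::euclidean_space \<Rightarrow> complex"
  assumes lin: "\<And>k. k < m \<Longrightarrow> linear (F k)"
    and inj: "\<And>u. (\<And>k. k < m \<Longrightarrow> F k u = 0) \<Longrightarrow> u = 0"
    and dim: "DIM('v) = 2 * m"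
  shows "dform (map F [0..<m]) \<noteq> (\<lambda>v. 0)"
proof -
  have "\<forall>i. \<exists>u. \<forall>k<m. F k u = (if k = i then 1 else 0)"
    by (rule allI, rule coframe_surj[of m F]; fact lin inj dim)
  from choice[OF this] obtain e where e: "\<And>i k. k < m \<Longrightarrow> F k (e i) = (if k = i then 1 else 0)" by blast
  have "dform (map F [0..<m]) e = (\<Sum>\<sigma> | \<sigma> permutes {..<m}. if \<sigma> = id then 1 else 0)"
    unfolding dform_def alternation_def
  proof (simp, rule sum.cong[OF refl])
    fix \<sigma> assume "\<sigma> \<in> {\<sigma>. \<sigma> permutes {..<m}}"
    then have s: "\<sigma> permutes {..<m}" by simp
    have t: "tensor (map F [0..<m]) (\<lambda>i. e (\<sigma> i)) = (\<Prod>i<m. if i = \<sigma> i then 1 else 0)"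
      by (simp add: tensor_eq_prod e)
    show "of_int (sign \<sigma>) * tensor (map F [0..<m]) (\<lambda>i. e (\<sigma> i)) = (if \<sigma> = id then 1 else 0)"
    proof (cases "\<sigma> = id")
      case True
      then show ?thesis unfolding t by simp
    next
      case False
      then obtain i where "\<sigma> i \<noteq> i" by (auto simp: fun_eq_iff)
      then have "i < m" using s by (metis lessThan_iff permutes_def)
      then have "(\<Prod>i<m. if i = \<sigma> i then 1 else (0::complex)) = 0" using \<open>\<sigma> i \<noteq> i\<close>
        by (auto intro!: bexI[of _ i])
      then show ?thesis using False unfolding t by simp
    qed
  qed
  also have "\<dots> = 1" by (simp add: finite_permutations permutes_id)
  finally show ?thesis by auto
qed

section \<open>Smoothness of rational functions\<close>

lemma Ck_on_cong:
  assumes "Ck_on k S f" "open S" "\<And>x. x \<in> S \<Longrightarrow> f x = g x"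
  shows "Ck_on k S g"
  using assms(1,3)
proof (induction k arbitrary: f g)
  case 0
  then show ?case using continuous_on_cong by fastforce
next
  case (Suc k)
  have d: "(g has_derivative frechet_derivative f (at x)) (at x)" if "x \<in> S" for x
    using Suc.prems that assms(2)
    by (intro has_derivative_transform_within_open[of f _ x UNIV S g]) (auto simp: frechet_derivative_works[symmetric])
  have "Ck_on k S (\<lambda>x. frechet_derivative g (at x) v)" for v
    by (rule Suc.IH[of "\<lambda>x. frechet_derivative f (at x) v"])
       (use Suc.prems(1) frechet_derivative_at[OF d] in auto)
  then show ?case using d by (auto simp: differentiable_def)
qed

text \<open>
  Smoothness is checked locally, since a decomposition of the 7-form is available only locally.
\<close>
lemma Ck_on_local:
  assumes "\<And>x. x \<in> S \<Longrightarrow> \<exists>N. open N \<and> x \<in> N \<and> Ck_on k N f"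
  shows "Ck_on k S f"
  using assms
proof (induction k arbitrary: f)
  case 0
  then have "isCont f x" if "x \<in> S" for x
    using that by (metis Ck_on.simps(1) continuous_on_eq_continuous_at)
  then show ?case by (simp add: continuous_at_imp_continuous_on)
next
  case (Suc k)
  have "Ck_on k S (\<lambda>x. frechet_derivative f (at x) v)" for v
    by (rule Suc.IH) (use Suc.prems in fastforce)
  moreover have "f differentiable (at x)" if "x \<in> S" for x
    using Suc.prems[OF that] by auto
  ultimately show ?case by simp
qed

lemma Ck_on_subset: "Ck_on k S f \<Longrightarrow> T \<subseteq> S \<Longrightarrow> Ck_on k T f"
  by (induction k arbitrary: f) (auto intro: continuous_on_subset)

lemma smooth_on_subset: "smooth_on S f \<Longrightarrow> T \<subseteq> S \<Longrightarrow> smooth_on T f"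
  by (auto simp: smooth_on_def intro: Ck_on_subset)

lemma smooth_on_cong: "smooth_on S f \<Longrightarrow> open S \<Longrightarrow> (\<And>x. x \<in> S \<Longrightarrow> f x = g x) \<Longrightarrow> smooth_on S g"
  by (auto simp: smooth_on_def intro: Ck_on_cong)

lemma smooth_on_local:
  "(\<And>x. x \<in> S \<Longrightarrow> \<exists>N. open N \<and> x \<in> N \<and> smooth_on N f) \<Longrightarrow> smooth_on S f"
  unfolding smooth_on_def using Ck_on_local by metis

text \<open>
  Rational functions of the real coordinates without poles in \<open>S\<close>. Linearity is over the reals, so that
  complex conjugation stays in the class. It is closed under directional derivatives, and therefore all its
  members are smooth; no chain rule for higher derivatives is needed.
\<close>
inductive_set rational_on :: "'a::euclidean_space set \<Rightarrow> ('a \<Rightarrow> complex) set" for S where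
  linear: "linear f \<Longrightarrow> f \<in> rational_on S"
| const: "(\<lambda>x. c) \<in> rational_on S"
| add: "f \<in> rational_on S \<Longrightarrow> g \<in> rational_on S \<Longrightarrow> (\<lambda>x. f x + g x) \<in> rational_on S"
| mult: "f \<in> rational_on S \<Longrightarrow> g \<in> rational_on S \<Longrightarrow> (\<lambda>x. f x * g x) \<in> rational_on S"
| inverse: "f \<in> rational_on S \<Longrightarrow> (\<And>x. x \<in> S \<Longrightarrow> f x \<noteq> 0) \<Longrightarrow> (\<lambda>x. inverse (f x)) \<in> rational_on S"

lemma rational_on_uminus: "f \<in> rational_on S \<Longrightarrow> (\<lambda>x. - f x) \<in> rational_on S"
  using rational_on.mult[OF rational_on.const[of "-1"]] by simp

lemma rational_on_diff: "f \<in> rational_on S \<Longrightarrow> g \<in> rational_on S \<Longrightarrow> (\<lambda>x. f x - g x) \<in> rational_on S"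
  using rational_on.add[OF _ rational_on_uminus] by simp

lemma rational_on_divide:
  "f \<in> rational_on S \<Longrightarrow> g \<in> rational_on S \<Longrightarrow> (\<And>x. x \<in> S \<Longrightarrow> g x \<noteq> 0) \<Longrightarrow> (\<lambda>x. f x / g x) \<in> rational_on S"
  unfolding divide_inverse by (intro rational_on.mult rational_on.inverse)

lemma rational_on_sum: "(\<And>i. i \<in> A \<Longrightarrow> f i \<in> rational_on S) \<Longrightarrow> (\<lambda>x. \<Sum>i\<in>A. f i x) \<in> rational_on S"
  by (induction A rule: infinite_finite_induct) (auto intro: rational_on.intros)

lemma rational_on_prod: "(\<And>i. i \<in> A \<Longrightarrow> f i \<in> rational_on S) \<Longrightarrow> (\<lambda>x. \<Prod>i\<in>A. f i x) \<in> rational_on S"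
  by (induction A rule: infinite_finite_induct) (auto intro: rational_on.intros)

lemma rational_on_cnj: "f \<in> rational_on S \<Longrightarrow> (\<lambda>x. cnj (f x)) \<in> rational_on S"
proof (induction rule: rational_on.induct)
  case (linear f)
  then have "linear (\<lambda>x. cnj (f x))" by (simp add: linear_iff)
  then show ?case by (rule rational_on.linear)
qed (auto intro: rational_on.intros)

lemma rational_on_det:
  "(\<And>i j. (\<lambda>x. A x $ i $ j) \<in> rational_on S) \<Longrightarrow> (\<lambda>x. det (A x)) \<in> rational_on S"
  unfolding det_def by (intro rational_on_sum rational_on.mult rational_on.const rational_on_prod)

lemma rational_on_subset: "f \<in> rational_on S \<Longrightarrow> T \<subseteq> S \<Longrightarrow> f \<in> rational_on T"
  by (induction rule: rational_on.induct) (auto intro: rational_on.intros)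

lemmas rational_on_intros = rational_on.const rational_on.add rational_on.mult rational_on_uminus rational_on_diff
  rational_on_divide rational_on_sum rational_on_prod rational_on_cnj

lemma rational_on_has_derivative:
  "f \<in> rational_on S \<Longrightarrow>
    \<exists>D. (\<forall>x\<in>S. (f has_derivative D x) (at x)) \<and> (\<forall>v. (\<lambda>x. D x v) \<in> rational_on S)"
proof (induction rule: rational_on.induct)
  case (linear f)
  then show ?case
    by (intro exI[of _ "\<lambda>x. f"]) (auto intro: linear_imp_has_derivative rational_on.const)
next
  case (const c)
  then show ?case by (intro exI[of _ "\<lambda>x v. 0"]) (auto intro: rational_on.const)
next
  case (add f g)
  then obtain D E where D: "\<And>x. x \<in> S \<Longrightarrow> (f has_derivative D x) (at x)" "\<And>v. (\<lambda>x. D x v) \<in> rational_on S"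
    and E: "\<And>x. x \<in> S \<Longrightarrow> (g has_derivative E x) (at x)" "\<And>v. (\<lambda>x. E x v) \<in> rational_on S" by blast
  show ?case
    by (intro exI[of _ "\<lambda>x v. D x v + E x v"] conjI ballI allI rational_on.add D E has_derivative_add)
next
  case (mult f g)
  then obtain D E where D: "\<And>x. x \<in> S \<Longrightarrow> (f has_derivative D x) (at x)" "\<And>v. (\<lambda>x. D x v) \<in> rational_on S"
    and E: "\<And>x. x \<in> S \<Longrightarrow> (g has_derivative E x) (at x)" "\<And>v. (\<lambda>x. E x v) \<in> rational_on S" by blast
  show ?case
    by (intro exI[of _ "\<lambda>x v. f x * E x v + D x v * g x"] conjI ballI allI rational_on.add rational_on.mult
         mult.hyps D E has_derivative_mult)
next
  case (inverse f)
  then obtain D where D: "\<And>x. x \<in> S \<Longrightarrow> (f has_derivative D x) (at x)" "\<And>v. (\<lambda>x. D x v) \<in> rational_on S" by blast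
  show ?case
    by (intro exI[of _ "\<lambda>x v. - (inverse (f x) * D x v * inverse (f x))"] conjI ballI allI
         rational_on_uminus rational_on.mult rational_on.inverse inverse.hyps D Deriv.has_derivative_inverse)
qed

lemma has_derivative_components:
  fixes f :: "'a::real_normed_vector \<Rightarrow> complex^'m"
  assumes "\<And>i. ((\<lambda>x. f x $ i) has_derivative D i) F"
  shows "(f has_derivative (\<lambda>h. \<chi> i. D i h)) F"
proof -
  have ax: "bounded_linear (axis i :: complex \<Rightarrow> complex^'m)" for i
    unfolding linear_conv_bounded_linear[symmetric]
    by (simp add: linear_iff vec_eq_iff axis_def)
  have exp: "w = (\<Sum>i\<in>UNIV. axis i (w $ i))" for w :: "complex^'m"
    by (simp add: vec_eq_iff axis_def if_distrib sum.delta' cong: if_cong)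
  have "((\<lambda>x. \<Sum>i\<in>UNIV. axis i (f x $ i)) has_derivative (\<lambda>h. \<Sum>i\<in>UNIV. axis i (D i h))) F"
    by (intro has_derivative_sum bounded_linear.has_derivative[OF ax] assms)
  moreover have "(\<lambda>h. \<chi> i. D i h) = (\<lambda>h. \<Sum>i\<in>UNIV. axis i (D i h))"
    by (rule ext, subst exp) simp
  ultimately show ?thesis by (simp flip: exp)
qed

lemma rational_map_Ck_on:
  fixes f :: "'a::euclidean_space \<Rightarrow> complex^'m"
  assumes "open S" "\<And>i. (\<lambda>x. f x $ i) \<in> rational_on S"
  shows "Ck_on k S f"
  using assms(2)
proof (induction k arbitrary: f)
  case 0
  have "isCont f x" if "x \<in> S" for x
  proof -
    have "\<exists>D. ((\<lambda>x. f x $ i) has_derivative D) (at x)" for i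
      using rational_on_has_derivative[OF 0] that by blast
    then have "isCont (\<lambda>x. f x $ i) x" for i using has_derivative_continuous by blast
    then show ?thesis
      using tendsto_vec_lambda[of "\<lambda>x i. f x $ i" "\<lambda>i. f x $ i" "at x"] by (simp add: isCont_def)
  qed
  then show ?case by (simp add: continuous_at_imp_continuous_on)
next
  case (Suc k)
  have "\<forall>i. \<exists>D. (\<forall>x\<in>S. ((\<lambda>x. f x $ i) has_derivative D x) (at x)) \<and> (\<forall>v. (\<lambda>x. D x v) \<in> rational_on S)"
    using rational_on_has_derivative[OF Suc.prems] by blast
  then obtain D where D: "\<And>i x. x \<in> S \<Longrightarrow> ((\<lambda>x. f x $ i) has_derivative D i x) (at x)"
    "\<And>i v. (\<lambda>x. D i x v) \<in> rational_on S"
    by metis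
  have d: "(f has_derivative (\<lambda>h. \<chi> i. D i x h)) (at x)" if "x \<in> S" for x
    by (rule has_derivative_components) (rule D(1)[OF that])
  have "Ck_on k S (\<lambda>x. \<chi> i. D i x v)" for v by (rule Suc.IH) (simp add: D)
  then have "Ck_on k S (\<lambda>x. frechet_derivative f (at x) v)" for v
    by (rule Ck_on_cong[OF _ assms(1)]) (simp add: frechet_derivative_at[OF d, symmetric])
  then show ?case using d by (auto simp: differentiable_def)
qed

lemma rational_map_smooth_on:
  fixes f :: "'a::euclidean_space \<Rightarrow> complex^'m"
  assumes "open S" "\<And>i. (\<lambda>x. f x $ i) \<in> rational_on S"
  shows "smooth_on S f"
  using rational_map_Ck_on[OF assms] by (simp add: smooth_on_def)

lemma rational_on_smooth_on:
  assumes "open S" "f \<in> rational_on S"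
  shows "smooth_on S f"
proof -
  have "Ck_on k S f" for k
    using assms(2)
  proof (induction k arbitrary: f)
    case 0
    then show ?case
      using rational_on_has_derivative[OF 0] has_derivative_continuous
      by (fastforce intro!: continuous_at_imp_continuous_on)
  next
    case (Suc k)
    obtain D where D: "\<And>x. x \<in> S \<Longrightarrow> (f has_derivative D x) (at x)" "\<And>v. (\<lambda>x. D x v) \<in> rational_on S"
      using rational_on_has_derivative[OF Suc.prems] by blast
    have "Ck_on k S (\<lambda>x. frechet_derivative f (at x) v)" for v
      by (rule Ck_on_cong[OF Suc.IH[OF D(2)[of v]] assms(1)]) (simp add: frechet_derivative_at[OF D(1), symmetric])
    then show ?case using D by (auto simp: differentiable_def)
  qed
  then show ?thesis by (simp add: smooth_on_def)
qed

lemma open_rational_nonzero: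
  assumes "open S" "f \<in> rational_on S"
  shows "open {x \<in> S. f x \<noteq> 0}"
proof -
  have "continuous_on S f"
    using rational_on_smooth_on[OF assms] by (auto simp: smooth_on_def dest: spec[of _ 0])
  then have "open (f -` (- {0}) \<inter> S)"
    using assms(1) by (simp add: continuous_on_open_vimage open_Compl)
  moreover have "f -` (- {0}) \<inter> S = {x \<in> S. f x \<noteq> 0}" by auto
  ultimately show ?thesis by simp
qed

section \<open>Descending forms from the cone to projective space\<close>

lemma mem_cline_self: "z \<in> cline z"
  unfolding cline_def by (metis rangeI vector_smult_lid)

lemma cline_scale:
  assumes "c \<noteq> 0" shows "cline (c *s z) = cline z"
proof -
  have "range (\<lambda>d. d *s (c *s z)) = (\<lambda>d. d *s z) ` range (\<lambda>d. d * c)"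
    by (simp add: image_image vector_smult_assoc)
  moreover have "range (\<lambda>d. d * c) = UNIV"
    using assms by (metis (no_types) surj_def nonzero_divide_eq_eq)
  ultimately show ?thesis by (simp add: cline_def)
qed

lemma cline_eqD:
  assumes "cline z = cline w" "w \<noteq> 0"
  obtains c where "c \<noteq> 0" "w = c *s z"
proof -
  have "w \<in> cline z" using assms(1) mem_cline_self by metis
  then obtain c where "w = c *s z" by (auto simp: cline_def)
  moreover from this assms(2) have "c \<noteq> 0" by auto
  ultimately show ?thesis using that by blast
qed

lemma affine_coords_cline:
  assumes "z $ j \<noteq> 0"
  shows "affine_coords j e (cline z) $ k = z $ e k / z $ j"
proof -
  have "(THE w. w \<in> cline z \<and> w $ j = 1) = (1 / z $ j) *s z"
  proof (rule the_equality)
    show "(1 / z $ j) *s z \<in> cline z \<and> ((1 / z $ j) *s z) $ j = 1"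
      using assms by (auto simp: cline_def)
    fix w assume "w \<in> cline z \<and> w $ j = 1"
    then obtain c where "w = c *s z" "c * z $ j = 1" unfolding cline_def by force
    then show "w = (1 / z $ j) *s z" using assms by (simp add: field_simps)
  qed
  then show ?thesis by (simp add: affine_coords_def)
qed

definition cone_over :: "(complex^'n) set set \<Rightarrow> (complex^'n) set" where
  "cone_over U = {z. z \<noteq> 0 \<and> cline z \<in> U}"

lemma cone_over_scale: "z \<in> cone_over U \<Longrightarrow> c \<noteq> 0 \<Longrightarrow> c *s z \<in> cone_over U"
  by (simp add: cone_over_def cline_scale)

text \<open>
  The section with \<open>z\<^sub>j = 1\<close> of the projection to projective space, over an affine chart.
\<close>
definition affine_section :: "'n \<Rightarrow> ('m \<Rightarrow> 'n) \<Rightarrow> complex^'m \<Rightarrow> complex^'n" where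
  "affine_section j e x = (\<chi> i. if i = j then 1 else x $ inv e i)"

text \<open>
  The derivative of \<open>affine_section\<close>.
\<close>
definition affine_incl :: "'n \<Rightarrow> ('m \<Rightarrow> 'n) \<Rightarrow> complex^'m \<Rightarrow> complex^'n" where
  "affine_incl j e v = (\<chi> i. if i = j then 0 else v $ inv e i)"

definition numbering :: "'n \<Rightarrow> ('m \<Rightarrow> 'n) \<Rightarrow> bool" where
  "numbering j e \<longleftrightarrow> bij_betw e UNIV (UNIV - {j})"

lemma numbering_inv:
  assumes "numbering j e"
  shows "inv e (e k) = k" "e k \<noteq> j" "i \<noteq> j \<Longrightarrow> e (inv e i) = i"
  using assms unfolding numbering_def bij_betw_def by (auto simp: inv_f_f f_inv_into_f)

lemma affine_section_nonzero: "affine_section j e x $ j = 1" "affine_section j e x \<noteq> 0"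
proof -
  show "affine_section j e x $ j = 1" by (simp add: affine_section_def)
  then show "affine_section j e x \<noteq> 0" by (metis zero_index zero_neq_one)
qed

lemma affine_coords_section:
  assumes "numbering j e"
  shows "affine_coords j e (cline (affine_section j e x)) = x"
  using numbering_inv[OF assms]
  by (simp add: vec_eq_iff affine_coords_cline affine_section_nonzero) (simp add: affine_section_def)

lemma affine_section_coords:
  assumes "numbering j e" "z $ j \<noteq> 0"
  shows "affine_section j e (affine_coords j e (cline z)) = (1 / z $ j) *s z"
  using assms numbering_inv[OF assms(1)]
  by (simp add: vec_eq_iff affine_section_def affine_coords_cline)

lemma linear_affine_incl: "linear (affine_incl j e)"
  by (simp add: linear_iff vec_eq_iff affine_incl_def)

lemma affine_section_has_derivative:
  "(affine_section j e has_derivative affine_incl j e) (at x)"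
proof -
  have "affine_section j e = (\<lambda>x. affine_incl j e x + axis j 1)"
    by (auto simp: fun_eq_iff vec_eq_iff affine_section_def affine_incl_def axis_def)
  moreover have "((\<lambda>x. affine_incl j e x + axis j 1) has_derivative affine_incl j e) (at x)"
    by (intro has_derivative_add_const linear_imp_has_derivative linear_affine_incl)
  ultimately show ?thesis by simp
qed

lemma rational_on_affine_section: "(\<lambda>x. affine_section j e x $ i) \<in> rational_on S"
proof (cases "i = j")
  case True
  then show ?thesis by (simp add: affine_section_def rational_on.const)
next
  case False
  then have "(\<lambda>x. affine_section j e x $ i) = (\<lambda>x. x $ inv e i)" by (simp add: affine_section_def)
  then show ?thesis by (simp add: rational_on.linear linear_iff)
qed

text \<open>
  A chart does not record the numbering of coordinates from which it was built. Any numbering that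
  gives the same coordinate map will do, because the forms below do not depend on the section.
\<close>
definition chart_index :: "((complex^'n) set, complex^'m) chart \<Rightarrow> 'n \<times> ('m \<Rightarrow> 'n)" where
  "chart_index c = (SOME (j, e). numbering j e \<and> (\<forall>z\<in>cone_over (fst c). z $ j \<noteq> 0) \<and> snd c = affine_coords j e)"

definition descended_form :: "(complex^'n \<Rightarrow> (complex^'n) form) \<Rightarrow> ((complex^'n) set, complex^'m) mform" where
  "descended_form \<Theta> c x v =
     (case chart_index c of (j, e) \<Rightarrow> \<Theta> (affine_section j e x) (\<lambda>i. affine_incl j e (v i)))"

lemma cone_over_coordinate: "cone_over ({cline z |z. z $ j \<noteq> 0} \<inter> X) = {z \<in> cone_over X. z $ j \<noteq> 0}"
proof -
  have "w $ j \<noteq> 0" if "w \<noteq> 0" and eq: "cline w = cline z" and nz: "z $ j \<noteq> 0" for w z :: "complex^'a"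
  proof -
    have "z \<noteq> 0" using nz by auto
    then obtain c where "z = c *s w" using cline_eqD[OF eq] by metis
    then show ?thesis using nz by auto
  qed
  then show ?thesis by (auto simp: cone_over_def)
qed

text \<open>
  All that is needed of a chart of the atlas, with the numbering chosen by \<open>chart_index\<close>.
\<close>
lemma CP_atlas_chart:
  assumes "(U, \<phi>) \<in> CP_atlas X" "X \<subseteq> CP" "open (cone_over X)"
  obtains j e where "numbering j e" "\<forall>z\<in>cone_over U. z $ j \<noteq> 0" "\<phi> = affine_coords j e"
    "\<And>\<Theta>. descended_form \<Theta> (U, \<phi>) = (\<lambda>x v. \<Theta> (affine_section j e x) (\<lambda>i. affine_incl j e (v i)))"
    "U \<subseteq> X" "U \<subseteq> CP" "open (cone_over U)"
proof -
  obtain j0 e0 where je: "numbering j0 e0" "\<phi> = affine_coords j0 e0" "U = {cline z |z. z $ j0 \<noteq> 0} \<inter> X"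
    using assms(1) by (auto simp: CP_atlas_def numbering_def)
  obtain j e where ix: "chart_index (U, \<phi>) = (j, e)" by (cases "chart_index (U, \<phi>)")
  have "case (j0, e0) of (j, e) \<Rightarrow> numbering j e \<and> (\<forall>z\<in>cone_over (fst (U, \<phi>)). z $ j \<noteq> 0) \<and> snd (U, \<phi>) = affine_coords j e"
    using je by (simp add: cone_over_coordinate)
  then have "case chart_index (U, \<phi>) of (j, e) \<Rightarrow> numbering j e \<and> (\<forall>z\<in>cone_over (fst (U, \<phi>)). z $ j \<noteq> 0) \<and> snd (U, \<phi>) = affine_coords j e"
    unfolding chart_index_def by (rule someI)
  then have P: "numbering j e" "\<forall>z\<in>cone_over U. z $ j \<noteq> 0" "\<phi> = affine_coords j e"
    by (auto simp: ix)
  have "open {z. z $ j0 \<noteq> (0::complex)}"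
    by (intro open_Collect_neq continuous_intros)
  then have "open (cone_over X \<inter> {z. z $ j0 \<noteq> 0})" using assms(3) by (rule open_Int[rotated])
  moreover have "cone_over X \<inter> {z. z $ j0 \<noteq> 0} = cone_over U" by (auto simp: je(3) cone_over_coordinate)
  ultimately have "open (cone_over U)" by simp
  moreover have "descended_form \<Theta> (U, \<phi>) = (\<lambda>x v. \<Theta> (affine_section j e x) (\<lambda>i. affine_incl j e (v i)))" for \<Theta>
    by (simp add: descended_form_def ix fun_eq_iff)
  ultimately show thesis using that[OF P] je(3) assms(2) by blast
qed

lemma CP_atlas_cover:
  assumes "CARD('n) = Suc CARD('m)" "X \<subseteq> CP"
  shows "(\<Union>(U, \<phi>)\<in>(CP_atlas X :: ((complex^'n) set, complex^'m) chart set). U) = X"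
proof (intro equalityI subsetI)
  fix L assume L: "L \<in> X"
  then obtain z where z: "z \<noteq> 0" "L = cline z" using assms(2) by (auto simp: projectivization_def)
  then obtain j where j: "z $ j \<noteq> 0" by (auto simp: vec_eq_iff)
  have "card (UNIV :: 'm set) = card (UNIV - {j} :: 'n set)" using assms(1) by (simp add: card_Diff_singleton)
  then obtain e :: "'m \<Rightarrow> 'n" where "bij_betw e UNIV (UNIV - {j})"
    using finite_same_card_bij[OF finite finite] by blast
  then have "({cline z |z. z $ j \<noteq> 0} \<inter> X, affine_coords j e) \<in> (CP_atlas X :: ((complex^'n) set, complex^'m) chart set)"
    by (auto simp: CP_atlas_def)
  moreover have "L \<in> {cline z |z. z $ j \<noteq> 0} \<inter> X" using L z j by auto
  ultimately show "L \<in> (\<Union>(U, \<phi>)\<in>(CP_atlas X :: ((complex^'n) set, complex^'m) chart set). U)" by blast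
qed (auto simp: CP_atlas_def)
lemma affine_coords_image:
  assumes "numbering j e" "\<forall>z\<in>cone_over U. z $ j \<noteq> 0" "U \<subseteq> CP"
  shows "affine_coords j e ` U = {x. affine_section j e x \<in> cone_over U}"
proof (intro equalityI subsetI)
  fix x assume "x \<in> affine_coords j e ` U"
  then obtain z where z: "z \<noteq> 0" "cline z \<in> U" "x = affine_coords j e (cline z)"
    using assms(3) by (auto simp: projectivization_def)
  then have j: "z $ j \<noteq> 0" "z \<in> cone_over U" using assms(2) by (auto simp: cone_over_def)
  then show "x \<in> {x. affine_section j e x \<in> cone_over U}"
    using z affine_section_coords[OF assms(1) j(1)] cone_over_scale[of z U "1 / z $ j"] by simp
next
  fix x assume "x \<in> {x. affine_section j e x \<in> cone_over U}"
  then have "cline (affine_section j e x) \<in> U" by (simp add: cone_over_def)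
  then show "x \<in> affine_coords j e ` U"
    using affine_coords_section[OF assms(1), of x] by (metis imageI)
qed

lemma affine_coords_inj_on:
  assumes "numbering j e" "\<forall>z\<in>cone_over U. z $ j \<noteq> 0" "U \<subseteq> CP"
  shows "inj_on (affine_coords j e) U"
proof (rule inj_on_inverseI[where g = "\<lambda>x. cline (affine_section j e x)"])
  fix L assume "L \<in> U"
  then obtain z where z: "z \<noteq> 0" "L = cline z" "z \<in> cone_over U"
    using assms(3) by (auto simp: projectivization_def cone_over_def)
  then have "z $ j \<noteq> 0" using assms(2) by simp
  then show "cline (affine_section j e (affine_coords j e L)) = L"
    using z affine_section_coords[OF assms(1), of z] by (simp add: cline_scale)
qed

lemma inv_into_affine_coords:
  assumes "numbering j e" "\<forall>z\<in>cone_over U. z $ j \<noteq> 0" "U \<subseteq> CP" "affine_section j e x \<in> cone_over U"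
  shows "inv_into U (affine_coords j e) x = cline (affine_section j e x)"
  using inv_into_f_f[OF affine_coords_inj_on[OF assms(1-3)], of "cline (affine_section j e x)"] assms(4)
    affine_coords_section[OF assms(1), of x] by (simp add: cone_over_def)

lemma open_affine_section_vimage:
  assumes "open (T :: (complex^'n) set)" shows "open {x. affine_section j e x \<in> T}"
proof -
  have "continuous_on UNIV (affine_section j e)"
    using affine_section_has_derivative has_derivative_continuous
    by (metis continuous_at_imp_continuous_on)
  from open_vimage[OF assms this] show ?thesis by (simp add: vimage_def)
qed

text \<open>
  Invariance under complex scaling together with blindness to the direction of \<open>z\<close>. Taking \<open>c = 1\<close>, adding
  complex multiples of \<open>z\<close> to the arguments changes nothing; so the pullback along a local section does not
  depend on the section.
\<close>
definition cone_basic :: "(complex^'n) set \<Rightarrow> (complex^'n \<Rightarrow> (complex^'n) form) \<Rightarrow> bool" where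
  "cone_basic C \<Theta> \<longleftrightarrow>
    (\<forall>z\<in>C. \<forall>c a v. c \<noteq> 0 \<longrightarrow> \<Theta> (c *s z) (\<lambda>i. c *s v i + a i *s z) = \<Theta> z v)"

lemma affine_coords_compose_has_derivative:
  fixes g :: "'a::real_normed_vector \<Rightarrow> complex^'n"
  assumes g: "(g has_derivative g') (at x)" and nz: "g x $ j \<noteq> 0"
  shows "((\<lambda>y. affine_coords j e (cline (g y))) has_derivative
     (\<lambda>w. \<chi> k. (g' w $ e k * g x $ j - g x $ e k * g' w $ j) / (g x $ j * g x $ j))) (at x)"
proof -
  have comp: "((\<lambda>y. g y $ i) has_derivative (\<lambda>w. g' w $ i)) (at x)" for i
    by (rule bounded_linear.has_derivative[OF bounded_linear_vec_nth g])
  have "((\<lambda>y. \<chi> k. g y $ e k / g y $ j) has_derivative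
     (\<lambda>w. \<chi> k. (g' w $ e k * g x $ j - g x $ e k * g' w $ j) / (g x $ j * g x $ j))) (at x)"
    by (rule has_derivative_components)
       (simp, rule has_derivative_divide'[OF comp comp nz])
  moreover have "\<forall>\<^sub>F y in at x. (\<chi> k. g y $ e k / g y $ j) = affine_coords j e (cline (g y))"
  proof -
    have "\<forall>\<^sub>F y in at x. g y $ j \<noteq> 0"
      using has_derivative_continuous[OF comp[of j]] nz
      by (simp add: isCont_def tendsto_imp_eventually_ne)
    then show ?thesis by (rule eventually_mono) (simp add: vec_eq_iff affine_coords_cline)
  qed
  ultimately show ?thesis
    by (rule has_derivative_transform_eventually) (simp_all add: vec_eq_iff affine_coords_cline nz)
qed

text \<open>
  Going down by a chart and up by its section turns \<open>g\<close> into \<open>g / g\<^sub>j\<close>, whose derivative is \<open>g'\<close> up to the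
  factor \<open>1 / g\<^sub>j\<close> and a multiple of \<open>g\<close>; an invariant form does not see either. With \<open>g\<close> a section of
  another chart this is the compatibility of chart expressions, with \<open>g\<close> the identity it compares the descended
  form with the form on the sphere.
\<close>
lemma pullback_descended_form:
  assumes chart: "(U, \<phi>) \<in> (CP_atlas X :: ((complex^'n) set, complex^'m) chart set)" "X \<subseteq> CP" "open (cone_over X)"
    and basic: "cone_basic (cone_over X) \<Theta>"
    and g: "(g has_derivative g') (at x)" and gx: "g x \<in> cone_over U"
  shows "pullback (\<lambda>y. \<phi> (cline (g y))) (descended_form \<Theta> (U, \<phi>)) x v = \<Theta> (g x) (\<lambda>i. g' (v i))"
proof -
  obtain j e where je: "numbering j e" "\<forall>z\<in>cone_over U. z $ j \<noteq> 0" "\<phi> = affine_coords j e"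
      "\<And>\<Theta>. descended_form \<Theta> (U, \<phi>) = (\<lambda>x v. \<Theta> (affine_section j e x) (\<lambda>i. affine_incl j e (v i)))"
      "U \<subseteq> X" "U \<subseteq> CP" "open (cone_over U)" using CP_atlas_chart[OF chart] by blast
  define z where "z = g x"
  have zj: "z $ j \<noteq> 0" using je(2) gx by (simp add: z_def)
  have zX: "z \<in> cone_over X" using gx je(5) by (auto simp: z_def cone_over_def)
  define D where "D w = (\<chi> k. (g' w $ e k * z $ j - z $ e k * g' w $ j) / (z $ j * z $ j))" for w
  have "((\<lambda>y. affine_coords j e (cline (g y))) has_derivative D) (at x)"
    using affine_coords_compose_has_derivative[OF g, of j e] zj unfolding D_def[abs_def] z_def by simp
  then have fd: "frechet_derivative (\<lambda>y. \<phi> (cline (g y))) (at x) = D"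
    unfolding je(3) by (rule frechet_derivative_at[symmetric])
  have incl: "affine_incl j e (D w) = (1 / z $ j) *s g' w + (- (g' w $ j) / (z $ j * z $ j)) *s z" for w
    using numbering_inv[OF je(1)] zj by (simp add: vec_eq_iff affine_incl_def D_def field_simps)
  have "pullback (\<lambda>y. \<phi> (cline (g y))) (descended_form \<Theta> (U, \<phi>)) x v =
      \<Theta> ((1 / z $ j) *s z) (\<lambda>i. (1 / z $ j) *s g' (v i) + (- (g' (v i) $ j) / (z $ j * z $ j)) *s z)"
    unfolding pullback_def fd je(4) incl unfolding je(3) using affine_section_coords[OF je(1) zj] by (simp add: z_def)
  also have "\<dots> = \<Theta> z (\<lambda>i. g' (v i))"
    using basic[unfolded cone_basic_def, rule_format, OF zX, of "1 / z $ j" "\<lambda>i. g' (v i)"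
        "\<lambda>i. - (g' (v i) $ j) / (z $ j * z $ j)"] zj by simp
  finally show ?thesis by (simp add: z_def)
qed

lemma CP_atlas_transition:
  assumes "(U, \<phi>) \<in> CP_atlas X" "(V, \<psi>) \<in> CP_atlas X" "X \<subseteq> CP" "open (cone_over X)"
    and je: "numbering j e" "\<forall>z\<in>cone_over U. z $ j \<noteq> 0" "\<phi> = affine_coords j e"
  shows "\<phi> ` (U \<inter> V) = {x. affine_section j e x \<in> cone_over U \<inter> cone_over V}"
    "open (\<phi> ` (U \<inter> V))"
    "x \<in> \<phi> ` (U \<inter> V) \<Longrightarrow> (\<psi> \<circ> inv_into U \<phi>) x = \<psi> (cline (affine_section j e x))"
proof -
  have U1: "U \<subseteq> CP" "open (cone_over U)" by (rule CP_atlas_chart[OF assms(1,3,4)], assumption)+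
  have V1: "V \<subseteq> CP" "open (cone_over V)" by (rule CP_atlas_chart[OF assms(2,3,4)], assumption)+
  have i: "cone_over (U \<inter> V) = cone_over U \<inter> cone_over V" by (auto simp: cone_over_def)
  show im: "\<phi> ` (U \<inter> V) = {x. affine_section j e x \<in> cone_over U \<inter> cone_over V}"
    unfolding je(3) i[symmetric] by (rule affine_coords_image) (use je U1 i in auto)
  show "open (\<phi> ` (U \<inter> V))" unfolding im
    by (intro open_affine_section_vimage open_Int U1 V1)
  show "(\<psi> \<circ> inv_into U \<phi>) x = \<psi> (cline (affine_section j e x))" if "x \<in> \<phi> ` (U \<inter> V)"
  proof -
    have "affine_section j e x \<in> cone_over U" using that unfolding im by simp
    then show ?thesis using inv_into_affine_coords[OF je(1,2) U1(1)] by (simp add: je(3))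
  qed
qed

text \<open>
  Transition maps are quotients of coordinates of a section.
\<close>
lemma smooth_atlas_CP:
  assumes "CARD('n) = Suc CARD('m)" "X \<subseteq> CP" "open (cone_over X)"
  shows "smooth_atlas X (CP_atlas X :: ((complex^'n) set, complex^'m) chart set)"
  unfolding smooth_atlas_def
proof (intro conjI)
  let ?A = "CP_atlas X :: ((complex^'n) set, complex^'m) chart set"
  show "(\<Union>(U, \<phi>)\<in>?A. U) = X" by (rule CP_atlas_cover[OF assms(1,2)])
  have 1: "inj_on \<phi> U \<and> open (\<phi> ` U)" if c: "(U, \<phi>) \<in> ?A" for U \<phi>
  proof -
    obtain j e where je: "numbering j e" "\<forall>z\<in>cone_over U. z $ j \<noteq> 0" "\<phi> = affine_coords j e"
      "\<And>\<Theta>. descended_form \<Theta> (U, \<phi>) = (\<lambda>x v. \<Theta> (affine_section j e x) (\<lambda>i. affine_incl j e (v i)))"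
      "U \<subseteq> X" "U \<subseteq> CP" "open (cone_over U)" using CP_atlas_chart[OF c assms(2,3)] by blast
    then show ?thesis
      using affine_coords_inj_on[OF je(1,2,6)] CP_atlas_transition(2)[OF c c assms(2,3) je(1-3)] by simp
  qed
  then show "\<forall>(U, \<phi>)\<in>?A. inj_on \<phi> U \<and> open (\<phi> ` U)" by auto
  have "open (\<phi> ` (U \<inter> V)) \<and> smooth_on (\<phi> ` (U \<inter> V)) (\<psi> \<circ> inv_into U \<phi>)"
    if c: "(U, \<phi>) \<in> ?A" and d: "(V, \<psi>) \<in> ?A" for U \<phi> V \<psi>
  proof -
    obtain j e where je: "numbering j e" "\<forall>z\<in>cone_over U. z $ j \<noteq> 0" "\<phi> = affine_coords j e"
      "\<And>\<Theta>. descended_form \<Theta> (U, \<phi>) = (\<lambda>x v. \<Theta> (affine_section j e x) (\<lambda>i. affine_incl j e (v i)))"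
      "U \<subseteq> X" "U \<subseteq> CP" "open (cone_over U)" using CP_atlas_chart[OF c assms(2,3)] by blast
    obtain j' e' where je': "numbering j' e'" "\<forall>z\<in>cone_over V. z $ j' \<noteq> 0" "\<psi> = affine_coords j' e'"
      "\<And>\<Theta>. descended_form \<Theta> (V, \<psi>) = (\<lambda>x v. \<Theta> (affine_section j' e' x) (\<lambda>i. affine_incl j' e' (v i)))"
      "V \<subseteq> X" "V \<subseteq> CP" "open (cone_over V)" using CP_atlas_chart[OF d assms(2,3)] by blast
    note tr = CP_atlas_transition[OF c d assms(2,3) je(1-3)]
    let ?S = "\<phi> ` (U \<inter> V)"
    have nz: "affine_section j e x $ j' \<noteq> 0" if "x \<in> ?S" for x
      using that je'(2) tr(1) by auto
    have "smooth_on ?S (\<lambda>x. \<chi> k. affine_section j e x $ e' k / affine_section j e x $ j')"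
      by (rule rational_map_smooth_on[OF tr(2)])
         (simp, intro rational_on_divide rational_on_affine_section nz)
    then have "smooth_on ?S (\<psi> \<circ> inv_into U \<phi>)"
      by (rule smooth_on_cong[OF _ tr(2)])
         (simp only: tr(3), simp add: je'(3) vec_eq_iff affine_coords_cline nz)
    then show ?thesis using tr(2) by simp
  qed
  then show "\<forall>(U, \<phi>)\<in>?A. \<forall>(V, \<psi>)\<in>?A.
      open (\<phi> ` (U \<inter> V)) \<and> smooth_on (\<phi> ` (U \<inter> V)) (\<psi> \<circ> inv_into U \<phi>)" by auto
qed

lemma differential_form_descended:
  assumes "X \<subseteq> CP" "open (cone_over X)"
    and basic: "cone_basic (cone_over X) \<Theta>"
    and smooth: "\<And>j (e :: 'm \<Rightarrow> 'n). numbering j e \<Longrightarrow>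
      smooth_form_on k {x. affine_section j e x \<in> cone_over X}
        (\<lambda>x v. \<Theta> (affine_section j e x) (\<lambda>i. affine_incl j e (v i)))"
  shows "differential_form k (CP_atlas X :: ((complex^'n) set, complex^'m) chart set) (descended_form \<Theta>)"
  unfolding differential_form_def
proof (intro conjI)
  let ?A = "CP_atlas X :: ((complex^'n) set, complex^'m) chart set"
  have "smooth_form_on k (\<phi> ` U) (descended_form \<Theta> (U, \<phi>))" if c: "(U, \<phi>) \<in> ?A" for U \<phi>
  proof -
    obtain j e where je: "numbering j e" "\<forall>z\<in>cone_over U. z $ j \<noteq> 0" "\<phi> = affine_coords j e"
      "\<And>\<Theta>. descended_form \<Theta> (U, \<phi>) = (\<lambda>x v. \<Theta> (affine_section j e x) (\<lambda>i. affine_incl j e (v i)))"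
      "U \<subseteq> X" "U \<subseteq> CP" "open (cone_over U)" using CP_atlas_chart[OF c assms(1,2)] by blast
    have "\<phi> ` U \<subseteq> {x. affine_section j e x \<in> cone_over X}"
      using CP_atlas_transition(1)[OF c c assms(1,2) je(1-3)] je(5) by (auto simp: cone_over_def)
    then show ?thesis
      using smooth[OF je(1)] unfolding je(4) smooth_form_on_def by (auto intro: smooth_on_subset)
  qed
  then show "\<forall>(U, \<phi>)\<in>?A. smooth_form_on k (\<phi> ` U) (descended_form \<Theta> (U, \<phi>))" by auto
  have "descended_form \<Theta> (U, \<phi>) x = pullback (\<psi> \<circ> inv_into U \<phi>) (descended_form \<Theta> (V, \<psi>)) x"
    if c: "(U, \<phi>) \<in> ?A" and d: "(V, \<psi>) \<in> ?A" and x: "x \<in> \<phi> ` (U \<inter> V)" for U \<phi> V \<psi> x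
  proof
    fix v
    obtain j e where je: "numbering j e" "\<forall>z\<in>cone_over U. z $ j \<noteq> 0" "\<phi> = affine_coords j e"
      "\<And>\<Theta>. descended_form \<Theta> (U, \<phi>) = (\<lambda>x v. \<Theta> (affine_section j e x) (\<lambda>i. affine_incl j e (v i)))"
      "U \<subseteq> X" "U \<subseteq> CP" "open (cone_over U)" using CP_atlas_chart[OF c assms(1,2)] by blast
    obtain j' e' where je': "numbering j' e'" "\<forall>z\<in>cone_over V. z $ j' \<noteq> 0" "\<psi> = affine_coords j' e'"
      "\<And>\<Theta>. descended_form \<Theta> (V, \<psi>) = (\<lambda>x v. \<Theta> (affine_section j' e' x) (\<lambda>i. affine_incl j' e' (v i)))"
      "V \<subseteq> X" "V \<subseteq> CP" "open (cone_over V)" using CP_atlas_chart[OF d assms(1,2)] by blast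
    note tr = CP_atlas_transition[OF c d assms(1,2) je(1-3)]
    let ?S = "\<phi> ` (U \<inter> V)" and ?s = "affine_section j e"
    have sx: "?s x \<in> cone_over V" using x tr(1) by auto
    have "((\<lambda>y. \<psi> (cline (?s y))) has_derivative frechet_derivative (\<lambda>y. \<psi> (cline (?s y))) (at x)) (at x)"
      using affine_coords_compose_has_derivative[OF affine_section_has_derivative, of j e x j' e'] bspec[OF je'(2) sx]
      unfolding je'(3) frechet_derivative_works[symmetric] differentiable_def by blast
    then have "((\<psi> \<circ> inv_into U \<phi>) has_derivative frechet_derivative (\<lambda>y. \<psi> (cline (?s y))) (at x)) (at x)"
      by (rule has_derivative_transform_within_open[OF _ tr(2) x]) (simp only: tr(3))
    then have "frechet_derivative (\<psi> \<circ> inv_into U \<phi>) (at x) = frechet_derivative (\<lambda>y. \<psi> (cline (?s y))) (at x)"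
      by (rule frechet_derivative_at[symmetric])
    then have "pullback (\<psi> \<circ> inv_into U \<phi>) (descended_form \<Theta> (V, \<psi>)) x v =
        pullback (\<lambda>y. \<psi> (cline (?s y))) (descended_form \<Theta> (V, \<psi>)) x v"
      unfolding pullback_def tr(3)[OF x] by simp
    also have "\<dots> = \<Theta> (?s x) (\<lambda>i. affine_incl j e (v i))"
      by (rule pullback_descended_form[OF d assms(1,2) basic affine_section_has_derivative sx])
    finally show "descended_form \<Theta> (U, \<phi>) x v = pullback (\<psi> \<circ> inv_into U \<phi>) (descended_form \<Theta> (V, \<psi>)) x v"
      by (simp add: je(4))
  qed
  then show "\<forall>(U, \<phi>)\<in>?A. \<forall>(V, \<psi>)\<in>?A. \<forall>x\<in>\<phi> ` (U \<inter> V).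
      descended_form \<Theta> (U, \<phi>) x = pullback (\<psi> \<circ> inv_into U \<phi>) (descended_form \<Theta> (V, \<psi>)) x" by blast
qed

lemma pullback_to_sphere:
  assumes "(U, \<phi>) \<in> (CP_atlas X :: ((complex^'n) set, complex^'m) chart set)" "X \<subseteq> CP" "open (cone_over X)"
    and "cone_basic (cone_over X) \<Theta>" and "norm p = 1" "cline p \<in> U"
  shows "pullback (\<phi> \<circ> cline) (descended_form \<Theta> (U, \<phi>)) p v = \<Theta> p v"
proof -
  have "p \<in> cone_over U" using assms by (auto simp: cone_over_def)
  from pullback_descended_form[OF assms(1-4) has_derivative_ident, of p v] this
  show ?thesis by (simp add: o_def)
qed

section \<open>Hermitian algebra of covectors\<close>

text \<open>
  The value of \<open>\<Sum>\<^sub>j a\<^sub>j dz\<^sub>j\<close> on a single vector.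
\<close>
definition lin :: "complex^'n \<Rightarrow> complex^'n \<Rightarrow> complex" where
  "lin a u = (\<Sum>j\<in>UNIV. a $ j * u $ j)"

definition cnjv :: "complex^'n \<Rightarrow> complex^'n" where
  "cnjv a = (\<chi> j. cnj (a $ j))"

lemma lin_add: "lin a (u + w) = lin a u + lin a w"
  by (simp add: lin_def algebra_simps sum.distrib)

lemma lin_scale: "lin a (c *s u) = c * lin a u"
  by (simp add: lin_def sum_distrib_left algebra_simps)

lemma lin_scale_left: "lin (c *s a) u = c * lin a u"
  by (simp add: lin_def sum_distrib_left algebra_simps)

lemma lin_diff_left: "lin (a - b) u = lin a u - lin b u"
  by (simp add: lin_def algebra_simps sum_subtractf)

lemma linear_lin: "linear (lin a)"
  by (rule linearI) (simp_all add: lin_add, simp add: lin_def scaleR_sum_right)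

lemma lin_axis: "lin (axis j 1) u = u $ j"
proof -
  have "axis j 1 $ k * u $ k = (if k = j then u $ k else 0)" for k by (simp add: axis_def)
  then show ?thesis by (simp add: lin_def)
qed

lemma cnjv_scale: "cnjv (c *s a) = cnj c *s cnjv a"
  by (simp add: cnjv_def vec_eq_iff)

lemma herm_eq_lin: "herm a b = lin b (cnjv a)"
  by (simp add: herm_def lin_def cnjv_def mult.commute)

lemma herm_cnjv_left: "herm (cnjv z) b = lin b z"
  by (simp add: herm_def lin_def cnjv_def mult.commute)

lemma herm_commute: "herm b a = cnj (herm a b)"
  by (simp add: herm_def mult.commute)

lemma herm_scale: "herm (c *s a) (d *s b) = cnj c * d * herm a b"
  by (simp add: herm_def sum_distrib_left algebra_simps)

lemma herm_scale_right: "herm a (d *s b) = d * herm a b"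
  by (simp add: herm_def sum_distrib_left algebra_simps)

lemma herm_scale_left: "herm (d *s a) b = cnj d * herm a b"
  by (simp add: herm_def sum_distrib_left algebra_simps)

lemma herm_diff_right: "herm a (b - c) = herm a b - herm a c"
  by (simp add: herm_def algebra_simps sum_subtractf)

lemma herm_self: "herm a a = norm_sq a"
proof -
  have "(norm a)\<^sup>2 = (\<Sum>j\<in>UNIV. (cmod (a $ j))\<^sup>2)"
    unfolding norm_vec_def L2_set_def by (simp add: sum_nonneg)
  then show ?thesis
    by (simp add: norm_sq_def herm_def complex_norm_square mult.commute del: of_real_power)
qed

lemma norm_sq_nonzero: "norm_sq a = 0 \<longleftrightarrow> a = 0"
  by (simp add: norm_sq_def)

lemma norm_sq_eq: "norm_sq a = of_real (norm a) * of_real (norm a)"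
  by (simp add: norm_sq_def power2_eq_square)

lemma norm_sq_scale: "norm_sq (c *s a) = c * cnj c * norm_sq a"
  by (simp add: herm_scale mult.commute flip: herm_self)

lemma norm_cnjv [simp]: "norm (cnjv a) = norm a"
  by (simp add: norm_vec_def L2_set_def cnjv_def)

definition orthonormal_list :: "(complex^'n) list \<Rightarrow> bool" where
  "orthonormal_list N \<longleftrightarrow>
     (\<forall>i<length N. \<forall>j<length N. herm (N ! i) (N ! j) = (if i = j then 1 else 0))"

lemma orthonormal_list_phases:
  assumes "orthonormal_list N" "length ps = length N" "\<And>p. p \<in> set ps \<Longrightarrow> cnj p * p = 1"
  shows "orthonormal_list (map2 (*s) ps N)"
  using assms by (auto simp: orthonormal_list_def herm_scale)

lemma ex_indexing:
  assumes "length xs = CARD('n::finite)"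
  obtains ix :: "'n::finite \<Rightarrow> nat" where "bij_betw ix UNIV {..<length xs}"
proof -
  have "card (UNIV :: 'n set) = card {..<length xs}" using assms by simp
  then show thesis using that finite_same_card_bij[OF finite finite_lessThan] by blast
qed

text \<open>
  A square matrix with a zero row has a nontrivial kernel, so fewer than \<open>n\<close> covectors have a common
  orthogonal one.
\<close>
lemma orthonormal_extend:
  fixes N :: "(complex^'n) list"
  assumes "orthonormal_list N" "length N < CARD('n)"
  obtains t where "orthonormal_list (N @ [t])"
proof -
  obtain ix :: "'n \<Rightarrow> nat" where ix: "bij_betw ix UNIV {..<CARD('n)}"
    using finite_same_card_bij[of "UNIV :: 'n set" "{..<CARD('n)}"] by fastforce
  define A :: "complex^'n^'n" where "A = (\<chi> a. if ix a < length N then cnjv (N ! ix a) else 0)"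
  have surj: "\<exists>a. ix a = i" if "i < CARD('n)" for i
  proof -
    have "i \<in> range ix" using that bij_betw_imp_surj_on[OF ix] by simp
    then show ?thesis by auto
  qed
  obtain a0 where "ix a0 = length N" using surj[OF assms(2)] by blast
  then have "row a0 A = 0" by (simp add: row_def A_def vec_eq_iff)
  then have "det A = 0" by (rule det_zero_row)
  then have "\<not> (\<exists>B. B ** A = mat 1)" using invertible_det_nz[of A] invertible_left_inverse[of A] by simp
  then obtain x where x: "A *v x = 0" "x \<noteq> 0" unfolding matrix_left_invertible_ker by blast
  have orth: "herm (N ! i) x = 0" if i: "i < length N" for i
  proof -
    obtain a where a: "ix a = i" using surj[of i] less_trans[OF i assms(2)] by blast
    have "(A *v x) $ a = herm (N ! i) x"
      using i a by (simp add: matrix_vector_mult_def A_def herm_def cnjv_def)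
    then show ?thesis using x by simp
  qed
  define t where "t = (1 / of_real (norm x)) *s x"
  have n: "complex_of_real (norm x) \<noteq> 0" using x by simp
  have tt: "herm t t = 1" unfolding t_def herm_scale using n by (simp add: herm_self norm_sq_eq)
  have Nt: "herm (N ! i) t = 0" if "i < length N" for i
    using orth[OF that] by (simp add: t_def herm_scale_right)
  then have tN: "herm t (N ! i) = 0" if "i < length N" for i
    using herm_commute[of t "N ! i"] that by simp
  have "orthonormal_list (N @ [t])"
    using assms(1) unfolding orthonormal_list_def
    by (auto simp: nth_append less_Suc_eq tt Nt tN)
  then show thesis by (rule that)
qed

lemma orthonormal_completion:
  fixes N :: "(complex^'n) list"
  assumes "orthonormal_list N" "length N + k \<le> CARD('n)"
  obtains ts where "length ts = k" "orthonormal_list (N @ ts)"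
proof -
  have "\<exists>ts. length ts = k \<and> orthonormal_list (N @ ts)"
    using assms
  proof (induction k)
    case (Suc k)
    then obtain ts where ts: "length ts = k" "orthonormal_list (N @ ts)" by auto
    obtain t where "orthonormal_list ((N @ ts) @ [t])"
      by (rule orthonormal_extend[OF ts(2)]) (use ts Suc.prems in auto)
    then show ?case using ts by (intro exI[of _ "ts @ [t]"]) auto
  qed auto
  then show thesis using that by blast
qed

lemma sum_list_reindex:
  assumes "bij_betw ix (UNIV :: 'n::finite set) {..<length N}"
  shows "(\<Sum>r\<leftarrow>N. f r) = (\<Sum>a\<in>UNIV. f (N ! ix a))"
  using sum.reindex_bij_betw[OF assms, of "\<lambda>i. f (N ! i)"]
  by (simp add: sum_list_sum_nth atLeast0LessThan)

lemma det_cnj: "det (\<chi> i j. cnj (A $ i $ j)) = cnj (det A)"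
  by (simp add: det_def)

lemma orthonormal_list_unitary:
  fixes N :: "(complex^'n) list"
  assumes "orthonormal_list N" and ix: "bij_betw ix (UNIV :: 'n set) {..<length N}"
  defines "A \<equiv> \<chi> a. N ! ix a"
  shows "A ** (\<chi> k b. cnj (A $ b $ k)) = mat 1"
proof -
  have "ix a < length N" for a using ix by (auto simp: bij_betw_def)
  moreover have "ix a = ix b \<longleftrightarrow> a = b" for a b using ix by (auto simp: bij_betw_def inj_on_def)
  ultimately have "herm (N ! ix b) (N ! ix a) = (if a = b then 1 else 0)" for a b
    using assms(1) unfolding orthonormal_list_def by auto
  then show ?thesis
    by (simp add: vec_eq_iff matrix_matrix_mult_def mat_def A_def herm_def mult.commute)
qed

lemma orthonormal_list_det:
  fixes N :: "(complex^'n) list"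
  assumes "orthonormal_list N" "bij_betw ix (UNIV :: 'n set) {..<length N}"
  shows "det (\<chi> a. N ! ix a) * cnj (det (\<chi> a. N ! ix a)) = 1"
proof -
  let ?A = "\<chi> a. N ! ix a"
  have "(\<chi> k b. cnj (?A $ b $ k)) = transpose (\<chi> i j. cnj (?A $ i $ j))"
    by (simp add: transpose_def)
  then have "det (\<chi> k b. cnj (?A $ b $ k)) = cnj (det ?A)"
    by (simp only: det_transpose det_cnj)
  then show ?thesis
    using arg_cong[OF orthonormal_list_unitary[OF assms], of det] by (simp add: det_mul)
qed
text \<open>
  A square matrix with orthonormal rows also has orthonormal columns.
\<close>
lemma parseval:
  fixes N :: "(complex^'n) list"
  assumes "orthonormal_list N" and len: "length N = CARD('n)"
  shows "(\<Sum>r\<leftarrow>N. lin r u * cnj (lin r w)) = (\<Sum>j\<in>UNIV. u $ j * cnj (w $ j))"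
proof -
  obtain ix :: "'n \<Rightarrow> nat" where ix: "bij_betw ix UNIV {..<length N}" by (rule ex_indexing[OF len])
  let ?A = "\<chi> a. N ! ix a" and ?B = "\<chi> k b. cnj ((\<chi> a. N ! ix a) $ b $ k)"
  have BA: "?B ** ?A = mat 1"
    by (rule matrix_left_right_inverse1[OF orthonormal_list_unitary[OF assms(1) ix]])
  have Aw: "(?A *v w) $ a = lin (N ! ix a) w" for w a
    by (simp add: matrix_vector_mult_def lin_def)
  have "?B *v (?A *v w) = w" by (simp only: matrix_vector_mul_assoc BA matrix_vector_mul_lid)
  then have w: "(\<Sum>a\<in>UNIV. cnj (N ! ix a $ j) * lin (N ! ix a) w) = w $ j" for j
    unfolding vec_eq_iff Aw[symmetric] by (simp add: matrix_vector_mult_def)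
  have "(\<Sum>r\<leftarrow>N. lin r u * cnj (lin r w)) = (\<Sum>a\<in>UNIV. \<Sum>j\<in>UNIV. u $ j * (N ! ix a $ j * cnj (lin (N ! ix a) w)))"
    by (simp add: sum_list_reindex[OF ix] lin_def[of _ u] sum_distrib_left mult_ac)
  also have "\<dots> = (\<Sum>j\<in>UNIV. u $ j * (\<Sum>a\<in>UNIV. N ! ix a $ j * cnj (lin (N ! ix a) w)))"
    by (subst sum.swap) (simp add: sum_distrib_left)
  also have "\<dots> = (\<Sum>j\<in>UNIV. u $ j * cnj (w $ j))"
    by (simp flip: w)
  finally show ?thesis .
qed

section \<open>Contractions of the holomorphic volume form\<close>

lemma dform_scale_arg:
  assumes "\<And>f. f \<in> set fs \<Longrightarrow> f (x' :: 'v) = c * f x" and i: "i < length fs"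
  shows "dform fs (v(i := x')) = c * dform fs (v(i := x))"
  unfolding dform_def alternation_def sum_distrib_left
proof (rule sum.cong[OF refl])
  fix \<sigma> assume "\<sigma> \<in> {\<sigma>. \<sigma> permutes {..<length fs}}"
  then have s: "\<sigma> permutes {..<length fs}" by simp
  have "(fs ! inv \<sigma> i) x' = c * (fs ! inv \<sigma> i) x"
    using assms(1) tensor_permuted_update(1)[OF s i] by simp
  then show "of_int (sign \<sigma>) * tensor fs (\<lambda>l. (v(i := x')) (\<sigma> l)) =
      c * (of_int (sign \<sigma>) * tensor fs (\<lambda>l. (v(i := x)) (\<sigma> l)))"
    unfolding tensor_permuted_update(2)[OF s i] by simp
qed

abbreviation (input) coordinate_list :: "8 list" where "coordinate_list \<equiv> [1, 2, 3, 4, 5, 6, 7, 8]"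

lemma coordinate_list: "distinct coordinate_list" "set coordinate_list = UNIV"
proof -
  show d: "distinct coordinate_list" by simp
  show "set coordinate_list = UNIV"
    by (rule card_subset_eq) (use distinct_card[OF d] in simp_all)
qed

lemma form10_eq: "form10 a = (\<lambda>v. lin a (v 0))"
  by (simp add: form10_def lin_def fun_eq_iff)

lemma Omega0_eq_dform: "Omega0 = dform (map (\<lambda>j. lin (axis j 1)) coordinate_list)"
  unfolding Omega0_def wedge_list_eq_dform[symmetric] by (simp add: form10_eq)

text \<open>
  The index of a coordinate in the list that defines the volume form. In the type \<open>8\<close>, the last entry is \<open>0\<close>.
\<close>
lemma ex_coordinate_indexing:
  obtains ix :: "8 \<Rightarrow> nat" where "bij_betw ix UNIV {..<8}" "\<And>a. coordinate_list ! ix a = a"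
proof -
  have b: "bij_betw (nth coordinate_list) {..<8} UNIV"
    using bij_betw_nth[OF coordinate_list(1), of "{..<8}" UNIV] coordinate_list(2) by simp
  show thesis
    by (rule that[OF bij_betw_inv_into[OF b]]) (use bij_betw_inv_into_right[OF b] in simp)
qed

lemma Omega0_eq_det:
  assumes ix: "bij_betw ix UNIV {..<8}" "\<And>a. coordinate_list ! ix a = a"
  shows "Omega0 v = det (\<chi> k b. v (ix b) $ k)"
proof -
  have lt: "ix a < 8" for a using ix(1) by (auto simp: bij_betw_def)
  have ix': "bij_betw ix UNIV {..<length (map (\<lambda>j. lin (axis j (1::complex))) coordinate_list)}"
    using ix by (simp add: eval_nat_numeral)
  have "(map (\<lambda>j. lin (axis j 1)) coordinate_list ! ix a) (v (ix b)) = v (ix b) $ a" for a b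
    using nth_map[of "ix a" coordinate_list "\<lambda>j. lin (axis j (1::complex))"] lt[of a]
    unfolding ix(2) by (simp add: lin_axis)
  then show ?thesis unfolding Omega0_eq_dform dform_eq_det[OF ix'] by simp
qed

lemma Omega0_nonzero: "\<exists>v. Omega0 v \<noteq> 0"
proof -
  obtain ix :: "8 \<Rightarrow> nat" where ix: "bij_betw ix UNIV {..<8}" "\<And>a. coordinate_list ! ix a = a"
    using ex_coordinate_indexing by blast
  have "(\<chi> k b. axis (coordinate_list ! ix b) 1 $ k) = (mat 1 :: complex^8^8)"
    unfolding ix(2) by (simp add: vec_eq_iff mat_def axis_def)
  then have "Omega0 (\<lambda>i. axis (coordinate_list ! i) 1) = 1"
    unfolding Omega0_eq_det[OF ix] by simp
  then show ?thesis by (metis zero_neq_one)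
qed
text \<open>
  Multiplicativity of the determinant: the values of the covectors form the product of the matrix of
  coefficients with the matrix of vectors.
\<close>
lemma dform_lin_eq_Omega0:
  assumes len: "length R = 8" and ix: "bij_betw ix UNIV {..<8}" "\<And>a. coordinate_list ! ix a = a"
  shows "dform (map lin R) v = det (\<chi> a. R ! ix a) * Omega0 v"
proof -
  have lt: "ix a < 8" for a using ix(1) by (auto simp: bij_betw_def)
  let ?V = "\<chi> k b. v (ix b) $ k"
  have ix': "bij_betw ix UNIV {..<length (map lin R)}" using ix len by simp
  have "dform (map lin R) v = det (\<chi> a b. lin (R ! ix a) (v (ix b)))"
    unfolding dform_eq_det[OF ix'] using lt len by simp
  also have "(\<chi> a b. lin (R ! ix a) (v (ix b))) = (\<chi> a. R ! ix a) ** ?V"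
    by (simp add: vec_eq_iff matrix_matrix_mult_def lin_def)
  also have "det \<dots> = det (\<chi> a. R ! ix a) * det ?V" by (rule det_mul)
  also have "det ?V = Omega0 v" by (rule Omega0_eq_det[OF ix, symmetric])
  finally show ?thesis .
qed

text \<open>
  On a form that is complex linear in the first slot, the contributions of the real and of the imaginary part
  of a vector of type \<open>(1,0)\<close> are both one half.
\<close>
lemma ccontract_vec10:
  assumes "\<And>c. \<phi> (case_nat (c *s w) v) = c * \<phi> (case_nat w v)"
  shows "ccontract (vec10 w) \<phi> v = \<phi> (case_nat w v)"
  unfolding ccontract_def vec10_def contract_def fst_conv snd_conv assms by simp

text \<open>
  The 5-form that remains of the volume form after the three contractions.
\<close>
definition residual_form :: "complex^8 \<Rightarrow> complex^8 \<Rightarrow> complex^8 \<Rightarrow> (complex^8) form" where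
  "residual_form z w2 w1 v = Omega0 (case_nat z (case_nat w2 (case_nat w1 v)))"

lemma Omega0_scale_arg: "i < 8 \<Longrightarrow> Omega0 (v(i := c *s x)) = c * Omega0 (v(i := x))"
  unfolding Omega0_eq_dform by (rule dform_scale_arg) (auto simp: lin_axis)

lemma case_nat_eq_upd:
  "case_nat x v = (case_nat undefined v)(0 := x)"
  "case_nat y (case_nat x v) = (case_nat y (case_nat undefined v))(1 := x)"
  "case_nat z (case_nat y (case_nat x v)) = (case_nat z (case_nat y (case_nat undefined v)))(2 := x)"
  by (auto simp: fun_eq_iff split: nat.splits)

lemma contractions_eq_residual_form:
  "ccontract (sharp_cnj b1) (ccontract (sharp_cnj b2) (ccontract (euler z) Omega0)) =
     residual_form z (cnjv b2) (cnjv b1)"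
proof -
  have 1: "ccontract (euler z) Omega0 = (\<lambda>v. Omega0 (case_nat z v))"
    unfolding euler_def
  proof (rule ext, rule ccontract_vec10)
    show "Omega0 (case_nat (c *s z) v) = c * Omega0 (case_nat z v)" for c v
      by (subst (1 2) case_nat_eq_upd(1)) (simp add: Omega0_scale_arg)
  qed
  have 2: "ccontract (sharp_cnj b2) \<dots> = (\<lambda>v. Omega0 (case_nat z (case_nat (cnjv b2) v)))"
    unfolding sharp_cnj_def cnjv_def[symmetric]
  proof (rule ext, rule ccontract_vec10)
    show "Omega0 (case_nat z (case_nat (c *s w) v)) = c * Omega0 (case_nat z (case_nat w v))" for c v w
      by (subst (1 2) case_nat_eq_upd(2)) (simp add: Omega0_scale_arg)
  qed
  have 3: "ccontract (sharp_cnj b1) \<dots> = residual_form z (cnjv b2) (cnjv b1)"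
    unfolding sharp_cnj_def cnjv_def[symmetric]
  proof (rule ext, subst ccontract_vec10)
    show "Omega0 (case_nat z (case_nat y (case_nat (c *s w) v))) = c * Omega0 (case_nat z (case_nat y (case_nat w v)))" for c v w y
      by (subst (1 2) case_nat_eq_upd(3)) (simp add: Omega0_scale_arg)
  qed (simp add: residual_form_def)
  show ?thesis unfolding 1 2 3 ..
qed

definition Omega_of :: "complex^8 \<Rightarrow> complex^8 \<Rightarrow> complex^8 \<Rightarrow> (complex^8) form" where
  "Omega_of b1 b2 z v = 1 / (norm_sq b1 * norm_sq b2) *
     wedge 1 6 (cnj_form (form10 b1)) (wedge 1 5 (cnj_form (form10 b2)) (residual_form z (cnjv b2) (cnjv b1))) v"

lemma twisted_Omega_eq: "twisted_Omega \<alpha>1 \<alpha>2 z v = Omega_of (\<alpha>1 z) (gram_schmidt2 (\<alpha>1 z) (\<alpha>2 z)) z v"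
  by (simp add: twisted_Omega_def Omega_of_def Let_def contractions_eq_residual_form)

text \<open>
  The first three members are dual to \<open>z\<close>, \<open>cnj b2\<close>, \<open>cnj b1\<close>, in the order in which the contractions insert
  these vectors, if the triple is orthogonal.
\<close>
definition dual_frame :: "complex^8 \<Rightarrow> complex^8 \<Rightarrow> complex^8 \<Rightarrow> (complex^8) list \<Rightarrow> (complex^8) list" where
  "dual_frame b1 b2 z ts = [(1 / norm_sq z) *s cnjv z, (1 / norm_sq b2) *s b2, (1 / norm_sq b1) *s b1] @ ts"

text \<open>
  The conditions on \<open>lin\<close> say that \<open>b1\<close> and \<open>b2\<close> are orthogonal to the covector \<open>cnjv z\<close>.
\<close>
definition orthogonal_triple :: "complex^'n \<Rightarrow> complex^'n \<Rightarrow> complex^'n \<Rightarrow> bool" where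
  "orthogonal_triple b1 b2 z \<longleftrightarrow> z \<noteq> 0 \<and> b1 \<noteq> 0 \<and> b2 \<noteq> 0 \<and> lin b1 z = 0 \<and> lin b2 z = 0 \<and> herm b1 b2 = 0"

lemma lin_cnjv_self: "lin (cnjv z) z = norm_sq z"
  by (simp add: lin_def cnjv_def herm_def flip: herm_self)

text \<open>
  The frame expresses the volume form as \<open>1 / \<kappa>\<close> times its product. Each of the three contractions removes the
  first member of the frame and sees none of the others.
\<close>
lemma residual_form_eq:
  assumes tri: "orthogonal_triple b1 b2 z"
    and ts: "\<And>t. t \<in> set ts \<Longrightarrow> lin t z = 0 \<and> herm b1 t = 0 \<and> herm b2 t = 0"
    and \<kappa>: "\<And>v. dform (map lin (dual_frame b1 b2 z ts)) v = \<kappa> * Omega0 v" "\<kappa> \<noteq> 0"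
  shows "residual_form z (cnjv b2) (cnjv b1) v = dform (map lin ts) v / \<kappa>"
proof -
  have nz: "norm_sq z \<noteq> 0" "norm_sq b1 \<noteq> 0" "norm_sq b2 \<noteq> 0"
    using tri by (auto simp: orthogonal_triple_def norm_sq_nonzero)
  have "herm b2 b1 = 0" using tri herm_commute[of b2 b1] by (simp add: orthogonal_triple_def)
  then have v: "lin b1 (cnjv b2) = 0" "lin b1 z = 0" "lin b2 z = 0"
    using tri by (auto simp: orthogonal_triple_def herm_eq_lin)
  have self: "lin b (cnjv b) = norm_sq b" for b :: "complex^8" by (simp flip: herm_eq_lin herm_self)
  have "\<kappa> * residual_form z (cnjv b2) (cnjv b1) v = dform (map lin ts) v"
    unfolding residual_form_def \<kappa>(1)[symmetric] dual_frame_def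
    by (simp, subst dform_contract, use ts v in \<open>force simp: lin_scale_left\<close>,
        subst dform_contract, use ts v in \<open>force simp: lin_scale_left herm_eq_lin\<close>,
        subst dform_contract, use ts v in \<open>force simp: lin_scale_left herm_eq_lin\<close>)
       (use nz in \<open>simp add: lin_scale_left lin_cnjv_self self\<close>)
  then show ?thesis using \<kappa>(2) by (simp add: field_simps)
qed

lemma cnj_form10: "cnj_form (form10 a) = dform [cnjf (lin a)]"
  by (simp add: cnj_form_def form10_eq dform_single)

lemma Omega_of_eq:
  assumes tri: "orthogonal_triple b1 b2 z" and len: "length ts = 5"
    and ts: "\<And>t. t \<in> set ts \<Longrightarrow> lin t z = 0 \<and> herm b1 t = 0 \<and> herm b2 t = 0"
    and \<kappa>: "\<And>v. dform (map lin (dual_frame b1 b2 z ts)) v = \<kappa> * Omega0 v" "\<kappa> \<noteq> 0"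
  shows "Omega_of b1 b2 z v =
    1 / (norm_sq b1 * norm_sq b2 * \<kappa>) * dform ([cnjf (lin b1), cnjf (lin b2)] @ map lin ts) v"
proof -
  have R: "residual_form z (cnjv b2) (cnjv b1) = (\<lambda>v. (1 / \<kappa>) * dform (map lin ts) v)"
    by (rule ext) (simp add: residual_form_eq[OF tri ts \<kappa>])
  have "wedge 1 5 (cnj_form (form10 b2)) (residual_form z (cnjv b2) (cnjv b1)) =
      (\<lambda>v. (1 / \<kappa>) * dform (cnjf (lin b2) # map lin ts) v)"
    unfolding R cnj_form10 by (rule ext) (simp only: wedge_cmult_right, simp add: wedge_dform_append len)
  then show ?thesis
    unfolding Omega_of_def by (simp only: wedge_cmult_right cnj_form10) (simp add: wedge_dform_append len)
qed

section \<open>The two forms in an adapted frame\<close>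

lemma dform_scale_list:
  assumes "length cs = length fs"
  shows "dform (map2 (\<lambda>c f u. c * f u) cs fs) v = prod_list cs * dform fs v"
  using dform_scale[of fst snd "zip cs fs" v] assms by (simp add: case_prod_unfold)

lemma dform_lin_scale_list:
  assumes "length cs = length N"
  shows "dform (map lin (map2 (*s) cs N)) v = prod_list cs * dform (map lin N) v"
proof -
  have "map lin (map2 (*s) cs N) = map2 (\<lambda>c f u. c * f u) cs (map lin N)"
    by (rule nth_equalityI) (auto simp: assms lin_scale_left)
  then show ?thesis using dform_scale_list[of cs "map lin N" v] assms by simp
qed

definition pair_form :: "complex^'n \<Rightarrow> (complex^'n) form" where
  "pair_form a v = lin a (v 0) * cnj (lin a (v 1)) - lin a (v 1) * cnj (lin a (v 0))"

lemma wedge_form10_cnj: "wedge 1 1 (form10 a) (cnj_form (form10 a)) v = pair_form a v"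
proof -
  have "form10 a = dform [lin a]" by (simp add: form10_eq dform_single)
  then show ?thesis
    unfolding cnj_form10 by (simp add: wedge_dform_append dform_pair pair_form_def)
qed

lemma pair_form_scale: "pair_form (c *s a) v = c * cnj c * pair_form a v"
  by (simp add: pair_form_def lin_scale_left algebra_simps)

lemma pair_form_args:
  "lin a z = 0 \<Longrightarrow> pair_form a (\<lambda>i. c *s v i + h i *s z) = c * cnj c * pair_form a v"
  by (simp add: pair_form_def lin_add lin_scale algebra_simps)

lemma omega0_eq: "omega0 v = \<i> / 2 * (\<Sum>j\<in>UNIV. v 0 $ j * cnj (v 1 $ j) - v 1 $ j * cnj (v 0 $ j))"
  unfolding omega0_def wedge_form10_cnj by (simp add: pair_form_def lin_axis)

definition unit_frame :: "complex^8 \<Rightarrow> complex^8 \<Rightarrow> complex^8 \<Rightarrow> (complex^8) list \<Rightarrow> (complex^8) list" where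
  "unit_frame b1 b2 z ts =
     [(1 / of_real (norm z)) *s cnjv z, (1 / of_real (norm b2)) *s b2, (1 / of_real (norm b1)) *s b1] @ ts"

text \<open>
  Five covectors that complete the normalised triple to a unitary basis.
\<close>
definition adapted :: "complex^8 \<Rightarrow> complex^8 \<Rightarrow> complex^8 \<Rightarrow> (complex^8) list \<Rightarrow> bool" where
  "adapted b1 b2 z ts \<longleftrightarrow> length ts = 5 \<and> orthonormal_list (unit_frame b1 b2 z ts)"

lemma ex_adapted:
  assumes "orthogonal_triple b1 b2 z"
  obtains ts where "adapted b1 b2 z ts"
proof -
  have o: "herm (cnjv z) b1 = 0" "herm (cnjv z) b2 = 0" "herm b1 b2 = 0" "z \<noteq> 0" "b1 \<noteq> 0" "b2 \<noteq> 0"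
    using assms by (auto simp: orthogonal_triple_def herm_cnjv_left)
  then have o': "herm b1 (cnjv z) = 0" "herm b2 (cnjv z) = 0" "herm b2 b1 = 0"
    using herm_commute[of b1 "cnjv z"] herm_commute[of b2 "cnjv z"] herm_commute[of b2 b1] by simp_all
  have "orthonormal_list (unit_frame b1 b2 z [])"
    unfolding orthonormal_list_def unit_frame_def
    by (auto simp: less_Suc_eq nth_Cons' herm_scale o o') (simp_all add: herm_self norm_sq_eq o)
  then obtain ts where "length ts = 5" "orthonormal_list (unit_frame b1 b2 z [] @ ts)"
    by (rule orthonormal_completion[where k = 5]) (simp add: unit_frame_def)
  then show thesis using that by (simp add: adapted_def unit_frame_def)
qed

lemma adapted_orthogonal:
  assumes "adapted b1 b2 z ts" "orthogonal_triple b1 b2 z" "t \<in> set ts"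
  shows "lin t z = 0 \<and> herm b1 t = 0 \<and> herm b2 t = 0"
proof -
  let ?N = "unit_frame b1 b2 z ts"
  obtain i where i: "i < 5" "t = ts ! i" using assms by (auto simp: in_set_conv_nth adapted_def)
  have t: "?N ! (3 + i) = t" using i by (simp add: unit_frame_def)
  have l: "length ?N = 8" using assms by (simp add: unit_frame_def adapted_def)
  have h: "herm (?N ! k) t = 0" if "k < 3" for k
  proof -
    have "k < length ?N" "3 + i < length ?N" "k \<noteq> 3 + i" using that i l by auto
    then have "herm (?N ! k) (?N ! (3 + i)) = 0"
      using assms(1) unfolding adapted_def orthonormal_list_def by simp
    then show ?thesis by (simp only: t)
  qed
  have "z \<noteq> 0" "b1 \<noteq> 0" "b2 \<noteq> 0" using assms(2) by (auto simp: orthogonal_triple_def)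
  then show ?thesis
    using h[of 0] h[of 1] h[of 2] by (simp add: unit_frame_def herm_scale_left herm_cnjv_left)
qed

text \<open>
  The determinant of the unitary frame, characterised through the volume form.
\<close>
definition frame_phase :: "complex^8 \<Rightarrow> complex^8 \<Rightarrow> complex^8 \<Rightarrow> (complex^8) list \<Rightarrow> complex \<Rightarrow> bool" where
  "frame_phase b1 b2 z ts \<delta> \<longleftrightarrow> \<delta> * cnj \<delta> = 1 \<and> (\<forall>v. dform (map lin (unit_frame b1 b2 z ts)) v = \<delta> * Omega0 v)"

lemma ex_frame_phase:
  assumes "adapted b1 b2 z ts"
  obtains \<delta> where "frame_phase b1 b2 z ts \<delta>"
proof -
  have l: "length (unit_frame b1 b2 z ts) = 8" using assms by (simp add: unit_frame_def adapted_def)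
  obtain ix :: "8 \<Rightarrow> nat" where ix: "bij_betw ix UNIV {..<8}" "\<And>a. coordinate_list ! ix a = a"
    using ex_coordinate_indexing by blast
  show thesis
    by (rule that[of "det (\<chi> a. unit_frame b1 b2 z ts ! ix a)"])
       (use orthonormal_list_det[of "unit_frame b1 b2 z ts" ix] dform_lin_eq_Omega0[OF l ix] assms ix l
         in \<open>simp add: frame_phase_def adapted_def\<close>)
qed

lemma frame_phase_dual:
  assumes "orthogonal_triple b1 b2 z" "length ts = 5" "frame_phase b1 b2 z ts \<delta>"
  shows "dform (map lin (dual_frame b1 b2 z ts)) v =
    \<delta> / (of_real (norm z) * of_real (norm b1) * of_real (norm b2)) * Omega0 v"
proof -
  let ?cs = "[1 / of_real (norm z), 1 / of_real (norm b2), 1 / of_real (norm b1)] @ replicate 5 (1::complex)"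
  have "map2 (*s) (replicate 5 1) ts = ts"
    by (rule nth_equalityI) (auto simp: assms(2))
  then have "dual_frame b1 b2 z ts = map2 (*s) ?cs (unit_frame b1 b2 z ts)"
    by (simp add: dual_frame_def unit_frame_def norm_sq_eq vector_smult_assoc)
  moreover have "length ?cs = length (unit_frame b1 b2 z ts)" using assms(2) by (simp add: unit_frame_def)
  ultimately have "dform (map lin (dual_frame b1 b2 z ts)) v = prod_list ?cs * dform (map lin (unit_frame b1 b2 z ts)) v"
    by (simp only: dform_lin_scale_list)
  then show ?thesis using assms(3) by (simp add: frame_phase_def)
qed

lemma norm_vector_scale: "norm (c *s a) = cmod c * norm (a :: complex^'n)"
  unfolding norm_vec_def by (simp add: norm_mult L2_set_right_distrib)

text \<open>
  Moving along the complex line of \<open>z\<close> multiplies the triple by phases, so the same five covectors stay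
  adapted. This lets the forms at \<open>z\<close> and at \<open>c z\<close> be compared.
\<close>
lemma adapted_scale:
  assumes "adapted b1 b2 z ts" "c \<noteq> 0" "frame_phase b1 b2 z ts \<delta>"
  shows "adapted (c *s b1) (c *s b2) (c *s z) ts"
    "frame_phase (c *s b1) (c *s b2) (c *s z) ts (cnj c * c * c / of_real (cmod c) ^ 3 * \<delta>)"
proof -
  let ?r = "complex_of_real (cmod c)"
  have r: "?r \<noteq> 0" "c * cnj c = ?r * ?r"
    using assms(2) complex_norm_square[of c] by (simp_all add: power2_eq_square)
  have norm: "complex_of_real (norm (c *s a)) = ?r * of_real (norm a)" for a :: "complex^8"
    by (simp add: norm_vector_scale)
  let ?ps = "[cnj c / ?r, c / ?r, c / ?r] @ replicate 5 1"
  have l: "length ts = 5" using assms by (simp add: adapted_def)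
  have "map2 (*s) (replicate 5 1) ts = ts" by (rule nth_equalityI) (auto simp: l)
  then have eq: "unit_frame (c *s b1) (c *s b2) (c *s z) ts = map2 (*s) ?ps (unit_frame b1 b2 z ts)"
    by (simp add: unit_frame_def norm cnjv_scale vector_smult_assoc)
  have len: "length ?ps = length (unit_frame b1 b2 z ts)" by (simp add: unit_frame_def l)
  have "cnj p * p = 1" if "p \<in> set ?ps" for p
    using that r by (auto simp: mult.commute)
  then show "adapted (c *s b1) (c *s b2) (c *s z) ts"
    using orthonormal_list_phases[OF _ len] assms(1) unfolding adapted_def eq by blast
  have "prod_list ?ps = cnj c * c * c / ?r ^ 3" by (simp add: power3_eq_cube mult.assoc)
  moreover have "(cnj c * c * c / ?r ^ 3 * \<delta>) * cnj (cnj c * c * c / ?r ^ 3 * \<delta>) = (c * cnj c) ^ 3 / ?r ^ 6 * (\<delta> * cnj \<delta>)"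
    by (simp add: eval_nat_numeral mult_ac)
  moreover have "(c * cnj c) ^ 3 / ?r ^ 6 = 1" unfolding r(2) using r(1) by (simp add: eval_nat_numeral)
  ultimately show "frame_phase (c *s b1) (c *s b2) (c *s z) ts (cnj c * c * c / ?r ^ 3 * \<delta>)"
    using assms(3) unfolding frame_phase_def eq dform_lin_scale_list[OF len] by (simp add: mult.assoc)
qed

text \<open>
  The power makes the form invariant: along \<open>z \<mapsto> c z\<close> and \<open>v \<mapsto> c v\<close>, the form \<open>Omega_of\<close> is multiplied by
  \<open>|c|\<^sup>8\<close>.
\<close>
definition Omega_hat :: "complex^8 \<Rightarrow> complex^8 \<Rightarrow> complex^8 \<Rightarrow> (complex^8) form" where
  "Omega_hat b1 b2 z v = Omega_of b1 b2 z v / norm_sq z ^ 4"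

text \<open>
  Minus the twisted 2-form, made blind to \<open>z\<close> by subtracting the term of \<open>cnjv z\<close>, and invariant by the last
  division.
\<close>
definition omega_hat :: "complex^8 \<Rightarrow> complex^8 \<Rightarrow> complex^8 \<Rightarrow> (complex^8) form" where
  "omega_hat b1 b2 z v = (omega0 v - \<i> / (2 * norm_sq z) * pair_form (cnjv z) v
     - \<i> / norm_sq b1 * pair_form b1 v - \<i> / norm_sq b2 * pair_form b2 v) / norm_sq z"

text \<open>
  The coframe for which the two forms are its top product and its fundamental form. The phase is put into the
  first member; there it does not affect the fundamental form.
\<close>
definition coframe :: "complex \<Rightarrow> complex^8 \<Rightarrow> complex^8 \<Rightarrow> complex^8 \<Rightarrow> (complex^8) list \<Rightarrow> (complex^8 \<Rightarrow> complex) list" where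
  "coframe \<delta> b1 b2 z ts =
     [\<lambda>u. 1 / (\<delta> * of_real (norm b1) * of_real (norm z)) * cnj (lin b1 u),
      \<lambda>u. 1 / (of_real (norm b2) * of_real (norm z)) * cnj (lin b2 u)] @
     map (\<lambda>t u. 1 / of_real (norm z) * lin t u) ts"

text \<open>
  By \<open>Omega_of_eq\<close>; it only remains to distribute the scalars over the seven factors.
\<close>
lemma Omega_hat_eq:
  assumes tri: "orthogonal_triple b1 b2 z" and ad: "adapted b1 b2 z ts" and \<delta>: "frame_phase b1 b2 z ts \<delta>"
  shows "Omega_hat b1 b2 z v = dform (coframe \<delta> b1 b2 z ts) v"
proof -
  let ?z = "complex_of_real (norm z)" and ?b1 = "complex_of_real (norm b1)" and ?b2 = "complex_of_real (norm b2)"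
  have l: "length ts = 5" using ad by (simp add: adapted_def)
  have nz: "?z \<noteq> 0" "?b1 \<noteq> 0" "?b2 \<noteq> 0" "\<delta> \<noteq> 0"
    using tri \<delta> by (auto simp: orthogonal_triple_def frame_phase_def)
  have \<kappa>: "\<delta> / (?z * ?b1 * ?b2) \<noteq> 0" using nz by simp
  \<comment> \<open>The factors by which the coframe differs from the unnormalised list in Omega_of_eq.\<close>
  let ?cs = "[1 / (\<delta> * ?b1 * ?z), 1 / (?b2 * ?z)] @ replicate 5 (1 / ?z)"
  let ?fs = "[cnjf (lin b1), cnjf (lin b2)] @ map lin ts"
  have "map2 (\<lambda>c f u. c * f u) (replicate 5 (1 / ?z)) (map lin ts) = map (\<lambda>t u. 1 / ?z * lin t u) ts"
    by (rule nth_equalityI) (auto simp: l)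
  then have "coframe \<delta> b1 b2 z ts = map2 (\<lambda>c f u. c * f u) ?cs ?fs"
    by (simp add: coframe_def)
  moreover have "length ?cs = length ?fs" by (simp add: l)
  ultimately have A: "dform (coframe \<delta> b1 b2 z ts) v = prod_list ?cs * dform ?fs v"
    by (simp only: dform_scale_list)
  have B: "Omega_of b1 b2 z v = 1 / (norm_sq b1 * norm_sq b2 * (\<delta> / (?z * ?b1 * ?b2))) * dform ?fs v"
    by (rule Omega_of_eq[OF tri l adapted_orthogonal[OF ad tri] frame_phase_dual[OF tri l \<delta>] \<kappa>])
  have C: "1 / (norm_sq b1 * norm_sq b2 * (\<delta> / (?z * ?b1 * ?b2))) / norm_sq z ^ 4 = prod_list ?cs"
    using nz by (simp add: norm_sq_eq field_simps eval_nat_numeral)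
  show ?thesis by (simp only: Omega_hat_def A B C[symmetric] times_divide_eq_left)
qed

text \<open>
  By Parseval's identity the standard 2-form is the sum over the unitary frame. The term of \<open>z\<close> drops out, and
  those of \<open>b1\<close> and \<open>b2\<close> change sign.
\<close>
lemma omega_hat_eq:
  assumes tri: "orthogonal_triple b1 b2 z" and ad: "adapted b1 b2 z ts"
  shows "omega_hat b1 b2 z v =
    \<i> / 2 * ((\<Sum>t\<leftarrow>ts. pair_form t v) - pair_form b1 v / norm_sq b1 - pair_form b2 v / norm_sq b2) / norm_sq z"
proof -
  let ?N = "unit_frame b1 b2 z ts"
  have l: "length ?N = CARD(8)" using ad by (simp add: adapted_def unit_frame_def)
  have o: "orthonormal_list ?N" using ad by (simp add: adapted_def)
  have nz: "norm_sq z \<noteq> 0" "norm_sq b1 \<noteq> 0" "norm_sq b2 \<noteq> 0"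
    using tri by (auto simp: orthogonal_triple_def norm_sq_nonzero)
  have "omega0 v = \<i> / 2 * ((\<Sum>j\<in>UNIV. v 0 $ j * cnj (v 1 $ j)) - (\<Sum>j\<in>UNIV. v 1 $ j * cnj (v 0 $ j)))"
    by (simp add: omega0_eq sum_subtractf)
  also have "\<dots> = \<i> / 2 * (\<Sum>r\<leftarrow>?N. pair_form r v)"
    unfolding parseval[OF o l, symmetric] pair_form_def by (simp add: sum_list_subtractf)
  also have "(\<Sum>r\<leftarrow>?N. pair_form r v) = pair_form (cnjv z) v / norm_sq z + pair_form b2 v / norm_sq b2
      + pair_form b1 v / norm_sq b1 + (\<Sum>t\<leftarrow>ts. pair_form t v)"
    by (simp add: unit_frame_def pair_form_scale norm_sq_eq)
  finally show ?thesis unfolding omega_hat_def using nz by (simp add: field_simps)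
qed

text \<open>
  The negative terms of \<open>b1\<close> and \<open>b2\<close> are absorbed by conjugating these two covectors.
\<close>
lemma omega_hat_eq_coframe:
  assumes tri: "orthogonal_triple b1 b2 z" and ad: "adapted b1 b2 z ts" and \<delta>: "\<delta> * cnj \<delta> = 1"
  shows "omega_hat b1 b2 z v =
    \<i> / 2 * (\<Sum>f\<leftarrow>coframe \<delta> b1 b2 z ts. f (v 0) * cnj (f (v 1)) - f (v 1) * cnj (f (v 0)))"
proof -
  have t: "(\<lambda>t. 1 / of_real (norm z) * lin t (v 0) * cnj (1 / of_real (norm z) * lin t (v 1))
      - 1 / of_real (norm z) * lin t (v 1) * cnj (1 / of_real (norm z) * lin t (v 0)))
    = (\<lambda>t. (1 / norm_sq z) * pair_form t v)"
    by (simp add: fun_eq_iff pair_form_def norm_sq_eq diff_divide_distrib)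
  have "\<delta> \<noteq> 0" using \<delta> by auto
  then have d: "1 / (\<delta> * x * y) * p * cnj (1 / (\<delta> * x * y) * q) = p * cnj q / (x * cnj x * (y * cnj y))" for p q x y
    using \<delta> by (simp add: field_simps)
  have S: "(\<Sum>f\<leftarrow>coframe \<delta> b1 b2 z ts. f (v 0) * cnj (f (v 1)) - f (v 1) * cnj (f (v 0))) =
    - pair_form b1 v / (norm_sq b1 * norm_sq z) - pair_form b2 v / (norm_sq b2 * norm_sq z)
    + (1 / norm_sq z) * (\<Sum>t\<leftarrow>ts. pair_form t v)"
    unfolding coframe_def map_append list.map map_map o_def t sum_list_append sum_list.Cons sum_list.Nil d
    unfolding sum_list_const_mult
    by (simp add: pair_form_def norm_sq_eq diff_divide_distrib mult_ac add_ac)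
  show ?thesis
    unfolding omega_hat_eq[OF tri ad] S by (simp add: diff_divide_distrib add_divide_distrib algebra_simps)
qed

lemma orthogonal_triple_scale:
  "orthogonal_triple b1 b2 z \<Longrightarrow> c \<noteq> 0 \<Longrightarrow> orthogonal_triple (c *s b1) (c *s b2) (c *s z)"
  by (simp add: orthogonal_triple_def lin_scale lin_scale_left herm_scale)

lemma omega_hat_basic:
  assumes tri: "orthogonal_triple b1 b2 z" and c: "c \<noteq> 0"
  shows "omega_hat (c *s b1) (c *s b2) (c *s z) (\<lambda>i. c *s v i + h i *s z) = omega_hat b1 b2 z v"
proof -
  obtain ts where ad: "adapted b1 b2 z ts" by (rule ex_adapted[OF tri])
  obtain \<delta> where \<delta>: "frame_phase b1 b2 z ts \<delta>" by (rule ex_frame_phase[OF ad])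
  let ?v = "\<lambda>i. c *s v i + h i *s z"
  have "(\<Sum>t\<leftarrow>ts. pair_form t ?v) = (\<Sum>t\<leftarrow>ts. c * cnj c * pair_form t v)"
    using adapted_orthogonal[OF ad tri]
    by (intro arg_cong[of _ _ sum_list] map_cong refl pair_form_args) blast
  also have "\<dots> = c * cnj c * (\<Sum>t\<leftarrow>ts. pair_form t v)" by (rule sum_list_const_mult)
  finally have t: "(\<Sum>t\<leftarrow>ts. pair_form t ?v) = c * cnj c * (\<Sum>t\<leftarrow>ts. pair_form t v)" .
  have b: "pair_form b1 ?v = c * cnj c * pair_form b1 v" "pair_form b2 ?v = c * cnj c * pair_form b2 v"
    using tri by (auto simp: orthogonal_triple_def pair_form_args)
  have cc: "c * cnj c \<noteq> 0" using c by simp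
  define q where "q = c * cnj c"
  have q: "q \<noteq> 0" using cc by (simp add: q_def)
  show ?thesis
    unfolding omega_hat_eq[OF orthogonal_triple_scale[OF tri c] adapted_scale(1)[OF ad c \<delta>]] omega_hat_eq[OF tri ad]
      pair_form_scale norm_sq_scale t b q_def[symmetric]
    using q tri by (simp add: orthogonal_triple_def norm_sq_nonzero field_simps)
qed

text \<open>
  With the same five covectors at both points, each member of the coframe is multiplied by a phase, and the
  seven phases multiply to \<open>1\<close>.
\<close>
lemma Omega_hat_basic:
  assumes tri: "orthogonal_triple b1 b2 z" and c: "c \<noteq> 0"
  shows "Omega_hat (c *s b1) (c *s b2) (c *s z) (\<lambda>i. c *s v i + h i *s z) = Omega_hat b1 b2 z v"
proof -
  obtain ts where ad: "adapted b1 b2 z ts" by (rule ex_adapted[OF tri])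
  obtain \<delta> where \<delta>: "frame_phase b1 b2 z ts \<delta>" by (rule ex_frame_phase[OF ad])
  let ?v = "\<lambda>i. c *s v i + h i *s z" and ?r = "complex_of_real (cmod c)"
  let ?\<delta> = "cnj c * c * c / ?r ^ 3 * \<delta>"
  have r: "?r \<noteq> 0" "c * cnj c = ?r * ?r"
    using c complex_norm_square[of c] by (simp_all add: power2_eq_square)
  have norm: "complex_of_real (norm (c *s a)) = ?r * of_real (norm a)" for a :: "complex^8"
    by (simp add: norm_vector_scale)
  have l: "length ts = 5" using ad by (simp add: adapted_def)
  let ?ps = "[(cnj c * cnj c) / (?r * ?r) * (?r ^ 3 / (cnj c * c * c)), (cnj c * cnj c) / (?r * ?r)] @ replicate 5 (c / ?r)"
  let ?F = "coframe \<delta> b1 b2 z ts"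
  have "list_all2 (\<lambda>f g. \<forall>i. f (?v i) = g (v i)) (coframe ?\<delta> (c *s b1) (c *s b2) (c *s z) ts) (map2 (\<lambda>p f u. p * f u) ?ps ?F)"
  proof -
    have "list_all2 (\<lambda>f g. \<forall>i. f (?v i) = g (v i)) (map (\<lambda>t u. 1 / of_real (norm (c *s z)) * lin t u) ts)
        (map2 (\<lambda>p f u. p * f u) (replicate 5 (c / ?r)) (map (\<lambda>t u. 1 / of_real (norm z) * lin t u) ts))"
      unfolding list_all2_conv_all_nth
      using adapted_orthogonal[OF ad tri] by (auto simp: l lin_add lin_scale norm)
    then show ?thesis
      using tri by (simp add: coframe_def lin_scale_left lin_add lin_scale norm orthogonal_triple_def mult_ac)
  qed
  then have "dform (coframe ?\<delta> (c *s b1) (c *s b2) (c *s z) ts) ?v = dform (map2 (\<lambda>p f u. p * f u) ?ps ?F) v"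
    by (rule dform_transfer)
  also have "\<dots> = prod_list ?ps * dform ?F v"
    by (rule dform_scale_list) (simp add: coframe_def l)
  also have "prod_list ?ps = (c * cnj c) ^ 3 / ?r ^ 6"
    using c r(1) by (simp add: field_simps eval_nat_numeral)
  also have "\<dots> = 1" unfolding r(2) using r(1) by (simp add: eval_nat_numeral)
  finally show ?thesis
    using Omega_hat_eq[OF orthogonal_triple_scale[OF tri c] adapted_scale[OF ad c \<delta>]] Omega_hat_eq[OF tri ad \<delta>]
    by simp
qed

text \<open>
  By Parseval's identity a vector is determined by its values on the unitary frame, of which only the first can be
  nonzero here.
\<close>
lemma coframe_kernel:
  assumes tri: "orthogonal_triple b1 b2 z" and ad: "adapted b1 b2 z ts" and \<delta>: "\<delta> \<noteq> 0"
    and u: "\<And>f. f \<in> set (coframe \<delta> b1 b2 z ts) \<Longrightarrow> f u = 0"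
  shows "u = (lin (cnjv z) u / norm_sq z) *s z"
proof -
  have nz: "norm z \<noteq> 0" "norm b1 \<noteq> 0" "norm b2 \<noteq> 0" using tri by (auto simp: orthogonal_triple_def)
  have t: "lin t u = 0" if "t \<in> set ts" for t
    using u[of "\<lambda>u. 1 / of_real (norm z) * lin t u"] that nz by (auto simp: coframe_def)
  have b: "lin b1 u = 0" "lin b2 u = 0"
    using u[of "\<lambda>u. 1 / (\<delta> * of_real (norm b1) * of_real (norm z)) * cnj (lin b1 u)"]
      u[of "\<lambda>u. 1 / (of_real (norm b2) * of_real (norm z)) * cnj (lin b2 u)"] nz \<delta>
    by (auto simp: coframe_def)
  let ?N = "unit_frame b1 b2 z ts"
  have l: "length ?N = CARD(8)" using ad by (simp add: adapted_def unit_frame_def)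
  have o: "orthonormal_list ?N" using ad by (simp add: adapted_def)
  have "u $ j = lin (cnjv z) u / norm_sq z * z $ j" for j
  proof -
    have "u $ j = (\<Sum>i\<in>UNIV. u $ i * cnj (axis j 1 $ i))"
      by (subst sum.remove[of _ j]) (auto simp: axis_def intro!: sum.neutral)
    also have "\<dots> = (\<Sum>r\<leftarrow>?N. lin r u * cnj (lin r (axis j 1)))" by (rule parseval[OF o l, symmetric])
    also have "\<dots> = 1 / of_real (norm z) * lin (cnjv z) u * cnj (1 / of_real (norm z) * lin (cnjv z) (axis j 1))"
      using b t by (simp add: unit_frame_def lin_scale_left cong: map_cong)
    also have "lin (cnjv z) (axis j 1) = cnj (z $ j)"
      unfolding lin_def by (subst sum.remove[of _ j]) (auto simp: axis_def cnjv_def intro!: sum.neutral)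
    finally show ?thesis by (simp add: norm_sq_eq)
  qed
  then show ?thesis by (simp add: vec_eq_iff)
qed

section \<open>The structure on projective space\<close>

lemma rational_on_power: "f \<in> rational_on S \<Longrightarrow> (\<lambda>x. f x ^ n) \<in> rational_on S"
  by (induction n) (auto intro: rational_on.intros)

lemma rational_on_lin:
  assumes "\<And>j. (\<lambda>x. a x $ j) \<in> rational_on S"
  shows "(\<lambda>x. lin (a x) u) \<in> rational_on S"
  unfolding lin_def by (intro rational_on_intros assms)

lemma rational_on_herm:
  assumes "\<And>j. (\<lambda>x. a x $ j) \<in> rational_on S" "\<And>j. (\<lambda>x. b x $ j) \<in> rational_on S"
  shows "(\<lambda>x. herm (a x) (b x)) \<in> rational_on S"
  unfolding herm_def by (intro rational_on_intros assms)

lemma rational_on_norm_sq: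
  assumes "\<And>j. (\<lambda>x. a x $ j) \<in> rational_on S"
  shows "(\<lambda>x. norm_sq (a x)) \<in> rational_on S"
  unfolding herm_self[symmetric] by (intro rational_on_herm assms)

lemma rational_on_cnjv:
  assumes "\<And>j. (\<lambda>x. a x $ j) \<in> rational_on S"
  shows "(\<lambda>x. cnjv (a x) $ j) \<in> rational_on S"
  by (simp add: cnjv_def rational_on_cnj assms)

lemma rational_on_scale:
  assumes "c \<in> rational_on S" "\<And>j. (\<lambda>x. a x $ j) \<in> rational_on S"
  shows "(\<lambda>x. (c x *s a x) $ j) \<in> rational_on S"
  by (simp add: rational_on.mult assms)

lemma rational_on_vdiff:
  assumes "\<And>j. (\<lambda>x. a x $ j) \<in> rational_on S" "\<And>j. (\<lambda>x. b x $ j) \<in> rational_on S"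
  shows "(\<lambda>x. (a x - b x) $ j) \<in> rational_on S"
  by (simp add: rational_on_diff assms)

lemma rational_on_dform:
  assumes "\<And>f u. f \<in> set fs \<Longrightarrow> (\<lambda>y. f y u) \<in> rational_on S"
  shows "(\<lambda>y. dform (map (\<lambda>f. f y) fs) v) \<in> rational_on S"
proof -
  have "(\<lambda>y. tensor (map (\<lambda>f. f y) fs) w) \<in> rational_on S" for w
    unfolding tensor_eq_prod length_map using assms by (intro rational_on_prod) simp
  then show ?thesis unfolding dform_def alternation_def length_map by (intro rational_on_intros)
qed

lemma linear_lin_compose: "linear g \<Longrightarrow> linear (\<lambda>u. lin a (g u))"
  using linear_compose[OF _ linear_lin] by (simp add: o_def)

lemma linear_cnj_compose: "linear f \<Longrightarrow> linear (\<lambda>u. cnj (f u))"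
  by (simp add: linear_iff)

lemma linear_coframe:
  assumes "f \<in> set (coframe \<delta> b1 b2 z ts)" "linear g"
  shows "linear (\<lambda>u. f (g u))"
proof -
  have "linear (\<lambda>u. c * lin a (g u))" "linear (\<lambda>u. c * cnj (lin a (g u)))" for c a
    by (intro linear_cmult_complex linear_cnj_compose linear_lin_compose assms(2))+
  then show ?thesis using assms(1) by (auto simp: coframe_def simp del: times_divide_eq_left)
qed

lemma alternating_fundamental_form:
  assumes "\<And>k. k < m \<Longrightarrow> linear (F k)"
  shows "alternating_form 2 (fundamental_form m F)"
  unfolding alternating_form_def fundamental_form_eq
proof (intro conjI allI impI)
  fix v :: "nat \<Rightarrow> 'a" and i :: nat assume "i < 2"
  then consider "i = 0" | "i = 1" by linarith
  then show "linear (\<lambda>x. \<i> / 2 * (\<Sum>k<m. F k ((v(i := x)) 0) * cnj (F k ((v(i := x)) 1)) - F k ((v(i := x)) 1) * cnj (F k ((v(i := x)) 0))))"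
  proof cases
    case 1
    have "linear (\<lambda>x. \<i> / 2 * (\<Sum>k<m. cnj (F k (v 1)) * F k x - F k (v 1) * cnj (F k x)))"
      by (intro linear_cmult_complex linear_sum_complex linear_compose_sub linear_cnj_compose assms) auto
    then show ?thesis using 1 by (simp add: mult.commute)
  next
    case 2
    have "linear (\<lambda>x. \<i> / 2 * (\<Sum>k<m. F k (v 0) * cnj (F k x) - cnj (F k (v 0)) * F k x))"
      by (intro linear_cmult_complex linear_sum_complex linear_compose_sub linear_cnj_compose assms) auto
    then show ?thesis using 2 by (simp add: mult.commute)
  qed
next
  fix v :: "nat \<Rightarrow> 'a" and i j :: nat
  assume "i < 2" "j < 2" "i \<noteq> j \<and> v i = v j"
  then have "v 0 = v 1" by (auto simp: less_2_cases_iff)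
  then show "\<i> / 2 * (\<Sum>k<m. F k (v 0) * cnj (F k (v 1)) - F k (v 1) * cnj (F k (v 0))) = 0" by simp
qed auto

lemma alternating_form_1: "linear f \<Longrightarrow> alternating_form 1 (\<lambda>v. f (v 0))"
  using alternating_dform[of "[f]"] by (simp add: dform_single)

text \<open>
  What is used of the Gram-Schmidt forms of two twist forms: orthogonality, homogeneity of degree one of the
  coefficients, and rationality, the last along any rational map because it is needed along the sections of charts.
\<close>
locale twisted_frame =
  fixes X :: "(complex^8) set set" and b1 b2 :: "complex^8 \<Rightarrow> complex^8"
  assumes X_subset: "X \<subseteq> CP" and open_cone: "open (cone_over X)"
    and triple: "z \<in> cone_over X \<Longrightarrow> orthogonal_triple (b1 z) (b2 z) z"
    and homogeneous: "z \<in> cone_over X \<Longrightarrow> c \<noteq> 0 \<Longrightarrow> b1 (c *s z) = c *s b1 z"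
      "z \<in> cone_over X \<Longrightarrow> c \<noteq> 0 \<Longrightarrow> b2 (c *s z) = c *s b2 z"
    and rational: "\<And>(S :: (complex^7) set) s i. (\<And>i. (\<lambda>x. s x $ i) \<in> rational_on S) \<Longrightarrow>
       (\<And>x. x \<in> S \<Longrightarrow> s x \<in> cone_over X) \<Longrightarrow> (\<lambda>x. b1 (s x) $ i) \<in> rational_on S"
      "\<And>(S :: (complex^7) set) s i. (\<And>i. (\<lambda>x. s x $ i) \<in> rational_on S) \<Longrightarrow>
       (\<And>x. x \<in> S \<Longrightarrow> s x \<in> cone_over X) \<Longrightarrow> (\<lambda>x. b2 (s x) $ i) \<in> rational_on S"
begin

definition Omega_cone :: "complex^8 \<Rightarrow> (complex^8) form" where "Omega_cone z = Omega_hat (b1 z) (b2 z) z"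
definition omega_cone :: "complex^8 \<Rightarrow> (complex^8) form" where "omega_cone z = omega_hat (b1 z) (b2 z) z"

lemma basic_Omega_cone: "cone_basic (cone_over X) Omega_cone"
  unfolding cone_basic_def Omega_cone_def by (simp add: homogeneous Omega_hat_basic triple)

lemma basic_omega_cone: "cone_basic (cone_over X) omega_cone"
  unfolding cone_basic_def omega_cone_def by (simp add: homogeneous omega_hat_basic triple)

lemma nonzero:
  assumes "z \<in> cone_over X"
  shows "norm_sq z \<noteq> 0" "norm_sq (b1 z) \<noteq> 0" "norm_sq (b2 z) \<noteq> 0"
  using triple[OF assms] by (auto simp: orthogonal_triple_def norm_sq_nonzero)

context
  fixes j :: 8 and e :: "7 \<Rightarrow> 8"
  assumes num: "numbering j e"
begin

abbreviation "s \<equiv> affine_section j e"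
abbreviation "L \<equiv> affine_incl j e"
abbreviation "S0 \<equiv> {x. s x \<in> cone_over X}"

lemma open_S0: "open S0" by (rule open_affine_section_vimage[OF open_cone])

lemma rational_s: "(\<lambda>x. s x $ i) \<in> rational_on T"
  by (rule rational_on_affine_section)
text \<open>
  The adapted coframe at the point of the section, restricted to the tangent space of the section. It stays
  injective, because this space meets the complex line of the point only in \<open>0\<close>.
\<close>
lemma ex_chart_coframe:
  assumes x: "x \<in> S0"
  obtains F :: "nat \<Rightarrow> complex^7 \<Rightarrow> complex" where
    "\<forall>k<7. linear (F k)" "\<forall>u. (\<forall>k<7. F k u = 0) \<longrightarrow> u = 0"
    "(\<lambda>v. Omega_cone (s x) (\<lambda>i. L (v i))) = dform (map F [0..<7])"
    "(\<lambda>v. omega_cone (s x) (\<lambda>i. L (v i))) = fundamental_form 7 F"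
proof -
  let ?z = "s x"
  have tri: "orthogonal_triple (b1 ?z) (b2 ?z) ?z" using triple x by simp
  obtain ts where ad: "adapted (b1 ?z) (b2 ?z) ?z ts" by (rule ex_adapted[OF tri])
  obtain \<delta> where \<delta>: "frame_phase (b1 ?z) (b2 ?z) ?z ts \<delta>" by (rule ex_frame_phase[OF ad])
  then have \<delta>1: "\<delta> * cnj \<delta> = 1" by (simp add: frame_phase_def)
  define Fs where "Fs = coframe \<delta> (b1 ?z) (b2 ?z) ?z ts"
  have len: "length Fs = 7" using ad by (simp add: Fs_def coframe_def adapted_def)
  define F where "F k = (\<lambda>u. (Fs ! k) (L u))" for k
  have F: "map F [0..<7] = map (\<lambda>f u. f (L u)) Fs"
    by (rule nth_equalityI) (simp_all add: F_def len)
  have lin: "\<forall>k<7. linear (F k)"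
    using linear_coframe[OF _ linear_affine_incl] nth_mem len unfolding F_def Fs_def by metis
  have "u = 0" if u: "\<forall>k<7. F k u = 0" for u
  proof -
    have "f (L u) = 0" if "f \<in> set Fs" for f
      using that u len by (auto simp: in_set_conv_nth F_def)
    then have "L u = (lin (cnjv ?z) (L u) / norm_sq ?z) *s ?z"
      using coframe_kernel[OF tri ad, of \<delta> "L u"] \<delta>1 by (force simp: Fs_def)
    then obtain c where eq: "L u = c *s ?z" by blast
    \<comment> \<open>The \<open>j\<close>-th coordinate is 1 on the section and 0 on its tangent vectors.\<close>
    have "L u $ j = 0" by (simp add: affine_incl_def)
    then have "c = 0" using arg_cong[OF eq, of "\<lambda>w. w $ j"] affine_section_nonzero(1)[of j e x] by simp
    then have "L u = 0" using eq by simp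
    then have "L u $ e k = 0" for k by simp
    then show "u = 0" using numbering_inv[OF num] by (simp add: vec_eq_iff affine_incl_def)
  qed
  moreover have "(\<lambda>v. Omega_cone ?z (\<lambda>i. L (v i))) = dform (map F [0..<7])"
    unfolding Omega_cone_def Omega_hat_eq[OF tri ad \<delta>] F Fs_def by (simp add: dform_compose)
  moreover have "(\<lambda>v. omega_cone ?z (\<lambda>i. L (v i))) = fundamental_form 7 F"
    unfolding omega_cone_def omega_hat_eq_coframe[OF tri ad \<delta>1] fundamental_form_eq Fs_def[symmetric]
    by (simp add: sum_list_sum_nth len atLeast0LessThan F_def fundamental_form_eq fun_eq_iff)
  ultimately show thesis using lin that by blast
qed
text \<open>
  An adapted frame at one point serves for its neighbours after projection. The projected covectors are no
  longer orthonormal, but \<open>Omega_of_eq\<close> asks only for orthogonality to the triple and for a nonzero determinant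
  \<open>\<kappa>\<close>, which is an open condition.
\<close>
lemma local_decomposition:
  assumes x0: "x0 \<in> S0"
  obtains N \<theta>s where "open N" "x0 \<in> N" "N \<subseteq> S0" "length \<theta>s = 7"
    "\<forall>\<theta>\<in>set \<theta>s. smooth_form_on 1 N \<theta>"
    "\<forall>y\<in>N. (\<lambda>v. Omega_cone (s y) (\<lambda>i. L (v i))) = wedge_list (map (\<lambda>\<theta>. \<theta> y) \<theta>s)"
    "\<forall>v. smooth_on N (\<lambda>y. Omega_cone (s y) (\<lambda>i. L (v i)))"
proof -
  have tri: "orthogonal_triple (b1 (s y)) (b2 (s y)) (s y)" if "y \<in> S0" for y using triple that by simp
  obtain ts where ad: "adapted (b1 (s x0)) (b2 (s x0)) (s x0) ts" by (rule ex_adapted[OF tri[OF x0]])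
  obtain \<delta> where \<delta>: "frame_phase (b1 (s x0)) (b2 (s x0)) (s x0) ts \<delta>" by (rule ex_frame_phase[OF ad])
  have l: "length ts = 5" using ad by (simp add: adapted_def)
  \<comment> \<open>The covectors are fixed; projecting them off the moving triple keeps them rational in \<open>y\<close>.\<close>
  define T where "T t y = t - (herm (cnjv (s y)) t / norm_sq (s y)) *s cnjv (s y)
    - (herm (b1 (s y)) t / norm_sq (b1 (s y))) *s b1 (s y) - (herm (b2 (s y)) t / norm_sq (b2 (s y))) *s b2 (s y)" for t y
  have T_orth: "lin (T t y) (s y) = 0 \<and> herm (b1 (s y)) (T t y) = 0 \<and> herm (b2 (s y)) (T t y) = 0"
    if "y \<in> S0" for t y
  proof -
    have nz: "norm_sq (s y) \<noteq> 0" "norm_sq (b1 (s y)) \<noteq> 0" "norm_sq (b2 (s y)) \<noteq> 0" using nonzero that by auto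
    have o: "lin (b1 (s y)) (s y) = 0" "lin (b2 (s y)) (s y) = 0" "herm (b1 (s y)) (b2 (s y)) = 0"
      using tri[OF that] by (auto simp: orthogonal_triple_def)
    then have "herm (b2 (s y)) (b1 (s y)) = 0" using herm_commute[of "b2 (s y)" "b1 (s y)"] by simp
    moreover have "herm (b1 (s y)) (cnjv (s y)) = 0" "herm (b2 (s y)) (cnjv (s y)) = 0"
      using o herm_commute[of _ "cnjv (s y)"] by (simp_all add: herm_cnjv_left)
    ultimately show ?thesis using nz o
      by (simp add: T_def lin_diff_left lin_scale_left lin_cnjv_self herm_diff_right herm_scale_right herm_self herm_cnjv_left)
  qed
  have T_x0: "T t x0 = t" if "t \<in> set ts" for t
    using adapted_orthogonal[OF ad tri[OF x0] that] by (simp add: T_def herm_cnjv_left)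
  let ?tsy = "\<lambda>y. map (\<lambda>t. T t y) ts"
  obtain ix :: "8 \<Rightarrow> nat" where ix: "bij_betw ix UNIV {..<8}" "\<And>a. coordinate_list ! ix a = a"
    using ex_coordinate_indexing by blast
  let ?R = "\<lambda>y. dual_frame (b1 (s y)) (b2 (s y)) (s y) (?tsy y)"
  define \<kappa> where "\<kappa> y = det (\<chi> a. ?R y ! ix a)" for y
  have lR: "length (?R y) = 8" for y by (simp add: dual_frame_def l)
  have \<kappa>: "dform (map lin (?R y)) v = \<kappa> y * Omega0 v" for y v
    unfolding \<kappa>_def by (rule dform_lin_eq_Omega0[OF lR ix])
  have "\<kappa> x0 \<noteq> 0"
  proof
    assume "\<kappa> x0 = 0"
    have "map (\<lambda>t. T t x0) ts = ts" by (rule map_idI) (rule T_x0)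
    then have "\<delta> / (of_real (norm (s x0)) * of_real (norm (b1 (s x0))) * of_real (norm (b2 (s x0)))) * Omega0 v = 0" for v
      using frame_phase_dual[OF tri[OF x0] l \<delta>] \<kappa>[of x0] \<open>\<kappa> x0 = 0\<close> by simp
    moreover have "\<delta> \<noteq> 0" using \<delta> by (auto simp: frame_phase_def)
    ultimately have "Omega0 v = 0" for v using tri[OF x0] by (force simp: orthogonal_triple_def)
    then show False using Omega0_nonzero by simp
  qed
  note b_rat = rational(1)[OF rational_s] rational(2)[OF rational_s]
  have T_rat: "(\<lambda>y. T t y $ i) \<in> rational_on N" if "N \<subseteq> S0" for t N i
    unfolding T_def using that nonzero
    by (intro rational_on_vdiff rational_on_scale rational_on_divide rational_on_herm rational_on_cnjv rational_on_norm_sq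
         rational_s b_rat rational_on.const) auto
  have R_rat: "(\<lambda>y. (?R y ! ix a) $ i) \<in> rational_on S0" for a i
  proof -
    let ?DF = "[\<lambda>y. (1 / norm_sq (s y)) *s cnjv (s y), \<lambda>y. (1 / norm_sq (b2 (s y))) *s b2 (s y),
      \<lambda>y. (1 / norm_sq (b1 (s y))) *s b1 (s y)] @ map T ts"
    have R: "?R y = map (\<lambda>f. f y) ?DF" for y by (simp add: dual_frame_def)
    have f: "\<forall>f\<in>set ?DF. (\<lambda>y. f y $ i) \<in> rational_on S0"
      using T_rat[OF order_refl] nonzero
      by (auto intro!: rational_on_scale[of _ _ _ i, simplified] rational_on.mult rational_on_divide rational_on_cnjv rational_on_norm_sq
         rational_s b_rat rational_on.const)
    have "ix a < 8" using ix(1) by (auto simp: bij_betw_def)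
    then have len: "ix a < length ?DF" by (simp add: l)
    have eq: "(\<lambda>y. (?R y ! ix a) $ i) = (\<lambda>y. (?DF ! ix a) y $ i)"
      unfolding R nth_map[OF len] ..
    show ?thesis unfolding eq by (rule bspec[OF f nth_mem[OF len]])
  qed
  have \<kappa>_rat: "\<kappa> \<in> rational_on S0"
    unfolding \<kappa>_def[abs_def] by (rule rational_on_det) (simp add: R_rat)
  define N where "N = {y \<in> S0. \<kappa> y \<noteq> 0}"
  have N: "open N" "x0 \<in> N" "N \<subseteq> S0"
    unfolding N_def using open_rational_nonzero[OF open_S0 \<kappa>_rat] x0 \<open>\<kappa> x0 \<noteq> 0\<close> by auto
  define co where "co y = 1 / (norm_sq (b1 (s y)) * norm_sq (b2 (s y)) * \<kappa> y) / norm_sq (s y) ^ 4" for y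
  have co_rat: "co \<in> rational_on N"
  proof -
    have "(\<lambda>y. norm_sq (s y) ^ 4) \<in> rational_on N"
      by (intro rational_on_power rational_on_norm_sq rational_s)
    then show ?thesis
      unfolding co_def[abs_def] using N nonzero
      by (intro rational_on_divide rational_on.mult rational_on_norm_sq b_rat rational_on.const
          rational_on_subset[OF \<kappa>_rat]) (auto simp: N_def)
  qed
  define gs where "gs = [\<lambda>y u. co y * cnj (lin (b1 (s y)) (L u)), \<lambda>y u. cnj (lin (b2 (s y)) (L u))] @
    map (\<lambda>t y u. lin (T t y) (L u)) ts"
  have g_rat: "(\<lambda>y. g y u) \<in> rational_on N" if "g \<in> set gs" for g u
    using that N unfolding gs_def
    by (auto intro!: rational_on.mult co_rat rational_on_cnj rational_on_lin b_rat T_rat)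
  have g_lin: "linear (g y)" if "g \<in> set gs" for g y
    using that unfolding gs_def
    by (auto intro!: linear_cmult_complex linear_lin_compose linear_cnj_compose linear_affine_incl)
  have Omega_cone: "Omega_cone (s y) (\<lambda>i. L (v i)) = dform (map (\<lambda>g. g y) gs) v" if "y \<in> N" for y v
  proof -
    have y: "y \<in> S0" "\<kappa> y \<noteq> 0" using that by (auto simp: N_def)
    have "Omega_of (b1 (s y)) (b2 (s y)) (s y) (\<lambda>i. L (v i)) =
      1 / (norm_sq (b1 (s y)) * norm_sq (b2 (s y)) * \<kappa> y) *
      dform ([cnjf (lin (b1 (s y))), cnjf (lin (b2 (s y)))] @ map lin (?tsy y)) (\<lambda>i. L (v i))"
      by (rule Omega_of_eq[OF tri[OF y(1)] _ _ \<kappa> y(2)]) (use T_orth[OF y(1)] l in auto)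
    then have "Omega_cone (s y) (\<lambda>i. L (v i)) = co y *
      dform ([cnjf (lin (b1 (s y))), cnjf (lin (b2 (s y)))] @ map lin (?tsy y)) (\<lambda>i. L (v i))"
      by (simp add: Omega_cone_def Omega_hat_def co_def)
    also have "\<dots> = co y * dform ((\<lambda>u. cnj (lin (b1 (s y)) (L u))) # (\<lambda>u. cnj (lin (b2 (s y)) (L u))) #
        map (\<lambda>t u. lin (T t y) (L u)) ts) v"
      unfolding dform_compose by (simp add: o_def)
    also have "\<dots> = dform (map (\<lambda>g. g y) gs) v"
      unfolding dform_scale_head[symmetric] by (simp add: gs_def o_def)
    finally show ?thesis .
  qed
  let ?\<theta>s = "map (\<lambda>g y v. g y (v 0)) gs"
  show thesis
  proof (rule that[OF N])
    show "length ?\<theta>s = 7" by (simp add: gs_def l)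
    show "\<forall>\<theta>\<in>set ?\<theta>s. smooth_form_on 1 N \<theta>"
      unfolding smooth_form_on_def
      using alternating_form_1[OF g_lin] rational_on_smooth_on[OF N(1) g_rat] by auto
    show "\<forall>y\<in>N. (\<lambda>v. Omega_cone (s y) (\<lambda>i. L (v i))) = wedge_list (map (\<lambda>\<theta>. \<theta> y) ?\<theta>s)"
    proof
      fix y assume "y \<in> N"
      then have "(\<lambda>v. Omega_cone (s y) (\<lambda>i. L (v i))) = dform (map (\<lambda>g. g y) gs)" using Omega_cone by auto
      then show "(\<lambda>v. Omega_cone (s y) (\<lambda>i. L (v i))) = wedge_list (map (\<lambda>\<theta>. \<theta> y) ?\<theta>s)"
        unfolding wedge_list_eq_dform[symmetric] by (simp add: o_def)
    qed
    show "\<forall>v. smooth_on N (\<lambda>y. Omega_cone (s y) (\<lambda>i. L (v i)))"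
    proof
      fix v
      have "smooth_on N (\<lambda>y. dform (map (\<lambda>g. g y) gs) v)"
        by (rule rational_on_smooth_on[OF N(1) rational_on_dform]) (rule g_rat)
      then show "smooth_on N (\<lambda>y. Omega_cone (s y) (\<lambda>i. L (v i)))"
        by (rule smooth_on_cong[OF _ N(1)]) (simp add: Omega_cone)
    qed
  qed
qed

lemma smooth_Omega_cone: "smooth_form_on 7 S0 (\<lambda>x v. Omega_cone (s x) (\<lambda>i. L (v i)))"
  unfolding smooth_form_on_def
proof (intro conjI ballI allI)
  fix x assume x: "x \<in> S0"
  obtain F :: "nat \<Rightarrow> complex^7 \<Rightarrow> complex" where F: "\<forall>k<7. linear (F k)" "\<forall>u. (\<forall>k<7. F k u = 0) \<longrightarrow> u = 0"
    "(\<lambda>v. Omega_cone (s x) (\<lambda>i. L (v i))) = dform (map F [0..<7])"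
    "(\<lambda>v. omega_cone (s x) (\<lambda>i. L (v i))) = fundamental_form 7 F"
    by (rule ex_chart_coframe[OF x])
  show "alternating_form 7 (\<lambda>v. Omega_cone (s x) (\<lambda>i. L (v i)))"
  proof -
    have "linear f" if "f \<in> set (map F [0..<7])" for f using that F(1) by auto
    from alternating_dform[of "map F [0..<7]", OF this] show ?thesis unfolding F(3) by simp
  qed
next
  fix v
  show "smooth_on S0 (\<lambda>x. Omega_cone (s x) (\<lambda>i. L (v i)))"
  proof (rule smooth_on_local)
    fix x assume "x \<in> S0"
    from local_decomposition[OF this]
    show "\<exists>N. open N \<and> x \<in> N \<and> smooth_on N (\<lambda>x. Omega_cone (s x) (\<lambda>i. L (v i)))" by metis
  qed
qed

lemma smooth_omega_cone: "smooth_form_on 2 S0 (\<lambda>x v. omega_cone (s x) (\<lambda>i. L (v i)))"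
  unfolding smooth_form_on_def
proof (intro conjI ballI allI)
  fix x assume x: "x \<in> S0"
  obtain F :: "nat \<Rightarrow> complex^7 \<Rightarrow> complex" where F: "\<forall>k<7. linear (F k)" "\<forall>u. (\<forall>k<7. F k u = 0) \<longrightarrow> u = 0"
    "(\<lambda>v. Omega_cone (s x) (\<lambda>i. L (v i))) = dform (map F [0..<7])"
    "(\<lambda>v. omega_cone (s x) (\<lambda>i. L (v i))) = fundamental_form 7 F"
    by (rule ex_chart_coframe[OF x])
  show "alternating_form 2 (\<lambda>v. omega_cone (s x) (\<lambda>i. L (v i)))"
    unfolding F(4) using alternating_fundamental_form[of 7 F] F(1) by auto
next
  fix v
  show "smooth_on S0 (\<lambda>x. omega_cone (s x) (\<lambda>i. L (v i)))"
    unfolding omega_cone_def omega_hat_def pair_form_def using nonzero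
    by (intro rational_on_smooth_on[OF open_S0] rational_on_intros rational_on_lin rational_on_norm_sq rational_on_cnjv
        rational_s rational(1)[OF rational_s] rational(2)[OF rational_s]) auto
qed

end

text \<open>
  Everything has been reduced to a chart, where \<open>ex_chart_coframe\<close> gives the pointwise conditions and
  \<open>local_decomposition\<close> the smooth factors.
\<close>
lemma SU_structure_descended:
  "SU_structure 7 X (CP_atlas X :: ((complex^8) set, complex^7) chart set) (descended_form Omega_cone) (descended_form omega_cone)"
  unfolding SU_structure_def
proof (intro conjI)
  let ?A = "CP_atlas X :: ((complex^8) set, complex^7) chart set"
  show "smooth_atlas X ?A" by (rule smooth_atlas_CP[OF _ X_subset open_cone]) simp
  show "DIM(complex^7) = 2 * 7" by simp
  show "differential_form 7 ?A (descended_form Omega_cone)"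
    by (rule differential_form_descended[OF X_subset open_cone basic_Omega_cone smooth_Omega_cone])
  show "differential_form 2 ?A (descended_form omega_cone)"
    by (rule differential_form_descended[OF X_subset open_cone basic_omega_cone smooth_omega_cone])
  have chart: "locally_decomposable 7 (\<phi> ` U) (descended_form Omega_cone (U, \<phi>)) \<and>
    (\<forall>x\<in>\<phi> ` U.
        let \<Omega>x = descended_form Omega_cone (U, \<phi>) x; \<omega>x = descended_form omega_cone (U, \<phi>) x in
        (\<forall>v. \<omega>x v \<in> \<real>) \<and> nondegenerate \<omega>x \<and> \<Omega>x \<noteq> (\<lambda>v. 0) \<and> wedge 7 2 \<Omega>x \<omega>x = (\<lambda>v. 0) \<and>
        wedge 7 7 \<Omega>x (cnj_form \<Omega>x) = (\<lambda>v. SU_constant 7 * wedge_power 2 \<omega>x 7 v))"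
    if c: "(U, \<phi>) \<in> ?A" for U \<phi>
  proof -
    obtain j e where je: "numbering j e" "\<forall>z\<in>cone_over U. z $ j \<noteq> 0" "\<phi> = affine_coords j e"
      "\<And>\<Theta>. descended_form \<Theta> (U, \<phi>) = (\<lambda>x v. \<Theta> (affine_section j e x) (\<lambda>i. affine_incl j e (v i)))"
      "U \<subseteq> X" "U \<subseteq> CP" "open (cone_over U)" using CP_atlas_chart[OF c X_subset open_cone] by blast
    have im: "\<phi> ` U = {x. affine_section j e x \<in> cone_over U}" and op: "open (\<phi> ` U)"
      using CP_atlas_transition(1,2)[OF c c X_subset open_cone je(1-3)] by simp_all
    have sub: "\<phi> ` U \<subseteq> {x. affine_section j e x \<in> cone_over X}"
      unfolding im using je(5) by (auto simp: cone_over_def)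
    show ?thesis
    proof (intro conjI ballI)
      show "locally_decomposable 7 (\<phi> ` U) (descended_form Omega_cone (U, \<phi>))"
        unfolding locally_decomposable_def je(4)
      proof
        fix x assume x: "x \<in> \<phi> ` U"
        then have xS: "x \<in> {x. affine_section j e x \<in> cone_over X}" using sub by blast
        obtain N \<theta>s where N: "open N" "x \<in> N" "N \<subseteq> {x. affine_section j e x \<in> cone_over X}"
          "length \<theta>s = 7" "\<forall>\<theta>\<in>set \<theta>s. smooth_form_on 1 N \<theta>"
          "\<forall>y\<in>N. (\<lambda>v. Omega_cone (affine_section j e y) (\<lambda>i. affine_incl j e (v i))) = wedge_list (map (\<lambda>\<theta>. \<theta> y) \<theta>s)"
          "\<forall>v. smooth_on N (\<lambda>y. Omega_cone (affine_section j e y) (\<lambda>i. affine_incl j e (v i)))"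
          by (rule local_decomposition[OF je(1) xS])
        have "\<forall>\<theta>\<in>set \<theta>s. smooth_form_on 1 (N \<inter> \<phi> ` U) \<theta>"
          using N(5) by (auto simp: smooth_form_on_def intro: smooth_on_subset)
        then show "\<exists>N \<theta>s. open N \<and> x \<in> N \<and> N \<subseteq> \<phi> ` U \<and> length \<theta>s = 7 \<and> (\<forall>\<theta>\<in>set \<theta>s. smooth_form_on 1 N \<theta>) \<and>
          (\<forall>y\<in>N. (\<lambda>v. Omega_cone (affine_section j e y) (\<lambda>i. affine_incl j e (v i))) = wedge_list (map (\<lambda>\<theta>. \<theta> y) \<theta>s))"
          using N op x by (intro exI[of _ "N \<inter> \<phi> ` U"] exI[of _ \<theta>s]) auto
      qed
      fix x assume "x \<in> \<phi> ` U"
      then have xS: "x \<in> {x. affine_section j e x \<in> cone_over X}" using sub by blast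
      obtain F :: "nat \<Rightarrow> complex^7 \<Rightarrow> complex"
        where lin: "\<forall>k<7. linear (F k)" and inj: "\<forall>u. (\<forall>k<7. F k u = 0) \<longrightarrow> u = 0"
          and F: "(\<lambda>v. Omega_cone (affine_section j e x) (\<lambda>i. affine_incl j e (v i))) = dform (map F [0..<7])"
          "(\<lambda>v. omega_cone (affine_section j e x) (\<lambda>i. affine_incl j e (v i))) = fundamental_form 7 F"
        by (rule ex_chart_coframe[OF je(1) xS])
      have d: "DIM(complex^7) = 2 * 7" by simp
      show "let \<Omega>x = descended_form Omega_cone (U, \<phi>) x; \<omega>x = descended_form omega_cone (U, \<phi>) x in
        (\<forall>v. \<omega>x v \<in> \<real>) \<and> nondegenerate \<omega>x \<and> \<Omega>x \<noteq> (\<lambda>v. 0) \<and> wedge 7 2 \<Omega>x \<omega>x = (\<lambda>v. 0) \<and>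
        wedge 7 7 \<Omega>x (cnj_form \<Omega>x) = (\<lambda>v. SU_constant 7 * wedge_power 2 \<omega>x 7 v)"
        unfolding Let_def je(4) F
      proof (intro conjI)
        show "\<forall>v. fundamental_form 7 F v \<in> \<real>" by (simp add: fundamental_form_real)
        show "nondegenerate (fundamental_form 7 F)"
          by (rule nondegenerate_fundamental_form[OF _ _ d]) (use lin inj in blast)+
        show "dform (map F [0..<7]) \<noteq> (\<lambda>v. 0)"
          by (rule dform_coframe_nonzero[OF _ _ d]) (use lin inj in blast)+
        show "wedge 7 2 (dform (map F [0..<7])) (fundamental_form 7 F) = (\<lambda>v. 0)"
          by (rule ext) (rule wedge_coframe_fundamental)
        show "wedge 7 7 (dform (map F [0..<7])) (cnj_form (dform (map F [0..<7]))) =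
          (\<lambda>v. SU_constant 7 * wedge_power 2 (fundamental_form 7 F) 7 v)"
          by (rule ext) (rule wedge_coframe_cnj)
      qed
    qed
  qed
  show "\<forall>(U, \<phi>)\<in>?A. locally_decomposable 7 (\<phi> ` U) (descended_form Omega_cone (U, \<phi>))"
    using chart by blast
  show "\<forall>(U, \<phi>)\<in>?A. \<forall>x\<in>\<phi> ` U.
        let \<Omega>x = descended_form Omega_cone (U, \<phi>) x; \<omega>x = descended_form omega_cone (U, \<phi>) x in
        (\<forall>v. \<omega>x v \<in> \<real>) \<and> nondegenerate \<omega>x \<and> \<Omega>x \<noteq> (\<lambda>v. 0) \<and> wedge 7 2 \<Omega>x \<omega>x = (\<lambda>v. 0) \<and>
        wedge 7 7 \<Omega>x (cnj_form \<Omega>x) = (\<lambda>v. SU_constant 7 * wedge_power 2 \<omega>x 7 v)"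
    using chart by blast
qed

end

section \<open>Skew matrices and their kernels\<close>

lemma vector_matrix_mult_transpose: "z v* A = transpose A *v (z :: complex^'n)"
  by (simp add: transpose_matrix_vector)

lemma vector_matrix_linear:
  fixes A B :: "complex^'n^'m"
  shows "(x + y) v* A = x v* A + y v* A" "(c *s x) v* A = c *s (x v* A)"
    "x v* (A - B) = x v* A - x v* B"
    "x v* (\<chi> i j. c * A $ i $ j) = c *s (x v* A)"
  by (simp_all add: vec_eq_iff vector_matrix_mult_def algebra_simps sum.distrib sum_subtractf sum_distrib_left)

lemma det_zero_iff_left_kernel:
  "det (M :: complex^'n^'n) = 0 \<longleftrightarrow> (\<exists>z. z \<noteq> 0 \<and> z v* M = 0)"
proof -
  have "det M \<noteq> 0 \<longleftrightarrow> (\<exists>B. B ** transpose M = mat 1)"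
    using invertible_det_nz[of "transpose M"] invertible_left_inverse[of "transpose M"] by (simp add: det_transpose)
  also have "\<dots> \<longleftrightarrow> (\<forall>z. z v* M = 0 \<longrightarrow> z = 0)"
    unfolding matrix_left_invertible_ker vector_matrix_mult_transpose ..
  finally show ?thesis by meson
qed

lemma skew_component:
  fixes M :: "complex^'n^'n"
  assumes "transpose M = - M" shows "M $ b $ a = - M $ a $ b"
  using arg_cong[OF assms, of "\<lambda>N. N $ a $ b"] by (simp add: transpose_def)

lemma skew_pairing:
  fixes M :: "complex^'n^'n"
  assumes "transpose M = - M"
  shows "(\<Sum>b\<in>UNIV. (x v* M) $ b * z $ b) = - (\<Sum>b\<in>UNIV. (z v* M) $ b * x $ b)"
proof -
  have M: "M $ b $ a = - M $ a $ b" for a b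
    by (rule skew_component[OF assms])
  have "(\<Sum>b\<in>UNIV. (x v* M) $ b * z $ b) = (\<Sum>b\<in>UNIV. \<Sum>a\<in>UNIV. x $ a * z $ b * M $ a $ b)"
    by (simp add: vector_matrix_mult_def sum_distrib_left mult_ac)
  also have "\<dots> = (\<Sum>a\<in>UNIV. \<Sum>b\<in>UNIV. x $ a * z $ b * M $ a $ b)" by (rule sum.swap)
  also have "\<dots> = - (\<Sum>a\<in>UNIV. \<Sum>b\<in>UNIV. z $ b * x $ a * M $ b $ a)"
    by (subst (2) M) (simp add: sum_negf mult_ac)
  also have "\<dots> = - (\<Sum>b\<in>UNIV. (z v* M) $ b * x $ b)"
    by (simp add: vector_matrix_mult_def sum_distrib_left mult_ac)
  finally show ?thesis .
qed

lemma skew_self_pairing: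
  fixes M :: "complex^'n^'n"
  assumes "transpose M = - M"
  shows "(\<Sum>b\<in>UNIV. (z v* M) $ b * z $ b) = 0"
  using skew_pairing[OF assms, of z z] by simp

lemma subspace_left_kernel: "vec.subspace {z. z v* (M :: complex^'n^'n) = 0}"
  by (rule vec.subspaceI) (simp_all add: vector_matrix_linear)
text \<open>
  If the kernel is a line, spanned by \<open>z\<close> with \<open>z\<^sub>i \<noteq> 0\<close>, then the form is nondegenerate on the hyperplane
  \<open>x\<^sub>i = 0\<close>. But this has odd dimension, where a skew determinant vanishes. To stay in the same matrix size, the
  \<open>i\<close>-th row and column are replaced by those of the identity.
\<close>
lemma skew_kernel_dim:
  fixes M :: "complex^'n^'n"
  assumes skew: "transpose M = - M" and det: "det M = 0" and ev: "even CARD('n)"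
  shows "vec.dim {z. z v* M = 0} \<ge> 2"
proof (rule ccontr)
  let ?K = "{z. z v* M = 0}"
  assume "\<not> vec.dim ?K \<ge> 2"
  then have small: "vec.dim ?K \<le> 1" by simp
  obtain z where z: "z \<noteq> 0" "z v* M = 0" using det det_zero_iff_left_kernel by blast
  have "?K \<subseteq> vec.span {z}"
    by (rule vec.card_ge_dim_independent) (use z small in \<open>auto simp: vec.dependent_single\<close>)
  then have line: "\<exists>c. x = c *s z" if "x v* M = 0" for x
    using that by (auto simp: vec.span_singleton)
  obtain i where i: "z $ i \<noteq> 0" using z(1) by (auto simp: vec_eq_iff)
  have M: "M $ b $ a = - M $ a $ b" for a b
    by (rule skew_component[OF skew])
  define M' :: "complex^'n^'n" where
    "M' = (\<chi> a b. if a = i \<and> b = i then 1 else if a = i \<or> b = i then 0 else M $ a $ b)"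
  define E :: "complex^'n^'n" where "E = (\<chi> a b. if a = b then (if a = i then 1 else - 1) else 0)"
  have EM: "(E ** M') $ a $ b = (if a = i then 1 else - 1) * M' $ a $ b" for a b
  proof -
    have "E $ a $ k * M' $ k $ b = (if k = a then (if a = i then 1 else - 1) * M' $ a $ b else 0)" for k
      by (auto simp: E_def)
    then have "(E ** M') $ a $ b = (\<Sum>k\<in>UNIV. if k = a then (if a = i then 1 else - 1) * M' $ a $ b else 0)"
      unfolding matrix_matrix_mult_def by (simp only: vec_lambda_beta)
    then show ?thesis by (simp only: sum.delta finite UNIV_I if_True)
  qed
  have sw: "M' $ b $ a = (if a = i then 1 else - 1) * M' $ a $ b" for a b
    using M[of b a] by (simp add: M'_def)
  \<comment> \<open>\<open>E\<close> changes the sign of all rows but the \<open>i\<close>-th, an odd number.\<close>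
  have "transpose M' $ a $ b = (E ** M') $ a $ b" for a b
    unfolding EM transpose_def vec_lambda_beta by (rule sw)
  then have "transpose M' = E ** M'" unfolding vec_eq_iff by blast
  from arg_cong[OF this, of det] have "det M' = det E * det M'" by (simp only: det_mul det_transpose)
  moreover have "det E = - 1"
  proof -
    have "det E = (\<Prod>a\<in>UNIV. if a = i then 1 else - 1)"
      by (subst det_diagonal) (auto simp: E_def)
    also have "\<dots> = (\<Prod>a\<in>UNIV - {i}. - 1)"
      by (subst prod.remove[of _ i]) auto
    also have "\<dots> = (- 1) ^ (CARD('n) - 1)" by simp
    also have "\<dots> = - 1"
      using ev by (simp add: uminus_power_if)
    finally show ?thesis .
  qed
  ultimately have "det M' = 0" by simp
  then obtain x where x: "x \<noteq> 0" "x v* M' = 0" using det_zero_iff_left_kernel by blast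
  have "M' $ a $ i * x $ a = (if a = i then x $ i else 0)" for a by (simp add: M'_def)
  then have "(x v* M') $ i = (\<Sum>a\<in>UNIV. if a = i then x $ i else 0)"
    by (simp add: vector_matrix_mult_def mult.commute)
  then have xi: "x $ i = 0" using x(2) by simp
  have xb: "(x v* M) $ b = 0" if "b \<noteq> i" for b
  proof -
    have "(x v* M) $ b = (x v* M') $ b"
      unfolding vector_matrix_mult_def M'_def using xi that by (auto intro!: sum.cong)
    then show ?thesis using x(2) by simp
  qed
  have "(\<Sum>b\<in>UNIV. (x v* M) $ b * z $ b) = 0" using skew_pairing[OF skew, of x z] z(2) by simp
  moreover have "(\<Sum>b\<in>UNIV. (x v* M) $ b * z $ b) = (x v* M) $ i * z $ i"
    by (subst sum.remove[of _ i]) (auto simp: xb intro!: sum.neutral)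
  ultimately have "(x v* M) $ i = 0" using i by simp
  then have "(x v* M) $ b = 0" for b using xb[of b] by (cases "b = i") simp_all
  then have "x v* M = 0" by (simp add: vec_eq_iff)
  then obtain c where "x = c *s z" using line by blast
  then show False using xi i x(1) by auto
qed

section \<open>Independence of eigenspaces\<close>

text \<open>
  Applying \<open>T - \<nu>\<close> to a combination of eigenvectors removes one eigenvalue and multiplies an eigenvector for
  another eigenvalue by a nonzero scalar.
\<close>
lemma eigenspaces_independent:
  fixes T :: "complex^'n \<Rightarrow> complex^'n"
  assumes add: "\<And>x y. T (x + y) = T x + T y" and scale: "\<And>c x. T (c *s x) = c *s T x"
    and "finite \<Lambda>"
  defines "K \<equiv> \<lambda>\<mu>. {z. T z = \<mu> *s z}"
  shows "\<mu> \<notin> \<Lambda> \<Longrightarrow> y \<in> vec.span (\<Union>l\<in>\<Lambda>. K l) \<Longrightarrow> T y = \<mu> *s y \<Longrightarrow> y = 0"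
  using \<open>finite \<Lambda>\<close>
proof (induction \<Lambda> arbitrary: y)
  case empty
  then show ?case by simp
next
  case (insert \<nu> \<Lambda>)
  let ?V = "vec.span (\<Union>l\<in>\<Lambda>. K l)"
  have subK: "vec.subspace (K l)" for l
    by (rule vec.subspaceI) (use scale[of 0 0] in \<open>auto simp: K_def add scale vector_add_ldistrib\<close>)
  have inv: "T w \<in> ?V" if "w \<in> ?V" for w
    using that
  proof (induction rule: vec.span_induct_alt)
    case base
    then show ?case using scale[of 0 0] by (simp add: vec.span_zero)
  next
    case (step c x y)
    then have "x \<in> ?V" by (blast intro: vec.span_base)
    moreover obtain l where "T x = l *s x" using step(1) by (auto simp: K_def)
    ultimately show ?case using step by (simp add: add scale vec.span_add vec.span_scale)
  qed
  have "y \<in> vec.span (K \<nu> \<union> (\<Union>l\<in>\<Lambda>. K l))" using insert.prems(2) by simp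
  then obtain x w where xw: "y = x + w" "x \<in> K \<nu>" "w \<in> ?V"
    unfolding vec.span_Un by (auto simp: vec.span_eq_iff[THEN iffD2, OF subK])
  have "(\<mu> - \<nu>) *s y = T y - \<nu> *s y" using insert.prems(3) by (simp add: vector_sub_rdistrib)
  also have "\<dots> = T w - \<nu> *s w" using xw by (simp add: add K_def vector_add_ldistrib)
  also have "\<dots> \<in> ?V" using inv[OF xw(3)] xw(3) by (intro vec.span_diff vec.span_scale)
  finally have mem: "(1 / (\<mu> - \<nu>)) *s ((\<mu> - \<nu>) *s y) \<in> ?V" by (rule vec.span_scale)
  have "\<mu> \<noteq> \<nu>" using insert.prems(1) by auto
  then have "(1 / (\<mu> - \<nu>)) *s ((\<mu> - \<nu>) *s y) = y"
    unfolding vector_smult_assoc by simp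
  with mem have "y \<in> ?V" by simp
  then show ?case using insert by auto
qed

lemma eigenspaces_dim_sum:
  fixes T :: "complex^'n \<Rightarrow> complex^'n"
  assumes add: "\<And>x y. T (x + y) = T x + T y" and scale: "\<And>c x. T (c *s x) = c *s T x"
    and "finite \<Lambda>"
  defines "K \<equiv> \<lambda>\<mu>. {z. T z = \<mu> *s z}"
  shows "vec.dim (vec.span (\<Union>l\<in>\<Lambda>. K l)) = (\<Sum>l\<in>\<Lambda>. vec.dim (K l))"
  using \<open>finite \<Lambda>\<close>
proof (induction \<Lambda>)
  case (insert \<nu> \<Lambda>)
  let ?V = "vec.span (\<Union>l\<in>\<Lambda>. K l)"
  have subK: "vec.subspace (K l)" for l
    by (rule vec.subspaceI) (use scale[of 0 0] in \<open>auto simp: K_def add scale vector_add_ldistrib\<close>)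
  have "K \<nu> \<inter> ?V = {0}"
  proof (intro equalityI subsetI)
    fix y assume "y \<in> K \<nu> \<inter> ?V"
    then show "y \<in> {0}"
      using eigenspaces_independent[OF add scale insert.hyps(1,2), of y] by (simp add: K_def)
  next
    fix y :: "complex^'n" assume "y \<in> {0}"
    then show "y \<in> K \<nu> \<inter> ?V" using scale[of 0 0] by (simp add: K_def vec.span_zero)
  qed
  moreover have "vec.span (K \<nu> \<union> (\<Union>l\<in>\<Lambda>. K l)) = {x + y |x y. x \<in> K \<nu> \<and> y \<in> ?V}"
    unfolding vec.span_Un by (simp add: vec.span_eq_iff[THEN iffD2, OF subK])
  moreover have "vec.dim {x + y |x y. x \<in> K \<nu> \<and> y \<in> ?V} + vec.dim (K \<nu> \<inter> ?V) = vec.dim (K \<nu>) + vec.dim ?V"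
    by (rule vec.dim_sums_Int[OF subK vec.subspace_span])
  ultimately show ?case using insert by simp
qed simp

section \<open>Polynomials with few roots\<close>

text \<open>
  The logarithmic derivative has at most simple poles, at the points of \<open>R\<close>, and vanishes at infinity.
\<close>
lemma log_derivative_numerator:
  fixes m :: "complex \<Rightarrow> nat"
  assumes "finite R"
  shows "\<exists>u. degree u < max 1 (card R) \<and>
    (\<Prod>z\<in>R. [:- z, 1:]) * pderiv (\<Prod>z\<in>R. [:- z, 1:] ^ m z) = u * (\<Prod>z\<in>R. [:- z, 1:] ^ m z)"
  using assms
proof (induction R)
  case empty
  show ?case by (intro exI[of _ 0]) (simp add: pderiv_1)
next
  case (insert z R)
  let ?r = "\<Prod>z\<in>R. [:- z, 1:]" and ?P = "\<Prod>z\<in>R. [:- z, 1:] ^ m z" and ?L = "[:- z, 1:]"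
  obtain u where u: "degree u < max 1 (card R)" "?r * pderiv ?P = u * ?P"
    using insert by blast
  have d: "?L * pderiv (?L ^ m z) = of_nat (m z) * ?L ^ m z"
  proof (cases "m z")
    case (Suc k)
    have "pderiv ?L = 1" by (simp add: pderiv_pCons)
    then show ?thesis
      unfolding Suc pderiv_power_Suc of_nat_poly by (simp only: mult_1_right mult_smult_right mult_pCons_left power_Suc) simp
  qed (simp add: pderiv_1)
  have "(?L * ?r) * pderiv (?L ^ m z * ?P) = (of_nat (m z) * ?r + ?L * u) * (?L ^ m z * ?P)"
  proof -
    have "(?L * ?r) * pderiv (?L ^ m z * ?P) = (?L * pderiv (?L ^ m z)) * (?r * ?P) + ?L * ?L ^ m z * (?r * pderiv ?P)"
      by (simp add: pderiv_mult algebra_simps)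
    then show ?thesis unfolding d u(2) by (simp add: algebra_simps)
  qed
  moreover have "degree (of_nat (m z) * ?r + ?L * u) < Suc (card R)"
  proof -
    have "degree ?r \<le> card R" using degree_prod_sum_le[OF insert.hyps(1), of "\<lambda>z. [:- z, 1:]"] by simp
    then have "degree (of_nat (m z) * ?r) \<le> card R"
      by (metis degree_mult_le degree_of_nat add_0 order_trans)
    moreover have "degree (?L * u) \<le> card R"
    proof (cases "R = {}")
      case True
      then have "u = 0" using u by (auto simp: pderiv_1)
      then show ?thesis by simp
    next
      case False
      then have "card R \<ge> 1" using insert.hyps(1) by (simp add: Suc_le_eq card_gt_0_iff)
      then have "degree u < card R" using u(1) by simp
      then show ?thesis using degree_mult_le[of ?L u] by simp
    qed
    ultimately show ?thesis by (meson degree_add_le le_imp_less_Suc)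
  qed
  ultimately show ?case using insert.hyps by (intro exI[of _ "of_nat (m z) * ?r + ?L * u"]) simp
qed

text \<open>
  Take for \<open>w\<close> the product of the distinct linear factors and for \<open>- u\<close> the numerator of the logarithmic
  derivative.
\<close>
lemma few_roots_syzygy:
  fixes q :: "complex poly"
  assumes "q \<noteq> 0" "card {z. poly q z = 0} < 4"
  shows "\<exists>u w. w \<noteq> 0 \<and> degree u < 3 \<and> degree w < 4 \<and> u * q + w * pderiv q = 0"
proof -
  let ?R = "{z. poly q z = 0}"
  let ?P = "\<Prod>z\<in>?R. [:- z, 1:] ^ order z q" and ?r = "\<Prod>z\<in>?R. [:- z, 1:]"
  have fin: "finite ?R" using assms(1) by (rule poly_roots_finite)
  have q: "q = smult (lead_coeff q) ?P" using complex_poly_decompose[of q] by simp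
  obtain u where u: "degree u < max 1 (card ?R)" "?r * pderiv ?P = u * ?P"
    using log_derivative_numerator[OF fin, of "\<lambda>z. order z q"] by blast
  have "?r * pderiv q = u * q"
    by (subst (1 2) q) (simp add: pderiv_smult u(2))
  moreover have "degree ?r < 4"
    using degree_prod_sum_le[OF fin, of "\<lambda>z. [:- z, 1:]"] assms(2) by simp
  moreover have "?r \<noteq> 0" using fin by simp
  moreover have "degree (- u) < 3"
    using u(1) assms(2) by simp
  ultimately show ?thesis
    by (intro exI[of _ "- u"] exI[of _ ?r]) simp
qed

section \<open>Genericity as a polynomial condition\<close>

abbreviation "pair_polynomials \<equiv> polynomial_functions (matrix_pair_coords :: ((complex^8^8) \<times> (complex^8^8) \<Rightarrow> complex) set)"

lemma polynomial_functions_sum: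
  "(\<And>i. i \<in> A \<Longrightarrow> f i \<in> polynomial_functions C) \<Longrightarrow> (\<lambda>x. \<Sum>i\<in>A. f i x) \<in> polynomial_functions C"
  by (induction A rule: infinite_finite_induct) (auto intro: polynomial_functions.intros)

lemma polynomial_functions_prod:
  "(\<And>i. i \<in> A \<Longrightarrow> f i \<in> polynomial_functions C) \<Longrightarrow> (\<lambda>x. \<Prod>i\<in>A. f i x) \<in> polynomial_functions C"
  by (induction A rule: infinite_finite_induct) (auto intro: polynomial_functions.intros)

lemma polynomial_functions_det:
  "(\<And>i j. (\<lambda>x. A x $ i $ j) \<in> polynomial_functions C) \<Longrightarrow> (\<lambda>x. det (A x)) \<in> polynomial_functions C"
  unfolding det_def
  by (intro polynomial_functions_sum polynomial_functions.mult polynomial_functions.const polynomial_functions_prod)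

definition poly_family :: "('a \<Rightarrow> complex) set \<Rightarrow> ('a \<Rightarrow> complex poly) \<Rightarrow> bool" where
  "poly_family C p \<longleftrightarrow> (\<forall>k. (\<lambda>x. coeff (p x) k) \<in> polynomial_functions C)"

lemma poly_family_const: "poly_family C (\<lambda>x. p)"
  by (simp add: poly_family_def polynomial_functions.const)

lemma poly_family_add: "poly_family C p \<Longrightarrow> poly_family C q \<Longrightarrow> poly_family C (\<lambda>x. p x + q x)"
  by (simp add: poly_family_def polynomial_functions.add)

lemma poly_family_mult: "poly_family C p \<Longrightarrow> poly_family C q \<Longrightarrow> poly_family C (\<lambda>x. p x * q x)"
  unfolding poly_family_def coeff_mult
  by (intro allI polynomial_functions_sum polynomial_functions.mult) auto

lemma poly_family_sum: "(\<And>i. i \<in> A \<Longrightarrow> poly_family C (p i)) \<Longrightarrow> poly_family C (\<lambda>x. \<Sum>i\<in>A. p i x)"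
  by (induction A rule: infinite_finite_induct) (auto intro: poly_family_const poly_family_add)

lemma poly_family_prod: "(\<And>i. i \<in> A \<Longrightarrow> poly_family C (p i)) \<Longrightarrow> poly_family C (\<lambda>x. \<Prod>i\<in>A. p i x)"
  by (induction A rule: infinite_finite_induct) (auto intro: poly_family_const poly_family_mult)

lemma poly_family_pderiv: "poly_family C p \<Longrightarrow> poly_family C (\<lambda>x. pderiv (p x))"
  unfolding poly_family_def coeff_pderiv
  by (intro allI polynomial_functions.mult polynomial_functions.const) auto

text \<open>
  The determinant of the pencil, taken over the polynomial ring so that its coefficients are visibly
  polynomial in the entries.
\<close>
definition pencil_poly :: "complex^'n^'n \<Rightarrow> complex^'n^'n \<Rightarrow> complex poly" where
  "pencil_poly M1 M2 = det (\<chi> i j. [:- M1 $ i $ j, M2 $ i $ j:])"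

definition pencil :: "complex^'n^'n \<Rightarrow> complex^'n^'n \<Rightarrow> complex \<Rightarrow> complex^'n^'n" where
  "pencil M1 M2 x = (\<chi> i j. x * M2 $ i $ j - M1 $ i $ j)"

lemma poly_pencil_poly: "poly (pencil_poly M1 M2) x = det (pencil M1 M2 x)"
  by (simp add: pencil_poly_def pencil_def det_def poly_sum poly_prod)

lemma poly_family_pencil: "poly_family matrix_pair_coords (\<lambda>(M1, M2). pencil_poly M1 M2)"
proof -
  have 1: "(\<lambda>x. fst x $ i $ j) \<in> polynomial_functions matrix_pair_coords"
    "(\<lambda>x. snd x $ i $ j) \<in> polynomial_functions matrix_pair_coords" for i j
    by (rule polynomial_functions.coord; force simp: matrix_pair_coords_def case_prod_unfold)+
  have "poly_family matrix_pair_coords (\<lambda>x. [:- fst x $ i $ j, snd x $ i $ j:])" for i j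
    unfolding poly_family_def
  proof
    fix k
    consider "k = 0" | "k = 1" | l where "k = Suc (Suc l)" by (metis One_nat_def not0_implies_Suc)
    then show "(\<lambda>x. coeff [:- fst x $ i $ j, snd x $ i $ j:] k) \<in> polynomial_functions matrix_pair_coords"
      using 1 polynomial_functions.mult[OF polynomial_functions.const[of "-1"] 1(1)]
      by cases (auto intro: polynomial_functions.const)
  qed
  then show ?thesis
    unfolding pencil_poly_def det_def case_prod_unfold
    by (intro poly_family_sum poly_family_mult poly_family_const poly_family_prod) simp
qed

definition index_of :: "'n::finite \<Rightarrow> nat" where
  "index_of = (SOME f. bij_betw f UNIV {..<CARD('n)})"

lemma bij_index_of: "bij_betw (index_of :: 'n::finite \<Rightarrow> nat) UNIV {..<CARD('n)}"
proof -
  have "\<exists>f :: 'n \<Rightarrow> nat. bij_betw f UNIV {..<CARD('n)}"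
    by (rule finite_same_card_bij) auto
  then show ?thesis unfolding index_of_def by (rule someI_ex)
qed

definition syzygy_column :: "complex poly \<Rightarrow> nat \<Rightarrow> complex poly" where
  "syzygy_column q k = (if k < 3 then monom 1 k * q else monom 1 (k - 3) * pderiv q)"

text \<open>
  The linear map \<open>(u, w) \<mapsto> u q + w q'\<close> on coefficients, for \<open>deg u < 3\<close> and \<open>deg w < 4\<close>. For \<open>deg q \<le> 8\<close>, as
  for the pencils at hand, the result has degree at most 10, so eleven coefficients determine it.
\<close>
definition syzygy_matrix :: "complex poly \<Rightarrow> complex^7^11" where
  "syzygy_matrix q = (\<chi> i k. coeff (syzygy_column q (index_of k)) (index_of i))"

definition syzygy_vector :: "complex poly \<Rightarrow> complex poly \<Rightarrow> complex^7" where
  "syzygy_vector u w = (\<chi> k. if index_of k < 3 then coeff u (index_of k) else coeff w (index_of k - 3))"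

lemma syzygy_matrix_apply:
  assumes "degree u < 3" "degree w < 4"
  shows "(syzygy_matrix q *v syzygy_vector u w) $ i = coeff (u * q + w * pderiv q) (index_of i)"
proof -
  let ?g = "\<lambda>n. smult (if n < 3 then coeff u n else coeff w (n - 3)) (syzygy_column q n)"
  have "(syzygy_matrix q *v syzygy_vector u w) $ i = (\<Sum>k\<in>(UNIV :: 7 set). coeff (?g (index_of k)) (index_of i))"
    by (auto simp: matrix_vector_mult_def syzygy_matrix_def syzygy_vector_def mult.commute intro!: sum.cong)
  also have "\<dots> = (\<Sum>n<7. coeff (?g n) (index_of i))"
    using sum.reindex_bij_betw[OF bij_index_of[where 'n = 7], of "\<lambda>n. coeff (?g n) (index_of i)"] by simp
  also have "\<dots> = coeff (\<Sum>n<7. ?g n) (index_of i)" by (simp add: coeff_sum)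
  also have "(\<Sum>n<7. ?g n) = u * q + w * pderiv q"
  proof -
    have s: "smult c (monom 1 n * p) = monom c n * p" for c n and p :: "complex poly"
      by (simp add: smult_monom flip: mult_smult_left)
    have "{..<7::nat} = {..<3} \<union> {3..<7}" by auto
    then have "(\<Sum>n<7. ?g n) = (\<Sum>n<3. ?g n) + (\<Sum>n\<in>{3..<7}. ?g n)"
      by (simp add: sum.union_disjoint ivl_disj_int)
    also have "(\<Sum>n<3. ?g n) = (\<Sum>n<3. monom (coeff u n) n) * q"
      by (simp add: sum_distrib_right syzygy_column_def s)
    also have "(\<Sum>n<3. monom (coeff u n) n) = u"
      using poly_as_sum_of_monoms'[of u 2] assms(1) by (simp add: lessThan_Suc_atMost[symmetric] numeral_3_eq_3)
    also have "(\<Sum>n\<in>{3..<7}. ?g n) = (\<Sum>n<4. ?g (n + 3))"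
      using sum.shift_bounds_nat_ivl[of ?g 0 3 4] by (simp add: atLeast0LessThan)
    also have "\<dots> = (\<Sum>n<4. monom (coeff w n) n) * pderiv q"
      by (simp add: sum_distrib_right syzygy_column_def s)
    also have "(\<Sum>n<4. monom (coeff w n) n) = w"
      using poly_as_sum_of_monoms'[of w 3] assms(2) lessThan_Suc_atMost[of 3, symmetric] by simp
    finally show ?thesis .
  qed
  finally show ?thesis .
qed

lemma syzygy_vector_zero:
  assumes "degree w < 4" "syzygy_vector u w = 0"
  shows "w = 0"
proof (rule poly_eqI)
  fix n
  show "coeff w n = coeff 0 n"
  proof (cases "n < 4")
    case True
    then have "n + 3 \<in> index_of ` (UNIV :: 7 set)" using bij_index_of[where 'n = 7] by (simp add: bij_betw_def)
    then obtain k :: 7 where k: "index_of k = n + 3" by force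
    then have "syzygy_vector u w $ k = coeff w n" by (simp add: syzygy_vector_def)
    then show ?thesis using assms(2) by simp
  next
    case False
    then show ?thesis using assms(1) by (simp add: coeff_eq_0)
  qed
qed

text \<open>
  With fewer roots, \<open>few_roots_syzygy\<close> gives a nonzero vector in the kernel.
\<close>
lemma det_syzygy_four_roots:
  assumes "det (C ** syzygy_matrix q) \<noteq> 0"
  shows "q \<noteq> 0" "card {z. poly q z = 0} \<ge> 4"
proof -
  have inj: "v = 0" if "syzygy_matrix q *v v = 0" for v
  proof -
    have "invertible (C ** syzygy_matrix q)" using assms invertible_det_nz by blast
    then obtain B where "B ** (C ** syzygy_matrix q) = mat 1" unfolding invertible_left_inverse by blast
    then have "v = B *v (C *v (syzygy_matrix q *v v))" by (simp add: matrix_vector_mul_assoc matrix_mul_assoc)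
    then show "v = 0" using that by simp
  qed
  show q: "q \<noteq> 0"
  proof
    assume q: "q = 0"
    have "syzygy_matrix q *v syzygy_vector 0 1 = 0"
      unfolding vec_eq_iff by (subst syzygy_matrix_apply) (simp_all add: q)
    then have "syzygy_vector 0 1 = 0" by (rule inj)
    then show False using syzygy_vector_zero[of 1 0] by simp
  qed
  show "card {z. poly q z = 0} \<ge> 4"
  proof (rule ccontr)
    assume "\<not> card {z. poly q z = 0} \<ge> 4"
    then obtain u w where uw: "w \<noteq> 0" "degree u < 3" "degree w < 4" "u * q + w * pderiv q = 0"
      using few_roots_syzygy[OF q] by auto
    have "syzygy_matrix q *v syzygy_vector u w = 0"
      unfolding vec_eq_iff by (simp add: syzygy_matrix_apply uw)
    then have "syzygy_vector u w = 0" by (rule inj)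
    then show False using syzygy_vector_zero[OF uw(3)] uw(1) by simp
  qed
qed

text \<open>
  Injectivity of the rectangular matrix is expressed by a family of determinants: it holds if and only if
  multiplication by some constant matrix \<open>C\<close> makes it invertible.
\<close>
definition genericity_polynomial :: "complex^11^7 \<Rightarrow> (complex^8^8) \<times> (complex^8^8) \<Rightarrow> complex" where
  "genericity_polynomial C x = det (C ** syzygy_matrix (pencil_poly (fst x) (snd x)))"

lemma genericity_polynomial: "genericity_polynomial C \<in> pair_polynomials"
proof -
  have q: "poly_family matrix_pair_coords (\<lambda>x :: (complex^8^8) \<times> (complex^8^8). pencil_poly (fst x) (snd x))"
    using poly_family_pencil by (simp add: case_prod_unfold)
  have "poly_family matrix_pair_coords (\<lambda>x :: (complex^8^8) \<times> (complex^8^8). syzygy_column (pencil_poly (fst x) (snd x)) k)" for k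
    unfolding syzygy_column_def
    by (cases "k < 3") (simp_all add: poly_family_mult poly_family_const poly_family_pderiv q)
  then have "(\<lambda>x :: (complex^8^8) \<times> (complex^8^8). syzygy_matrix (pencil_poly (fst x) (snd x)) $ i $ k) \<in> pair_polynomials" for i k
    by (simp add: syzygy_matrix_def poly_family_def)
  then show ?thesis
    unfolding genericity_polynomial_def[abs_def] matrix_matrix_mult_def
    by (intro polynomial_functions_det)
       (simp add: polynomial_functions_sum polynomial_functions.mult polynomial_functions.const)
qed

section \<open>The planes where a pencil degenerates\<close>

text \<open>
  The kernels of the pencil are eigenspaces of a single operator.
\<close>
lemma left_kernel_eigen:
  fixes M1 M2 N :: "complex^'n^'n"
  assumes "M2 ** N = mat 1" "N ** M2 = mat 1"
  shows "(z v* M1) v* N = l *s z \<longleftrightarrow> z v* M1 = l *s (z v* M2)"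
proof
  assume "(z v* M1) v* N = l *s z"
  then have "((z v* M1) v* N) v* M2 = (l *s z) v* M2" by simp
  then show "z v* M1 = l *s (z v* M2)"
    by (simp add: vector_matrix_mul_assoc assms vector_matrix_linear flip: matrix_mul_assoc)
next
  assume "z v* M1 = l *s (z v* M2)"
  then show "(z v* M1) v* N = l *s z"
    by (simp add: vector_matrix_mul_assoc assms vector_matrix_linear)
qed

lemma pencil_left_kernel: "z v* pencil M1 M2 l = 0 \<longleftrightarrow> z v* M1 = l *s (z v* M2)"
proof -
  have "z v* pencil M1 M2 l = l *s (z v* M2) - z v* M1"
    by (simp add: pencil_def vec_eq_iff vector_matrix_mult_def algebra_simps sum_subtractf sum_distrib_left)
  then show ?thesis by auto
qed

lemma closed_left_kernel: "closed {z. z v* (M :: complex^'n^'n) = 0}"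
proof (rule closed_subspace)
  have "r *\<^sub>R z = complex_of_real r *s z" for r and z :: "complex^'n"
    unfolding vec_eq_iff vector_scaleR_component vector_smult_component by (simp add: scaleR_conv_of_real)
  then show "subspace {z. z v* M = 0}"
    by (intro subspaceI) (simp_all add: vector_matrix_linear)
qed

text \<open>
  Each of four roots contributes a kernel of dimension at least two, and the sum of the kernels is direct. In
  dimension eight this leaves no room: each dimension is exactly two, the kernels span, and any further
  eigenvector has one of the four eigenvalues, since otherwise it would be independent of the whole space.
\<close>
lemma degeneracy_planes:
  fixes M1 M2 :: "complex^8^8"
  assumes skew: "transpose M1 = - M1" "transpose M2 = - M2" and inv: "invertible M2"
    and q: "pencil_poly M1 M2 \<noteq> 0" "card {x. poly (pencil_poly M1 M2) x = 0} \<ge> 4"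
  obtains W :: "4 \<Rightarrow> (complex^8) set" where "four_generic_lines W" "\<And>k. closed (W k)"
    "\<And>z c. z \<noteq> 0 \<Longrightarrow> z v* M1 = c *s (z v* M2) \<Longrightarrow> z \<in> (\<Union>k. W k)"
proof -
  obtain N where N: "M2 ** N = mat 1" "N ** M2 = mat 1" using inv unfolding invertible_def by blast
  define T where "T z = (z v* M1) v* N" for z
  define K where "K = (\<lambda>l. {z. T z = l *s z})"
  have T: "T (x + y) = T x + T y" "T (c *s x) = c *s T x" for x y c
    by (simp_all add: T_def vector_matrix_linear)
  have K: "K l = {z. z v* pencil M1 M2 l = 0}" for l
    by (simp add: K_def T_def left_kernel_eigen[OF N] pencil_left_kernel)
  let ?R = "{x. poly (pencil_poly M1 M2) x = 0}"
  have dimK: "vec.dim (K l) \<ge> 2" if "l \<in> ?R" for l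
    unfolding K
  proof (rule skew_kernel_dim)
    show "transpose (pencil M1 M2 l) = - pencil M1 M2 l"
    proof (unfold vec_eq_iff, intro allI)
      fix a b
      show "transpose (pencil M1 M2 l) $ a $ b = (- pencil M1 M2 l) $ a $ b"
        using skew_component[OF skew(1), of b a] skew_component[OF skew(2), of b a]
        by (simp add: transpose_def pencil_def)
    qed
    show "det (pencil M1 M2 l) = 0" using that by (simp add: poly_pencil_poly)
  qed simp
  obtain \<Lambda> where \<Lambda>: "\<Lambda> \<subseteq> ?R" "card \<Lambda> = 4" "finite \<Lambda>"
    using obtain_subset_with_card_n[OF q(2)] by auto
  have "vec.dim (vec.span (\<Union>l\<in>\<Lambda>. K l)) = (\<Sum>l\<in>\<Lambda>. vec.dim (K l))"
    unfolding K_def by (rule eigenspaces_dim_sum[OF T \<Lambda>(3)])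
  moreover have "vec.dim (vec.span (\<Union>l\<in>\<Lambda>. K l)) \<le> 8"
    using vec.dim_subset_UNIV[of "vec.span (\<Union>l\<in>\<Lambda>. K l)"] by (simp add: vec.dimension_def card_cart_basis)
  moreover have ge: "(\<Sum>l\<in>\<Lambda>. vec.dim (K l)) \<ge> (\<Sum>l\<in>\<Lambda>. 2)"
    using dimK \<Lambda>(1) by (intro sum_mono) blast
  ultimately have sum: "(\<Sum>l\<in>\<Lambda>. vec.dim (K l)) = 8" "vec.dim (vec.span (\<Union>l\<in>\<Lambda>. K l)) = 8"
    using \<Lambda>(2) by simp_all
  \<comment> \<open>The other three kernels already use up six dimensions.\<close>
  have dim2: "vec.dim (K l) = 2" if "l \<in> \<Lambda>" for l
  proof -
    have "(\<Sum>l\<in>\<Lambda> - {l}. vec.dim (K l)) \<ge> (\<Sum>l\<in>\<Lambda> - {l}. 2)"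
      using dimK \<Lambda>(1) by (intro sum_mono) blast
    then have "(\<Sum>l\<in>\<Lambda> - {l}. vec.dim (K l)) \<ge> 6" using that \<Lambda> by simp
    moreover have "vec.dim (K l) \<ge> 2" using dimK that \<Lambda>(1) by blast
    ultimately show ?thesis using sum(1) sum.remove[OF \<Lambda>(3) that, of "\<lambda>l. vec.dim (K l)"] by simp
  qed
  have span: "vec.span (\<Union>l\<in>\<Lambda>. K l) = UNIV"
    using sum(2) vec.dim_eq_full[of "\<Union>l\<in>\<Lambda>. K l"] by (simp add: vec.dimension_def card_cart_basis)
  have "card (UNIV :: 4 set) = card \<Lambda>" using \<Lambda>(2) by simp
  then obtain h :: "4 \<Rightarrow> complex" where h: "bij_betw h UNIV \<Lambda>"
    using finite_same_card_bij[OF finite \<Lambda>(3)] by blast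
  have U: "(\<Union>k. K (h k)) = (\<Union>l\<in>\<Lambda>. K l)" using h by (auto simp: bij_betw_def)
  have hk: "h k \<in> \<Lambda>" for k using h by (auto simp: bij_betw_def)
  show thesis
  proof (rule that[of "\<lambda>k. K (h k)"])
    show "four_generic_lines (\<lambda>k. K (h k))"
      unfolding four_generic_lines_def U span using dim2[OF hk] by (simp add: K subspace_left_kernel)
    show "closed (K (h k))" for k unfolding K by (rule closed_left_kernel)
    fix z c assume z: "z \<noteq> 0" "z v* M1 = c *s (z v* M2)"
    have Tz: "T z = c *s z" unfolding T_def left_kernel_eigen[OF N] by (rule z(2))
    have "c \<in> \<Lambda>"
    proof (rule ccontr)
      assume "c \<notin> \<Lambda>"
      have "z \<in> vec.span (\<Union>l\<in>\<Lambda>. {z. T z = l *s z})" using span unfolding K_def by simp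
      from eigenspaces_independent[OF T \<Lambda>(3) \<open>c \<notin> \<Lambda>\<close> this Tz] z(1) show False by simp
    qed
    then show "z \<in> (\<Union>k. K (h k))" unfolding U using Tz by (auto simp: K_def)
  qed
qed

section \<open>A generic pair\<close>

text \<open>
  Exchanges \<open>2k\<close> and \<open>2k + 1\<close>.
\<close>
definition partner :: "nat \<Rightarrow> nat" where
  "partner n = (if even n then Suc n else n - 1)"

lemma partner: "partner (partner n) = n" "partner n \<noteq> n" "partner n div 2 = n div 2" "even (partner n) \<longleftrightarrow> odd n"
  by (auto simp: partner_def elim!: oddE evenE)

lemma partner_less: "n < 8 \<Longrightarrow> partner n < 8"
  by (auto simp: partner_def elim!: evenE)

text \<open>
  Block diagonal, with blocks \<open>c k\<close> times the rotation by a right angle.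
\<close>
definition block_skew :: "(nat \<Rightarrow> complex) \<Rightarrow> complex^8^8" where
  "block_skew c = (\<chi> i j. if index_of j = partner (index_of i)
     then (if even (index_of i) then 1 else - 1) * c (index_of i div 2) else 0)"

lemma block_skew_transpose: "transpose (block_skew c) = - block_skew c"
proof -
  have "block_skew c $ j $ i = - block_skew c $ i $ j" for i j
    using partner(1)[of "index_of i"] partner(1)[of "index_of j"] partner(3,4)[of "index_of i"] partner(3,4)[of "index_of j"]
    by (auto simp: block_skew_def)
  then have "transpose (block_skew c) $ i $ j = (- block_skew c) $ i $ j" for i j
    unfolding transpose_def vec_lambda_beta vector_uminus_component .
  then show ?thesis unfolding vec_eq_iff by blast
qed

lemma index_of_8: "index_of (i :: 8) < 8" "index_of i = index_of j \<longleftrightarrow> i = (j :: 8)"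
  "n < 8 \<Longrightarrow> \<exists>i :: 8. index_of i = n"
proof -
  have b: "bij_betw (index_of :: 8 \<Rightarrow> nat) UNIV {..<8}" using bij_index_of[where 'n = 8] by simp
  show "index_of i < 8" "index_of i = index_of j \<longleftrightarrow> i = j"
    using b by (auto simp: bij_betw_def inj_on_def)
  show "\<exists>i :: 8. index_of i = n" if "n < 8"
  proof -
    have "n \<in> index_of ` (UNIV :: 8 set)" using b that by (simp add: bij_betw_def)
    then show ?thesis by auto
  qed
qed

lemma block_skew_apply:
  assumes "index_of b = partner (index_of a)"
  shows "(z v* block_skew c) $ b = (if even (index_of a) then 1 else - 1) * c (index_of a div 2) * z $ a"
proof -
  have summand: "block_skew c $ k $ b * z $ k = (if k = a then block_skew c $ a $ b * z $ a else 0)" for k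
  proof (cases "k = a")
    case False
    have "index_of b \<noteq> partner (index_of k)"
    proof
      assume "index_of b = partner (index_of k)"
      then have "partner (partner (index_of k)) = partner (partner (index_of a))" using assms by simp
      then have "index_of k = index_of a" by (simp only: partner(1))
      then show False using False index_of_8(2)[of k a] by simp
    qed
    then show ?thesis using False by (simp add: block_skew_def)
  qed simp
  have "(z v* block_skew c) $ b = (\<Sum>k\<in>UNIV. block_skew c $ k $ b * z $ k)"
    by (simp add: vector_matrix_mult_def mult.commute)
  also have "\<dots> = (\<Sum>k\<in>UNIV. if k = a then block_skew c $ a $ b * z $ a else 0)"
    by (rule sum.cong[OF refl]) (rule summand)
  also have "\<dots> = block_skew c $ a $ b * z $ a" by simp
  finally show ?thesis using assms by (simp add: block_skew_def)
qed

lemma det_block_skew: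
  assumes "\<And>k. k < 4 \<Longrightarrow> c k \<noteq> 0" shows "det (block_skew c) \<noteq> 0"
proof
  assume "det (block_skew c) = 0"
  then obtain z where z: "z \<noteq> 0" "z v* block_skew c = 0" using det_zero_iff_left_kernel by blast
  have "z $ a = 0" for a
  proof -
    obtain b :: 8 where b: "index_of b = partner (index_of a)"
      using index_of_8(3)[OF partner_less[OF index_of_8(1)[of a]]] by blast
    have "index_of a div 2 < 4" using index_of_8(1)[of a] by simp
    then show ?thesis using block_skew_apply[OF b, of z c] assms[of "index_of a div 2"] z(2) by (auto split: if_splits)
  qed
  then show False using z(1) by (simp add: vec_eq_iff)
qed

lemma block_skew_invertible_skew: "(\<And>k. k < 4 \<Longrightarrow> c k \<noteq> 0) \<Longrightarrow> block_skew c \<in> invertible_skew"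
  using det_block_skew[of c] by (simp add: invertible_skew_def block_skew_transpose invertible_det_nz)

text \<open>
  The Pfaffian of the pencil of the two block matrices, up to a constant.
\<close>
definition quartic :: "complex poly" where
  "quartic = [:-1, 1:] * [:-2, 1:] * [:-3, 1:] * [:-4, 1:]"

text \<open>
  The blocks of the pencil are those of the second matrix, multiplied by \<open>x - 1, \<dots>, x - 4\<close>.
\<close>
lemma pencil_poly_block_skew:
  "pencil_poly (block_skew (\<lambda>k. of_nat (Suc k))) (block_skew (\<lambda>k. 1)) =
     smult (det (block_skew (\<lambda>k. 1))) (quartic * quartic)"
proof -
  have "poly (pencil_poly (block_skew (\<lambda>k. of_nat (Suc k))) (block_skew (\<lambda>k. 1))) x =
      poly (smult (det (block_skew (\<lambda>k. 1))) (quartic * quartic)) x" for x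
  proof -
    let ?D = "(\<chi> i j. if i = j then x - of_nat (Suc (index_of i div 2)) else 0) :: complex^8^8"
    have "pencil (block_skew (\<lambda>k. of_nat (Suc k))) (block_skew (\<lambda>k. 1)) x = ?D ** block_skew (\<lambda>k. 1)"
    proof -
      have "(?D ** block_skew (\<lambda>k. 1)) $ i $ j = (x - of_nat (Suc (index_of i div 2))) * block_skew (\<lambda>k. 1) $ i $ j" for i j
      proof -
        have "(?D ** block_skew (\<lambda>k. 1)) $ i $ j = (\<Sum>k\<in>UNIV. ?D $ i $ k * block_skew (\<lambda>k. 1) $ k $ j)"
          unfolding matrix_matrix_mult_def vec_lambda_beta ..
        also have "\<dots> = (\<Sum>k\<in>UNIV. if k = i then (x - of_nat (Suc (index_of i div 2))) * block_skew (\<lambda>k. 1) $ i $ j else 0)"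
          by (rule sum.cong[OF refl]) auto
        also have "\<dots> = (x - of_nat (Suc (index_of i div 2))) * block_skew (\<lambda>k. 1) $ i $ j" by simp
        finally show ?thesis .
      qed
      then show ?thesis by (simp add: vec_eq_iff pencil_def) (simp add: block_skew_def algebra_simps)
    qed
    moreover have "det ?D = (\<Prod>i\<in>UNIV. x - of_nat (Suc (index_of (i :: 8) div 2)))"
      by (subst det_diagonal) simp_all
    moreover have "\<dots> = (\<Prod>n<8. x - of_nat (Suc (n div 2)))"
      using prod.reindex_bij_betw[OF bij_index_of[where 'n = 8], of "\<lambda>n. x - of_nat (Suc (n div 2))"] by simp
    moreover have "\<dots> = poly (quartic * quartic) x"
    proof -
      have "{..<8::nat} = {0, 1, 2, 3, 4, 5, 6, 7}" by auto
      moreover have "poly quartic x = (x - 1) * (x - 2) * (x - 3) * (x - 4)"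
        by (simp add: quartic_def) algebra
      ultimately show ?thesis by (simp add: mult_ac)
    qed
    ultimately show ?thesis by (simp add: poly_pencil_poly det_mul mult.commute)
  qed
  then show ?thesis by (simp add: poly_eq_poly_eq_iff[symmetric] fun_eq_iff)
qed

text \<open>
  Cancelling the quartic leaves \<open>u h + 2 w h' = 0\<close>. As \<open>h\<close> has simple roots, \<open>w\<close> vanishes at all four of
  them.
\<close>
lemma syzygy_of_square:
  assumes "d \<noteq> 0" "degree u < 3" "degree w < 4"
    and syz: "u * smult d (quartic * quartic) + w * pderiv (smult d (quartic * quartic)) = 0"
  shows "u = 0 \<and> w = 0"
proof -
  have h0: "quartic \<noteq> 0" by (simp add: quartic_def)
  have "smult d quartic * (u * quartic + 2 * w * pderiv quartic) = 0"
    using syz by (simp add: pderiv_smult pderiv_mult algebra_simps)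
  then have eq: "u * quartic + 2 * w * pderiv quartic = 0" using h0 assms(1) by simp
  have q4: "poly quartic a = 0" "poly (pderiv quartic) a \<noteq> 0" if "a \<in> {1, 2, 3, 4}" for a
    using that by (auto simp: quartic_def pderiv_mult pderiv_pCons)
  have root: "poly w a = 0" if "a \<in> {1, 2, 3, 4}" for a
    using arg_cong[OF eq, of "\<lambda>p. poly p a"] q4[OF that] by simp
  have "w = 0"
  proof (rule ccontr)
    assume "w \<noteq> 0"
    then have "card {a. poly w a = 0} \<le> degree w" "finite {a. poly w a = 0}"
      by (auto intro: card_poly_roots_bound poly_roots_finite)
    moreover have "{1, 2, 3, 4} \<subseteq> {a. poly w a = 0}" using root by blast
    ultimately have "card {1, 2, 3, 4 :: complex} \<le> degree w" by (meson card_mono order_trans)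
    then show False using assms(3) by simp
  qed
  then show ?thesis using eq h0 by simp
qed

text \<open>
  By \<open>syzygy_of_square\<close> the matrix of syzygies is injective, and a left inverse of it can be taken for \<open>C\<close>.
\<close>
lemma ex_generic_pair:
  "\<exists>C. genericity_polynomial C (block_skew (\<lambda>k. of_nat (Suc k)), block_skew (\<lambda>k. 1)) \<noteq> 0"
proof -
  let ?d = "det (block_skew (\<lambda>k. 1))"
  let ?q = "smult ?d (quartic * quartic)"
  have d: "?d \<noteq> 0" by (rule det_block_skew) simp
  have "degree quartic = 4" by (simp add: quartic_def)
  then have dq: "degree ?q \<le> 8" using degree_mult_le[of quartic quartic] d by simp
  have "v = 0" if v: "syzygy_matrix ?q *v v = 0" for v :: "complex^7"
  proof -
    define cc where "cc n = v $ (inv index_of n)" for n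
    have cc: "cc (index_of k) = v $ k" for k
      using bij_index_of[where 'n = 7] by (simp add: cc_def bij_betw_def inv_f_f)
    define u where "u = (\<Sum>n<3. monom (cc n) n)"
    define w where "w = (\<Sum>n<4. monom (cc (n + 3)) n)"
    have cu: "coeff u n = cc n" if "n < 3" for n using that by (simp add: u_def coeff_sum)
    have cw: "coeff w n = cc (n + 3)" if "n < 4" for n using that by (simp add: w_def coeff_sum)
    have du: "degree u < 3" unfolding u_def
      by (rule degree_lessI) (auto simp: coeff_sum)
    have dw: "degree w < 4" unfolding w_def
      by (rule degree_lessI) (auto simp: coeff_sum)
    have "syzygy_vector u w = v"
    proof -
      have l7: "index_of k < 7" for k :: 7 using bij_index_of[where 'n = 7] by (auto simp: bij_betw_def)
      have "syzygy_vector u w $ k = v $ k" for k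
      proof (cases "index_of k < 3")
        case True
        then show ?thesis using cu[of "index_of k"] cc[of k] by (simp add: syzygy_vector_def)
      next
        case False
        then have "index_of k - 3 + 3 = index_of k" "index_of k - 3 < 4" using l7[of k] by auto
        then show ?thesis using False cw[of "index_of k - 3"] cc[of k] by (simp add: syzygy_vector_def)
      qed
      then show ?thesis by (simp add: vec_eq_iff)
    qed
    then have z: "coeff (u * ?q + w * pderiv ?q) (index_of i) = 0" for i :: 11
      using syzygy_matrix_apply[OF du dw, of ?q i] v by simp
    have "u * ?q + w * pderiv ?q = 0"
    proof (rule poly_eqI)
      fix n
      show "coeff (u * ?q + w * pderiv ?q) n = coeff 0 n"
      proof (cases "n < 11")
        case True
        then have "n \<in> index_of ` (UNIV :: 11 set)" using bij_index_of[where 'n = 11] by (simp add: bij_betw_def)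
        then show ?thesis using z by auto
      next
        case False
        have "degree (u * ?q) \<le> 10" using degree_mult_le[of u ?q] du dq by linarith
        moreover have "degree (w * pderiv ?q) \<le> 10"
          using degree_mult_le[of w "pderiv ?q"] dw dq degree_pderiv[of ?q] by linarith
        ultimately have "degree (u * ?q + w * pderiv ?q) \<le> 10" by (rule degree_add_le)
        then have "degree (u * ?q + w * pderiv ?q) < n" using False by linarith
        then show ?thesis by (simp only: coeff_eq_0 coeff_0)
      qed
    qed
    from syzygy_of_square[OF d du dw this] have "u = 0" "w = 0" by auto
    then show "v = 0" using \<open>syzygy_vector u w = v\<close> by (simp add: syzygy_vector_def vec_eq_iff flip: \<open>syzygy_vector u w = v\<close>)
  qed
  then obtain C where "C ** syzygy_matrix ?q = mat 1"
    using matrix_left_invertible_ker[of "syzygy_matrix ?q"] by blast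
  then show ?thesis
    unfolding genericity_polynomial_def fst_conv snd_conv pencil_poly_block_skew
    by (intro exI[of _ C]) simp
qed

section \<open>The theorem\<close>

lemma cone_over_complement_lines:
  assumes "\<And>k. vec.subspace (W k :: (complex^'n) set)"
  shows "cone_over (CP - (\<Union>k. projectivization (W k))) = {z. z \<noteq> 0 \<and> z \<notin> (\<Union>k. W k)}"
proof -
  have "cline z \<in> projectivization (W k) \<longleftrightarrow> z \<in> W k" if z: "z \<noteq> 0" for z k
  proof
    assume "cline z \<in> projectivization (W k)"
    then obtain w where w: "w \<in> W k" "cline w = cline z" by (auto simp: projectivization_def)
    obtain c where "z = c *s w" using cline_eqD[OF w(2) z] by metis
    then show "z \<in> W k" using vec.subspace_scale[OF assms w(1)] by simp
  qed (use z in \<open>auto simp: projectivization_def\<close>)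
  then show ?thesis by (auto simp: cone_over_def projectivization_def)
qed

text \<open>
  The Gram-Schmidt forms are nonzero where the pencil is independent; orthogonality to \<open>z\<close> is skewness.
\<close>
lemma twisted_frame_of_pencil:
  fixes M1 M2 :: "complex^8^8"
  assumes skew: "transpose M1 = - M1" "transpose M2 = - M2" and inv: "invertible M1" "invertible M2"
    and X: "X \<subseteq> CP" "open (cone_over X)"
    and indep: "\<And>z c. z \<in> cone_over X \<Longrightarrow> z v* M1 \<noteq> c *s (z v* M2)"
  shows "twisted_frame X (\<lambda>z. z v* M1) (\<lambda>z. gram_schmidt2 (z v* M1) (z v* M2))"
proof -
  have lin0: "lin (z v* M) z = 0" if "transpose M = - M" for M :: "complex^8^8" and z
    using skew_self_pairing[OF that, of z] by (simp add: lin_def)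
  have nz: "z v* M \<noteq> 0" if "z \<noteq> 0" "invertible M" for M :: "complex^8^8" and z
    using that det_zero_iff_left_kernel[of M] invertible_det_nz[of M] by auto
  have nzX: "z v* M1 \<noteq> 0" "z v* M2 \<noteq> 0" "z \<noteq> 0" if "z \<in> cone_over X" for z
    using that nz inv by (auto simp: cone_over_def)
  show ?thesis
  proof
    show "X \<subseteq> CP" "open (cone_over X)" by fact+
    fix z :: "complex^8" and c :: complex assume z: "z \<in> cone_over X"
    let ?a1 = "z v* M1" and ?a2 = "z v* M2"
    have n1: "norm_sq ?a1 \<noteq> 0" using nzX[OF z] by (simp add: norm_sq_nonzero)
    have "gram_schmidt2 ?a1 ?a2 \<noteq> 0"
    proof
      assume "gram_schmidt2 ?a1 ?a2 = 0"
      then have a2: "?a2 = (herm ?a1 ?a2 / norm_sq ?a1) *s ?a1" (is "_ = ?c *s _")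
        by (simp add: gram_schmidt2_def)
      then have c: "?c \<noteq> 0" using nzX(2)[OF z] by (metis vector_smult_lzero)
      have "(1 / ?c) *s ?a2 = (1 / ?c) *s (?c *s ?a1)" using a2 by (rule arg_cong)
      also have "\<dots> = ?a1" unfolding vector_smult_assoc using c by simp
      finally show False using indep[OF z, of "1 / ?c"] by simp
    qed
    moreover have "herm ?a1 (gram_schmidt2 ?a1 ?a2) = 0"
      using n1 by (simp add: gram_schmidt2_def herm_diff_right herm_scale_right herm_self)
    moreover have "lin (gram_schmidt2 ?a1 ?a2) z = 0"
      by (simp add: gram_schmidt2_def lin_diff_left lin_scale_left lin0 skew)
    ultimately show "orthogonal_triple ?a1 (gram_schmidt2 ?a1 ?a2) z"
      using nzX[OF z] lin0[OF skew(1)] by (simp add: orthogonal_triple_def)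
    assume c: "c \<noteq> 0"
    show "(c *s z) v* M1 = c *s ?a1" by (rule vector_matrix_linear)
    have "cnj c * c * herm ?a1 ?a2 / (c * cnj c * norm_sq ?a1) = herm ?a1 ?a2 / norm_sq ?a1"
      using c by (simp add: mult.commute)
    then show "gram_schmidt2 ((c *s z) v* M1) ((c *s z) v* M2) = c *s gram_schmidt2 ?a1 ?a2"
      unfolding vector_matrix_linear(2) gram_schmidt2_def herm_scale norm_sq_scale
      by (simp add: vector_smult_assoc mult.commute vector_ssub_ldistrib)
  next
    fix S :: "(complex^7) set" and s i
    assume s: "\<And>i. (\<lambda>x. s x $ i) \<in> rational_on S" and sX: "\<And>x. x \<in> S \<Longrightarrow> s x \<in> cone_over X"
    have a: "(\<lambda>x. (s x v* M) $ i) \<in> rational_on S" for M :: "complex^8^8" and i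
      unfolding vector_matrix_mult_def vec_lambda_beta by (intro rational_on_intros s)
    show "(\<lambda>x. (s x v* M1) $ i) \<in> rational_on S" by (rule a)
    show "(\<lambda>x. gram_schmidt2 (s x v* M1) (s x v* M2) $ i) \<in> rational_on S"
      unfolding gram_schmidt2_def using nzX sX
      by (intro rational_on_vdiff rational_on_scale rational_on_divide rational_on_herm rational_on_norm_sq a)
         (simp add: norm_sq_nonzero)
  qed
qed

lemma Re_herm: "Re (lin (cnjv p) v) = p \<bullet> v"
  by (simp add: lin_def cnjv_def inner_vec_def inner_complex_def)

text \<open>
  On vectors tangent to the sphere the covector \<open>cnjv p\<close> is purely imaginary, so its term vanishes.
\<close>
lemma twisted_omega_eq:
  assumes "norm p = 1" "\<forall>i<2. p \<bullet> v i = 0"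
  shows "twisted_omega \<alpha>1 \<alpha>2 p v = - omega_hat (\<alpha>1 p) (gram_schmidt2 (\<alpha>1 p) (\<alpha>2 p)) p v"
proof -
  have "Re (lin (cnjv p) (v 0)) = 0" "Re (lin (cnjv p) (v 1)) = 0" using assms(2) by (simp_all add: Re_herm)
  then have "pair_form (cnjv p) v = 0" by (simp add: pair_form_def complex_eq_iff)
  moreover have "norm_sq p = 1" using assms(1) by (simp add: norm_sq_def)
  ultimately show ?thesis
    unfolding twisted_omega_def omega_hat_def Let_def wedge_form10_cnj by simp
qed

lemma smooth_form_on_uminus:
  assumes "smooth_form_on k S \<theta>" "open S"
  shows "smooth_form_on k S (\<lambda>x v. - \<theta> x v)"
proof -
  have "Ck_on n S (\<lambda>x. - f x)" if "Ck_on n S f" for n and f :: "'a \<Rightarrow> complex"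
    using that
  proof (induction n arbitrary: f)
    case 0
    then show ?case by (simp add: continuous_on_minus)
  next
    case (Suc n)
    have d: "((\<lambda>x. - f x) has_derivative (\<lambda>v. - frechet_derivative f (at x) v)) (at x)" if "x \<in> S" for x
      using Suc.prems that by (intro has_derivative_minus) (simp add: frechet_derivative_works[symmetric])
    have "Ck_on n S (\<lambda>x. - frechet_derivative f (at x) v)" for v using Suc by simp
    then have "Ck_on n S (\<lambda>x. frechet_derivative (\<lambda>x. - f x) (at x) v)" for v
      by (rule Ck_on_cong[OF _ assms(2)]) (simp add: frechet_derivative_at[OF d, symmetric])
    then show ?case using d by (auto simp: differentiable_def)
  qed
  then have neg: "smooth_on S (\<lambda>x. - \<theta> x v)" for v
    using assms(1) by (simp add: smooth_form_on_def smooth_on_def)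
  have "alternating_form k (\<lambda>v. - \<theta> x v)" if x: "x \<in> S" for x
  proof -
    have a: "alternating_form k (\<theta> x)" using assms(1) x by (simp add: smooth_form_on_def)
    have 1: "\<theta> x v = \<theta> x w" if "\<forall>i<k. v i = w i" for v w
      using a that unfolding alternating_form_def by blast
    have 2: "linear (\<lambda>y. \<theta> x (v(i := y)))" if "i < k" for v i
      using a that unfolding alternating_form_def by blast
    have 3: "\<theta> x v = 0" if "i < k" "j < k" "i \<noteq> j \<and> v i = v j" for v i j
      using a that unfolding alternating_form_def by blast
    show ?thesis
      unfolding alternating_form_def
    proof (intro conjI allI impI)
      show "- \<theta> x v = - \<theta> x w" if "\<forall>i<k. v i = w i" for v w using 1[OF that] by simp
      show "linear (\<lambda>y. - \<theta> x (v(i := y)))" if "i < k" for v i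
        by (rule linear_compose_neg[OF 2[OF that]])
      show "- \<theta> x v = 0" if "i < k" "j < k" "i \<noteq> j \<and> v i = v j" for v i j
        using 3[OF that] by simp
    qed
  qed
  with neg show ?thesis by (simp add: smooth_form_on_def)
qed

definition generic_pairs :: "((complex^8^8) \<times> (complex^8^8)) set" where
  "generic_pairs = {x \<in> invertible_skew \<times> invertible_skew. \<exists>f\<in>range genericity_polynomial. f x \<noteq> 0}"

lemma zariski_open_generic_pairs:
  "zariski_open_in matrix_pair_coords (invertible_skew \<times> invertible_skew) generic_pairs"
  unfolding zariski_open_in_def generic_pairs_def using genericity_polynomial
  by (intro exI[of _ "range genericity_polynomial"]) auto

lemma generic_pairs_nonempty: "generic_pairs \<noteq> {}"
proof -
  have "(block_skew (\<lambda>k. of_nat (Suc k)), block_skew (\<lambda>k. 1)) \<in> generic_pairs"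
    unfolding generic_pairs_def
    using ex_generic_pair by (auto intro!: block_skew_invertible_skew simp del: of_nat_Suc)
  then show ?thesis by blast
qed

lemma SU_structure_of_generic_pair:
  fixes M1 M2 :: "complex^8^8"
  assumes generic: "(M1, M2) \<in> generic_pairs"
    and \<alpha>: "\<forall>z. z \<noteq> 0 \<longrightarrow> \<alpha>1 z = matrix_form M1 z" "\<forall>z. z \<noteq> 0 \<longrightarrow> \<alpha>2 z = matrix_form M2 z"
  shows "\<exists>W. four_generic_lines W \<and>
      (let X = CP - (\<Union>k. projectivization (W k)) in
       \<exists>\<Omega> \<omega> :: ((complex^8) set, complex^7) mform.
         defines_form 7 X (twisted_Omega \<alpha>1 \<alpha>2) \<Omega> \<and>
         defines_form 2 X (twisted_omega \<alpha>1 \<alpha>2) \<omega> \<and>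
         SU_structure 7 X (CP_atlas X) \<Omega> (\<lambda>c x v. - \<omega> c x v))"
proof -
  obtain C where M: "M1 \<in> invertible_skew" "M2 \<in> invertible_skew" and C: "genericity_polynomial C (M1, M2) \<noteq> 0"
    using generic by (auto simp: generic_pairs_def)
  have skew: "transpose M1 = - M1" "transpose M2 = - M2" and inv: "invertible M1" "invertible M2"
    using M by (auto simp: invertible_skew_def)
  have q: "pencil_poly M1 M2 \<noteq> 0" "card {x. poly (pencil_poly M1 M2) x = 0} \<ge> 4"
    using det_syzygy_four_roots[of C "pencil_poly M1 M2"] C by (simp_all add: genericity_polynomial_def)
  obtain W :: "4 \<Rightarrow> (complex^8) set" where W: "four_generic_lines W" "\<And>k. closed (W k)"
    "\<And>z c. z \<noteq> 0 \<Longrightarrow> z v* M1 = c *s (z v* M2) \<Longrightarrow> z \<in> (\<Union>k. W k)"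
    using degeneracy_planes[OF skew inv(2) q] by metis
  define X where "X = CP - (\<Union>k. projectivization (W k))"
  have cone: "cone_over X = {z. z \<noteq> 0 \<and> z \<notin> (\<Union>k. W k)}"
    unfolding X_def by (rule cone_over_complement_lines) (use W(1) in \<open>simp add: four_generic_lines_def\<close>)
  have "closed (\<Union>k. W k)" using W(2) by (intro closed_UN) auto
  then have op: "open (cone_over X)"
    unfolding cone by (intro open_Collect_conj open_Collect_neq) (auto simp: closed_def Compl_eq)
  have sub: "X \<subseteq> CP" by (auto simp: X_def)
  interpret twisted_frame X "\<lambda>z. z v* M1" "\<lambda>z. gram_schmidt2 (z v* M1) (z v* M2)"
    by (rule twisted_frame_of_pencil[OF skew inv sub op]) (use W(3) cone in blast)
  let ?\<omega> = "\<lambda>z v. - omega_cone z v"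
  have neg: "descended_form ?\<omega> = (\<lambda>c x v. - descended_form omega_cone c x v)"
    by (simp add: descended_form_def fun_eq_iff split: prod.splits)
  have b\<omega>: "cone_basic (cone_over X) ?\<omega>" using basic_omega_cone by (simp add: cone_basic_def)
  have "defines_form 7 X (twisted_Omega \<alpha>1 \<alpha>2) (descended_form Omega_cone :: ((complex^8) set, complex^7) mform)"
    unfolding defines_form_def
  proof (intro conjI)
    show "differential_form 7 (CP_atlas X) (descended_form Omega_cone :: ((complex^8) set, complex^7) mform)"
      using SU_structure_descended by (simp add: SU_structure_def)
    have "twisted_Omega \<alpha>1 \<alpha>2 p v = pullback (\<phi> \<circ> cline) (descended_form Omega_cone (U, \<phi>)) p v"
      if c: "(U, \<phi>) \<in> (CP_atlas X :: ((complex^8) set, complex^7) chart set)" and p: "norm p = 1" "cline p \<in> U" for U \<phi> p v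
    proof -
      have "p \<noteq> 0" "norm_sq p = 1" using p by (auto simp: norm_sq_def)
      then have "twisted_Omega \<alpha>1 \<alpha>2 p v = Omega_cone p v"
        using \<alpha> by (simp add: twisted_Omega_eq Omega_cone_def Omega_hat_def matrix_form_def)
      then show ?thesis using pullback_to_sphere[OF c sub op basic_Omega_cone p] by simp
    qed
    then show "\<forall>(U, \<phi>)\<in>(CP_atlas X :: ((complex^8) set, complex^7) chart set). \<forall>p. norm p = 1 \<and> cline p \<in> U \<longrightarrow>
      (\<forall>v. (\<forall>i<7. p \<bullet> v i = 0) \<longrightarrow> twisted_Omega \<alpha>1 \<alpha>2 p v = pullback (\<phi> \<circ> cline) (descended_form Omega_cone (U, \<phi>)) p v)"
      by blast
  qed
  moreover have "defines_form 2 X (twisted_omega \<alpha>1 \<alpha>2) (descended_form ?\<omega> :: ((complex^8) set, complex^7) mform)"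
    unfolding defines_form_def
  proof (intro conjI)
    show "differential_form 2 (CP_atlas X) (descended_form ?\<omega> :: ((complex^8) set, complex^7) mform)"
      by (rule differential_form_descended[OF sub op b\<omega>])
         (rule smooth_form_on_uminus[OF smooth_omega_cone open_S0])
    have "twisted_omega \<alpha>1 \<alpha>2 p v = pullback (\<phi> \<circ> cline) (descended_form ?\<omega> (U, \<phi>)) p v"
      if c: "(U, \<phi>) \<in> (CP_atlas X :: ((complex^8) set, complex^7) chart set)" and p: "norm p = 1" "cline p \<in> U"
        and v: "\<forall>i<2. p \<bullet> v i = 0" for U \<phi> p v
    proof -
      have "p \<noteq> 0" using p by auto
      then have "twisted_omega \<alpha>1 \<alpha>2 p v = - omega_cone p v"
        using \<alpha> twisted_omega_eq[OF p(1) v, of \<alpha>1 \<alpha>2] by (simp add: omega_cone_def matrix_form_def)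
      then show ?thesis using pullback_to_sphere[OF c sub op b\<omega> p] by simp
    qed
    then show "\<forall>(U, \<phi>)\<in>(CP_atlas X :: ((complex^8) set, complex^7) chart set). \<forall>p. norm p = 1 \<and> cline p \<in> U \<longrightarrow>
      (\<forall>v. (\<forall>i<2. p \<bullet> v i = 0) \<longrightarrow> twisted_omega \<alpha>1 \<alpha>2 p v = pullback (\<phi> \<circ> cline) (descended_form ?\<omega> (U, \<phi>)) p v)"
      by blast
  qed
  moreover have "SU_structure 7 X (CP_atlas X :: ((complex^8) set, complex^7) chart set)
      (descended_form Omega_cone) (\<lambda>c x v. - descended_form ?\<omega> c x v)"
    unfolding neg minus_minus by (rule SU_structure_descended)
  ultimately show ?thesis
    unfolding Let_def X_def using W(1) by blast
qed

theorem theorem6: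
  shows "generic_skew_pair (\<lambda>M1 M2 :: complex^8^8. \<forall>\<alpha>1 \<alpha>2.
    holomorphic_twist_form 2 \<alpha>1 \<and> (\<forall>z. z \<noteq> 0 \<longrightarrow> \<alpha>1 z = matrix_form M1 z) \<and>
    holomorphic_twist_form 2 \<alpha>2 \<and> (\<forall>z. z \<noteq> 0 \<longrightarrow> \<alpha>2 z = matrix_form M2 z) \<longrightarrow>
    (\<exists>W. four_generic_lines W \<and>
      (let X = CP - (\<Union>k. projectivization (W k)) in
       \<exists>\<Omega> \<omega> :: ((complex^8) set, complex^7) mform.
         defines_form 7 X (twisted_Omega \<alpha>1 \<alpha>2) \<Omega> \<and>
         defines_form 2 X (twisted_omega \<alpha>1 \<alpha>2) \<omega> \<and>
         SU_structure 7 X (CP_atlas X) \<Omega> (\<lambda>c x v. - \<omega> c x v))))"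
  unfolding generic_skew_pair_def
proof (intro exI[of _ generic_pairs] conjI zariski_open_generic_pairs generic_pairs_nonempty, clarify)
  fix M1 M2 :: "complex^8^8" and \<alpha>1 \<alpha>2
  assume "(M1, M2) \<in> generic_pairs"
    and "\<forall>z. z \<noteq> 0 \<longrightarrow> \<alpha>1 z = matrix_form M1 z" "\<forall>z. z \<noteq> 0 \<longrightarrow> \<alpha>2 z = matrix_form M2 z"
  then show "\<exists>W. four_generic_lines W \<and>
      (let X = CP - (\<Union>k. projectivization (W k)) in
       \<exists>\<Omega> \<omega> :: ((complex^8) set, complex^7) mform.
         defines_form 7 X (twisted_Omega \<alpha>1 \<alpha>2) \<Omega> \<and>
         defines_form 2 X (twisted_omega \<alpha>1 \<alpha>2) \<omega> \<and>
         SU_structure 7 X (CP_atlas X) \<Omega> (\<lambda>c x v. - \<omega> c x v))"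
    by (rule SU_structure_of_generic_pair)
qed

end
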